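(* Let $K$ be an infinite field, let $n,r\in\mathbb{N}$ (positive integers), and let $A$ be the $K$-algebra with involution $(\mathrm{M}_n(K)\times \mathrm{M}_n(K),\ (a,b)\mapsto (b^{\mathrm t},a^{\mathrm t}))$. Let $Z_r$ be the closed subscheme of non-generating $r$-tuples in the affine space $V_r$ underlying $A^r$. Then \[\dim Z_r = \begin{cases} 2rn^2-(2r-1)(n-1) & n>1,\\ r & n=1.\end{cases}\]
   Context: Algebras are associative and unital; $a^{\mathrm t}$ denotes the transpose of $a$. Here $A$ is viewed as a unital $K$-algebra with involution: subalgebras must contain the unity and be stable under the involution, and a set generates $A$ if the smallest such subalgebra containing it is $A$. For $r\in\mathbb{N}$, $V_r$ denotes the $K$-affine space underlying the vector space $A^r$, and $Z_r$ is the closed subscheme of $V_r$ such that for every field extension $L/K$, $Z_r(L)=\{(a_1,\dots,a_r)\in A_L^r : a_1,\dots,a_r \text{ do not generate } A_L\}$, where $A_L=A\otimes_K L$ is viewed as a unital $L$-algebra with involution. *)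

theory Defs
  imports
    "HOL-Algebra.Algebra"
    "HOL-Algebra.Algebraic_Closure_Type"
    "Jordan_Normal_Form.Matrix"
    "HOL-Library.Poly_Mapping"
    "HOL-Library.Extended_Real"
begin

section \<open>The algebra with involution\<close>

definition matrix_ring :: "('l, 'm) ring_scheme \<Rightarrow> nat \<Rightarrow> 'l mat ring" where
  "matrix_ring L n =
    \<lparr> carrier = {M \<in> carrier_mat n n. elements_mat M \<subseteq> carrier L},
      monoid.mult = (\<lambda>M N. mat n n (\<lambda>(i, j). \<Oplus>\<^bsub>L\<^esub>k\<in>{..<n}. M $$ (i, k) \<otimes>\<^bsub>L\<^esub> N $$ (k, j))),
      monoid.one = mat n n (\<lambda>(i, j). if i = j then \<one>\<^bsub>L\<^esub> else \<zero>\<^bsub>L\<^esub>),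
      ring.zero = mat n n (\<lambda>(i, j). \<zero>\<^bsub>L\<^esub>),
      ring.add = (\<lambda>M N. mat n n (\<lambda>(i, j). M $$ (i, j) \<oplus>\<^bsub>L\<^esub> N $$ (i, j))) \<rparr>"

text \<open>For an extension \<open>L\<close> of \<open>K\<close> the algebra \<open>A\<^sub>L\<close>, the tensor product of \<open>A\<close> with \<open>L\<close> over \<open>K\<close>,
  is \<open>M\<^sub>n(L) \<times> M\<^sub>n(L)\<close> with the involution given by the same formula.\<close>

definition alg :: "('l, 'm) ring_scheme \<Rightarrow> nat \<Rightarrow> ('l mat \<times> 'l mat) ring" where
  "alg L n = RDirProd (matrix_ring L n) (matrix_ring L n)"

definition invol :: "'l mat \<times> 'l mat \<Rightarrow> 'l mat \<times> 'l mat" where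
  "invol = (\<lambda>(a, b). (transpose_mat b, transpose_mat a))"

definition scalars :: "('l, 'm) ring_scheme \<Rightarrow> nat \<Rightarrow> ('l mat \<times> 'l mat) set" where
  "scalars L n =
    (\<lambda>c. let C = mat n n (\<lambda>(i, j). if i = j then c else \<zero>\<^bsub>L\<^esub>) in (C, C)) ` carrier L"

text \<open>The locale \<open>subalgebra\<close> only asks for a subspace; multiplication and unity come from
  \<open>subring\<close>.\<close>

definition invol_subalgebra ::
    "('l, 'm) ring_scheme \<Rightarrow> nat \<Rightarrow> ('l mat \<times> 'l mat) set \<Rightarrow> bool" where
  "invol_subalgebra L n B \<longleftrightarrow>
    subring B (alg L n) \<and> subalgebra (scalars L n) B (alg L n) \<and> invol ` B \<subseteq> B"

definition generates ::
    "('l, 'm) ring_scheme \<Rightarrow> nat \<Rightarrow> ('l mat \<times> 'l mat) set \<Rightarrow> bool" where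
  "generates L n S \<longleftrightarrow> \<Inter>{B. invol_subalgebra L n B \<and> S \<subseteq> B} = carrier (alg L n)"


section \<open>The affine space underlying \<open>A\<^sup>r\<close>\<close>

text \<open>The coordinate \<open>(k, s, i, j)\<close> of \<open>(a\<^sub>0, \<dots>, a\<^sub>r\<^sub>-\<^sub>1)\<close> is the \<open>(i, j)\<close> entry of the first
  (\<open>s = False\<close>) or second (\<open>s = True\<close>) component of \<open>a\<^sub>k\<close>.\<close>

type_synonym var = "nat \<times> bool \<times> nat \<times> nat"

type_synonym 'k mpoly = "(var \<Rightarrow>\<^sub>0 nat) \<Rightarrow>\<^sub>0 'k"

definition vars :: "nat \<Rightarrow> nat \<Rightarrow> var set" where
  "vars n r = {..<r} \<times> UNIV \<times> {..<n} \<times> {..<n}"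

definition coord_ring :: "nat \<Rightarrow> nat \<Rightarrow> 'k::comm_ring_1 mpoly ring" where
  "coord_ring n r =
    ring_of_type_algebra \<lparr> carrier := {f. \<forall>m \<in> Poly_Mapping.keys f. Poly_Mapping.keys m \<subseteq> vars n r} \<rparr>"

definition coord :: "(nat \<Rightarrow> 'l mat \<times> 'l mat) \<Rightarrow> var \<Rightarrow> 'l" where
  "coord a = (\<lambda>(k, s, i, j). (if s then snd (a k) else fst (a k)) $$ (i, j))"

definition mpoly_eval ::
    "('l, 'm) ring_scheme \<Rightarrow> ('k::zero \<Rightarrow> 'l) \<Rightarrow> (var \<Rightarrow> 'l) \<Rightarrow> 'k mpoly \<Rightarrow> 'l" where
  "mpoly_eval L \<phi> x f =
    (\<Oplus>\<^bsub>L\<^esub>m \<in> Poly_Mapping.keys f.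
      \<phi> (Poly_Mapping.lookup f m) \<otimes>\<^bsub>L\<^esub>
      (\<Otimes>\<^bsub>L\<^esub>v \<in> Poly_Mapping.keys m. x v [^]\<^bsub>L\<^esub> Poly_Mapping.lookup m v))"

definition affine_points :: "('l, 'm) ring_scheme \<Rightarrow> nat \<Rightarrow> nat \<Rightarrow> (nat \<Rightarrow> 'l mat \<times> 'l mat) set" where
  "affine_points L n r = {..<r} \<rightarrow>\<^sub>E carrier (alg L n)"

definition closed_points ::
    "'k::zero mpoly set \<Rightarrow> ('l, 'm) ring_scheme \<Rightarrow> ('k \<Rightarrow> 'l) \<Rightarrow> nat \<Rightarrow> nat \<Rightarrow> (nat \<Rightarrow> 'l mat \<times> 'l mat) set"
  where
  "closed_points I L \<phi> n r =
    {a \<in> affine_points L n r. \<forall>f \<in> I. mpoly_eval L \<phi> (coord a) f = \<zero>\<^bsub>L\<^esub>}"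


section \<open>The scheme of non-generating tuples\<close>

text \<open>A closed subscheme of \<open>V\<^sub>r\<close> is given by an ideal of the coordinate ring. HOL cannot quantify
  over types inside a formula, so the carriers of the extension fields \<open>L\<close> are taken inside the
  fixed type of sets of pairs of polynomials. It contains, as sets of numerators and denominators,
  the residue fields of all points of \<open>V\<^sub>r\<close>, hence up to isomorphism every extension of \<open>K\<close>
  generated by the coordinates of a tuple. Whether a tuple generates, and whether it is a zero of
  the ideal, does not change when \<open>L\<close> is enlarged, so this is no restriction.\<close>

type_synonym 'k ext_carrier = "('k mpoly \<times> 'k mpoly) set"

definition nongenerating_subscheme :: "nat \<Rightarrow> nat \<Rightarrow> 'k::field mpoly set \<Rightarrow> bool" where
  "nongenerating_subscheme n r I \<longleftrightarrow>
    ideal I (coord_ring n r) \<and>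
    (\<forall>(L :: 'k ext_carrier ring) \<phi>.
      field L \<and> \<phi> \<in> Ring.ring_hom ring_of_type_algebra L \<longrightarrow>
      closed_points I L \<phi> n r =
        {a \<in> affine_points L n r. \<not> generates L n (a ` {..<r})})"


section \<open>Dimension\<close>

text \<open>The supremum is taken in \<^typ>\<open>ereal\<close>, so that the empty scheme has dimension \<open>-\<infinity>\<close>.\<close>

definition krull_dim :: "('a, 'm) ring_scheme \<Rightarrow> ereal" where
  "krull_dim R =
    Sup {ereal (real d) | d. \<exists>P :: nat \<Rightarrow> 'a set.
      (\<forall>i\<le>d. primeideal (P i) R) \<and> (\<forall>i<d. P i \<subset> P (Suc i))}"

definition subscheme_dim :: "nat \<Rightarrow> nat \<Rightarrow> 'k::field mpoly set \<Rightarrow> ereal" where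
  "subscheme_dim n r I = krull_dim (coord_ring n r Quot I)"

end

theory Submission
  imports Defs "Jordan_Normal_Form.Char_Poly" "HOL-Library.Product_Lexorder"
begin

text \<open>
  By Burnside's theorem, a tuple \<open>(a\<^sub>k, b\<^sub>k)\<close> over an algebraically closed field fails to generate in one
  of two ways: either the matrices \<open>a\<^sub>k\<close> and \<open>b\<^sub>k\<^sup>t\<close> preserve a common subspace of dimension \<open>m\<close> with
  \<open>0 < m < n\<close>, or they generate the graph of an inner automorphism, \<open>b\<^sub>k = g a\<^sub>k g\<^sup>-\<^sup>1\<close>, where \<open>g\<^sup>t = \<plusminus>g\<close>
  because the graph is stable under the involution. The coordinates of such a tuple are rational
  functions in \<open>m(n - m) + 2r(n\<^sup>2 - m(n - m))\<close>, respectively \<open>rn\<^sup>2 + n(n + 1)/2 - 1\<close>, of its entries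
  and those of the subspace or of \<open>g\<close>; for \<open>n > 1\<close> the largest of these numbers belongs to
  \<open>m = 1\<close>.

  For the upper bound, choosing \<open>f\<^sub>i \<in> P\<^sub>i\<^sub>+\<^sub>1 - P\<^sub>i\<close> along a chain of primes \<open>P\<^sub>0 \<subset> \<dots> \<subset> P\<^sub>d\<close> yields \<open>d\<close>
  elements that are algebraically independent modulo \<open>P\<^sub>0\<close>, and the residue field of \<open>P\<^sub>0\<close> carries a
  nongenerating tuple. For the lower bound, the generic tuple with a common eigenvector is specialized
  by letting its parameters vanish one at a time; the parameters that hide the eigenvector go first,
  so that its coordinates can be read off the tuple when their turn comes.
\<close>

section \<open>Rational functions and algebraic independence\<close>

text \<open>Neither bound goes through transcendence degrees or the dimension theory of finitely
  generated algebras: lengths of prime chains are bounded by counting monomials, and a longest chain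
  is written down explicitly. Two points shape the upper bound. The subscheme is tested only over
  fields whose elements are sets of pairs of polynomials, while Burnside's theorem needs an
  algebraically closed field. A proper subalgebra is therefore found over the residue field, and its
  scalars are extended afterwards; it stays proper because a linear form that vanishes on it
  survives the extension. Moreover the parameters need not be independent: it is enough that all
  coordinates lie in the field generated by a set of the right cardinality.

  The constant is explained as follows. A line in n-space has n - 1 parameters, and preserving it
  costs each of 2r matrices n - 1 entries, which gives (n - 1) + 2r(n^2 - (n - 1)). For n = 1 no
  proper nonzero subspace exists, and the graph case gives r.\<close>

locale field_ext = comm_ring_hom \<kappa> for \<kappa> :: "'k::field \<Rightarrow> 'f::field"
begin

sublocale V: vector_space "\<lambda>c x. \<kappa> c * x"
  by unfold_locales (auto simp: algebra_simps hom_add hom_mult)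

definition monomial :: "'f set \<Rightarrow> ('f \<Rightarrow> nat) \<Rightarrow> 'f" where
  "monomial T m = (\<Prod>t\<in>T. t ^ m t)"

text \<open>The bound \<open>c\<close> applies to the exponent of each element of \<open>T\<close>
  separately. The exponents thus form a box: bounds add under multiplication, and for finite
  \<open>T\<close> there are exactly \<open>(c + 1) ^ card T\<close> exponent functions.\<close>

definition poly_span :: "'f set \<Rightarrow> nat \<Rightarrow> 'f set" where
  "poly_span T c = V.span (monomial T ` (T \<rightarrow>\<^sub>E {..c}))"

text \<open>For finite \<open>T\<close> this is the subfield generated by \<open>T\<close> over the
  image of \<open>\<kappa>\<close>. Numerator and denominator share a degree bound, since the
  counting argument has to control degrees.\<close>

definition ratfun :: "'f set \<Rightarrow> 'f set" where
  "ratfun T = {x. \<exists>c p q. p \<in> poly_span T c \<and> q \<in> poly_span T c \<and> q \<noteq> 0 \<and> x * q = p}"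

section \<open>Closure properties of polynomial spans and of the field they generate\<close>

lemma poly_span_mult:
  assumes "x \<in> poly_span T c" "y \<in> poly_span T c'"
  shows "x * y \<in> poly_span T (c + c')"
proof -
  have mono: "monomial T m * y \<in> poly_span T (c + c')" if m: "m \<in> T \<rightarrow>\<^sub>E {..c}" for m
    using assms(2) unfolding poly_span_def
  proof (induction rule: V.span_induct)
    case base
    show ?case
      unfolding V.subspace_def
      by (auto simp: distrib_left mult.left_commute intro: V.span_zero V.span_add V.span_scale)
  next
    case (step z)
    then obtain m' where m': "m' \<in> T \<rightarrow>\<^sub>E {..c'}" "z = monomial T m'" by auto
    have "monomial T m * z = monomial T (restrict (\<lambda>t. m t + m' t) T)"
      by (auto simp: m'(2) monomial_def power_add prod.distrib intro!: prod.cong)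
    moreover have "restrict (\<lambda>t. m t + m' t) T \<in> T \<rightarrow>\<^sub>E {..c + c'}"
      using m m'(1) by (auto simp: PiE_iff intro!: add_mono)
    ultimately show ?case by (auto intro!: V.span_base)
  qed
  show ?thesis
    using assms(1) unfolding poly_span_def
  proof (induction rule: V.span_induct)
    case base
    show ?case
      unfolding V.subspace_def
      by (auto simp: distrib_right mult.assoc intro: V.span_zero V.span_add V.span_scale)
  next
    case (step z)
    then show ?case using mono by (auto simp: poly_span_def)
  qed
qed

lemma poly_span_one: "1 \<in> poly_span T c"
proof -
  have "monomial T (restrict (\<lambda>_. 0) T) = 1" by (simp add: monomial_def)
  moreover have "restrict (\<lambda>_. 0) T \<in> T \<rightarrow>\<^sub>E {..c}" by auto
  ultimately show ?thesis unfolding poly_span_def by (metis V.span_base image_eqI)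
qed

lemma poly_span_const: "\<kappa> a \<in> poly_span T c"
  using V.span_scale[of 1 _ a] poly_span_one[of T c] unfolding poly_span_def by fastforce

lemma poly_span_gen:
  assumes "finite T" "t \<in> T" shows "t \<in> poly_span T 1"
proof -
  let ?m = "restrict (\<lambda>u. if u = t then 1 else 0) T :: 'f \<Rightarrow> nat"
  have "monomial T ?m = (\<Prod>u\<in>T. if u = t then t else 1)"
    unfolding monomial_def by (intro prod.cong) auto
  then have "monomial T ?m = t" using assms by simp
  moreover have "?m \<in> T \<rightarrow>\<^sub>E {..1}" by auto
  ultimately show ?thesis unfolding poly_span_def by (metis V.span_base image_eqI)
qed

lemma poly_span_power:
  "x \<in> poly_span T c \<Longrightarrow> x ^ m \<in> poly_span T (c * m)"
  by (induction m) (auto simp: poly_span_one dest: poly_span_mult)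

lemma poly_span_prod:
  assumes "finite I" "\<And>i. i \<in> I \<Longrightarrow> f i \<in> poly_span T c"
  shows "(\<Prod>i\<in>I. f i) \<in> poly_span T (card I * c)"
  using assms by (induction I) (auto simp: poly_span_one dest: poly_span_mult)

lemma poly_span_ratfun: "x \<in> poly_span T c \<Longrightarrow> x \<in> ratfun T"
  unfolding ratfun_def using poly_span_one[of T c] by (intro CollectI exI[of _ c] exI[of _ x] exI[of _ 1]) auto

lemma ratfun_const: "\<kappa> a \<in> ratfun T"
  using poly_span_const poly_span_ratfun by blast

lemma ratfun_0: "0 \<in> ratfun T" and ratfun_1: "1 \<in> ratfun T"
  using ratfun_const[of 0] ratfun_const[of 1] by auto

lemma ratfun_gen: "finite T \<Longrightarrow> t \<in> T \<Longrightarrow> t \<in> ratfun T"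
  using poly_span_gen poly_span_ratfun by blast

lemma ratfun_mult:
  assumes "x \<in> ratfun T" "y \<in> ratfun T" shows "x * y \<in> ratfun T"
proof -
  from assms obtain c p q c' p' q' where
    "p \<in> poly_span T c" "q \<in> poly_span T c" "q \<noteq> 0" "x * q = p"
    "p' \<in> poly_span T c'" "q' \<in> poly_span T c'" "q' \<noteq> 0" "y * q' = p'"
    unfolding ratfun_def by auto
  then show ?thesis unfolding ratfun_def
    by (intro CollectI exI[of _ "c + c'"] exI[of _ "p * p'"] exI[of _ "q * q'"])
      (auto intro: poly_span_mult)
qed

lemma ratfun_add:
  assumes "x \<in> ratfun T" "y \<in> ratfun T" shows "x + y \<in> ratfun T"
proof -
  from assms obtain c p q c' p' q' where *:
    "p \<in> poly_span T c" "q \<in> poly_span T c" "q \<noteq> 0" "x * q = p"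
    "p' \<in> poly_span T c'" "q' \<in> poly_span T c'" "q' \<noteq> 0" "y * q' = p'"
    unfolding ratfun_def by auto
  have "p * q' + q * p' \<in> poly_span T (c + c')"
    using poly_span_mult[OF *(1,6)] poly_span_mult[OF *(2,5)]
    unfolding poly_span_def by (rule V.span_add)
  moreover have "(x + y) * (q * q') = p * q' + q * p'"
    unfolding *(4)[symmetric] *(8)[symmetric] by (simp add: algebra_simps)
  moreover have "q * q' \<in> poly_span T (c + c')" "q * q' \<noteq> 0"
    using * by (auto intro: poly_span_mult)
  ultimately show ?thesis unfolding ratfun_def by blast
qed

lemma ratfun_inverse:
  assumes "x \<in> ratfun T" shows "inverse x \<in> ratfun T"
proof (cases "x = 0")
  case False
  from assms obtain c p q where
    *: "p \<in> poly_span T c" "q \<in> poly_span T c" "q \<noteq> 0" "x * q = p"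
    unfolding ratfun_def by auto
  then have "p \<noteq> 0" "inverse x * p = q" using False by auto
  then show ?thesis unfolding ratfun_def using * by blast
qed (simp add: ratfun_0)

lemma ratfun_uminus: "x \<in> ratfun T \<Longrightarrow> - x \<in> ratfun T"
  using ratfun_mult[OF ratfun_const[of "-1"], of x] by (simp add: hom_uminus)

lemma ratfun_diff: "x \<in> ratfun T \<Longrightarrow> y \<in> ratfun T \<Longrightarrow> x - y \<in> ratfun T"
  using ratfun_add[OF _ ratfun_uminus, of x T y] by simp

lemma ratfun_power: "x \<in> ratfun T \<Longrightarrow> x ^ m \<in> ratfun T"
  by (induction m) (auto simp: ratfun_1 ratfun_mult)

lemma ratfun_sum: "(\<And>i. i \<in> I \<Longrightarrow> f i \<in> ratfun T) \<Longrightarrow> sum f I \<in> ratfun T"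
  by (induction I rule: infinite_finite_induct) (auto simp: ratfun_0 ratfun_add)

lemma ratfun_prod: "(\<And>i. i \<in> I \<Longrightarrow> f i \<in> ratfun T) \<Longrightarrow> prod f I \<in> ratfun T"
  by (induction I rule: infinite_finite_induct) (auto simp: ratfun_1 ratfun_mult)

text \<open>A single \<open>q\<close> with a single degree bound allows a monomial with exponents at
  most \<open>s\<close> to be cleared of denominators at a cost linear in \<open>s\<close>.\<close>

lemma ratfun_common_denominator:
  fixes d :: nat
  assumes "\<And>i. i < d \<Longrightarrow> f i \<in> ratfun T"
  shows "\<exists>c q. q \<noteq> 0 \<and> q \<in> poly_span T c \<and> (\<forall>i<d. f i * q \<in> poly_span T c)"
  using assms
proof (induction d)
  case 0
  show ?case using poly_span_one by (intro exI[of _ 0] exI[of _ 1]) auto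
next
  case (Suc d)
  then obtain c q where 1: "q \<noteq> 0" "q \<in> poly_span T c" "\<And>i. i < d \<Longrightarrow> f i * q \<in> poly_span T c"
    by (metis less_SucI)
  obtain c' p' q' where 2: "p' \<in> poly_span T c'" "q' \<in> poly_span T c'" "q' \<noteq> 0" "f d * q' = p'"
    using Suc.prems[of d] unfolding ratfun_def by auto
  have "f i * (q * q') \<in> poly_span T (c + c')" if "i < Suc d" for i
  proof (cases "i = d")
    case True
    then have "f i * (q * q') = q * p'" unfolding 2(4)[symmetric] by (simp add: algebra_simps)
    then show ?thesis using poly_span_mult[OF 1(2) 2(1)] by (simp only:)
  next
    case False
    then show ?thesis using that poly_span_mult[OF 1(3) 2(2), of i] by (simp add: algebra_simps)
  qed
  then show ?case using 1 2 poly_span_mult[OF 1(2) 2(2)]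
    by (intro exI[of _ "c + c'"] exI[of _ "q * q'"]) auto
qed

text \<open>Every polynomial relation among the \<open>f i\<close> fits into some box of exponents,
  so quantifying over the side \<open>s\<close> replaces a polynomial ring in \<open>d\<close>
  variables. Extensional functions index each monomial once.\<close>

definition alg_indep :: "nat \<Rightarrow> (nat \<Rightarrow> 'f) \<Rightarrow> bool" where
  "alg_indep d f \<longleftrightarrow> (\<forall>s g. (\<Sum>m\<in>{..<d} \<rightarrow>\<^sub>E {..s}. \<kappa> (g m) * (\<Prod>i<d. f i ^ m i)) = 0 \<longrightarrow>
     (\<forall>m\<in>{..<d} \<rightarrow>\<^sub>E {..s}. g m = 0))"

text \<open>Counting: the \<open>(s + 1)\<^sup>d\<close> monomials in \<open>f\<close> with exponents at most \<open>s\<close>, cleared of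
  denominators, are independent elements of a space of dimension \<open>O(s ^ card T)\<close>.\<close>
lemma alg_indep_le_card:
  assumes T: "finite T" and f: "\<And>i. i < d \<Longrightarrow> f i \<in> ratfun T" and indep: "alg_indep d f"
  shows "d \<le> card T"
proof -
  obtain c q where q: "q \<noteq> 0" "q \<in> poly_span T c" "\<And>i. i < d \<Longrightarrow> f i * q \<in> poly_span T c"
    using ratfun_common_denominator[of d f T] f by auto
  have count: "(s + 1) ^ d \<le> (d * (c * s) + 1) ^ card T" for s
  proof -
    let ?M = "monomial T ` (T \<rightarrow>\<^sub>E {..d * (c * s)})"
    let ?B = "{..<d} \<rightarrow>\<^sub>E {..s}"
    \<comment> \<open>Each of the \<open>d\<close> powers \<open>f i ^ m i\<close> is allotted
      \<open>s\<close> copies of \<open>q\<close>, enough for its denominator because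
      \<open>m i \<le> s\<close>.\<close>
    define F where "F m = q ^ (d * s) * (\<Prod>i<d. f i ^ m i)" for m
    have fin: "finite ?B" by (auto intro: finite_PiE)
    have zero: "\<forall>m\<in>?B. g m = 0" if "(\<Sum>m\<in>?B. \<kappa> (g m) * F m) = 0" for g
    proof -
      have "q ^ (d * s) * (\<Sum>m\<in>?B. \<kappa> (g m) * (\<Prod>i<d. f i ^ m i)) = 0"
        using that unfolding F_def sum_distrib_left by (simp add: mult.left_commute)
      then have "(\<Sum>m\<in>?B. \<kappa> (g m) * (\<Prod>i<d. f i ^ m i)) = 0"
        using q(1) by simp
      then show ?thesis using indep[unfolded alg_indep_def, rule_format, of g s] by simp
    qed
    \<comment> \<open>Linear independence concerns the set of values of \<open>F\<close>. Two equal
      values would give a relation with coefficients 1 and -1.\<close>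
    have inj: "inj_on F ?B"
    proof (rule inj_onI, rule ccontr)
      fix m m' assume m: "m \<in> ?B" "m' \<in> ?B" "F m = F m'" "m \<noteq> m'"
      let ?g = "(\<lambda>x. if x = m then 1 else if x = m' then - 1 else 0) :: (nat \<Rightarrow> nat) \<Rightarrow> 'k"
      have "(\<Sum>x\<in>?B. \<kappa> (?g x) * F x) =
          (\<Sum>x\<in>?B. (if x = m then F m else 0) - (if x = m' then F m' else 0))"
        using m(4) by (intro sum.cong refl) (simp add: hom_uminus)
      also have "\<dots> = 0" unfolding sum_subtractf using fin m(1-3) by (simp del: PiE_iff)
      finally have "\<forall>x\<in>?B. ?g x = 0" by (rule zero)
      then have "?g m = 0" using m(1) by (rule bspec)
      then show False by simp
    qed
    have "V.independent (F ` ?B)"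
    proof
      assume "V.dependent (F ` ?B)"
      then obtain u where u: "\<exists>v\<in>F ` ?B. u v \<noteq> 0" "(\<Sum>v\<in>F ` ?B. \<kappa> (u v) * v) = 0"
        using V.dependent_finite[of "F ` ?B"] fin by auto
      have "(\<Sum>m\<in>?B. \<kappa> (u (F m)) * F m) = 0"
        using u(2) by (subst (asm) sum.reindex[OF inj]) simp
      then show False using zero[of "\<lambda>m. u (F m)"] u(1) by auto
    qed
    moreover have "F ` ?B \<subseteq> V.span ?M"
    proof (rule image_subsetI)
      fix m assume m: "m \<in> ?B"
      have "F m = (\<Prod>i<d. q ^ s * f i ^ m i)"
        by (simp add: F_def prod.distrib power_mult mult.commute[of d])
      also have "\<dots> = (\<Prod>i<d. (f i * q) ^ m i * q ^ (s - m i))"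
      proof (rule prod.cong)
        fix i assume "i \<in> {..<d}"
        then have "m i \<le> s" using m by auto
        then have "q ^ s = q ^ m i * q ^ (s - m i)" by (simp flip: power_add)
        then show "q ^ s * f i ^ m i = (f i * q) ^ m i * q ^ (s - m i)"
          by (simp add: power_mult_distrib algebra_simps)
      qed simp
      also have "\<dots> \<in> poly_span T (card {..<d} * (c * s))"
      proof (rule poly_span_prod)
        fix i assume i: "i \<in> {..<d}"
        then have "m i \<le> s" using m by auto
        then have "c * m i + c * (s - m i) = c * s" by (simp flip: distrib_left)
        then show "(f i * q) ^ m i * q ^ (s - m i) \<in> poly_span T (c * s)"
          using poly_span_mult[OF poly_span_power[OF q(3), of i "m i"] poly_span_power[OF q(2), of "s - m i"]]
            i by simp
      qed simp
      finally show "F m \<in> V.span ?M"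
        by (simp add: poly_span_def)
    qed
    moreover have finT: "finite (T \<rightarrow>\<^sub>E {..d * (c * s)})" using T by (auto intro: finite_PiE)
    ultimately have "card (F ` ?B) \<le> card ?M"
      using V.independent_span_bound by blast
    also have "\<dots> \<le> card (T \<rightarrow>\<^sub>E {..d * (c * s)})" using card_image_le[OF finT] .
    also have "\<dots> = (d * (c * s) + 1) ^ card T" using T by (simp add: card_PiE)
    finally show ?thesis using card_image[OF inj] by (simp add: card_PiE)
  qed
  show ?thesis
  proof (rule ccontr)
    assume "\<not> d \<le> card T"
    \<comment> \<open>With this \<open>s\<close> the right side of the count is at most
      \<open>s * (s + 1) ^ card T\<close>, which is less than \<open>(s + 1) ^ d\<close> as soon as
      \<open>d > card T\<close>.\<close>
    define C s where "C = d * c + 1" and "s = C ^ card T"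
    have "(s + 1) ^ card T * (s + 1) \<le> (s + 1) ^ d"
      using \<open>\<not> d \<le> card T\<close> power_increasing[of "card T + 1" d "s + 1"]
      by (simp add: mult.commute)
    also have "\<dots> \<le> (d * (c * s) + 1) ^ card T" by (rule count)
    also have "\<dots> \<le> (C * (s + 1)) ^ card T"
      unfolding C_def by (intro power_mono) (auto simp: algebra_simps)
    also have "\<dots> = (s + 1) ^ card T * s" by (subst power_mult_distrib) (simp add: s_def)
    finally show False by simp
  qed
qed

end

section \<open>Burnside's theorem\<close>

text \<open>Vectors are functions on the whole index type, of which only the values on
  \<open>I\<close> count. The last clause makes \<open>W\<close> insensitive to the other values, so
  that properness can be expressed as \<open>W \<noteq> UNIV\<close>.\<close>

definition subspace_on :: "'i set \<Rightarrow> ('i \<Rightarrow> 'f::field) set \<Rightarrow> bool" where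
  "subspace_on I W \<longleftrightarrow> (\<lambda>_. 0) \<in> W \<and> (\<forall>v\<in>W. \<forall>w\<in>W. (\<lambda>i. v i + w i) \<in> W) \<and>
     (\<forall>c. \<forall>v\<in>W. (\<lambda>i. c * v i) \<in> W) \<and> (\<forall>v\<in>W. \<forall>w. (\<forall>i\<in>I. w i = v i) \<longrightarrow> w \<in> W)"

text \<open>Let \<open>J\<close> be a smallest set of coordinates such that a vector of
  \<open>W\<close> vanishing on \<open>J\<close> vanishes on \<open>I\<close>. For each
  \<open>j\<close> in \<open>J\<close>, minimality yields a vector of \<open>W\<close> that vanishes
  on the rest of \<open>J\<close> but not at \<open>j\<close>. After scaling, these vectors form a
  basis dual to the coordinates in \<open>J\<close>, and the \<open>c i j\<close> are their
  remaining entries.\<close>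

lemma reduced_echelon_form:
  assumes fin: "finite I" and W: "subspace_on I W"
  obtains J c where "J \<subseteq> I" "\<And>v. v \<in> W \<longleftrightarrow> (\<forall>i\<in>I - J. v i = (\<Sum>j\<in>J. c i j * v j))"
proof -
  have zero: "(\<lambda>_. 0) \<in> W"
    and add: "\<And>v w. v \<in> W \<Longrightarrow> w \<in> W \<Longrightarrow> (\<lambda>i. v i + w i) \<in> W"
    and scale: "\<And>c v. v \<in> W \<Longrightarrow> (\<lambda>i. c * v i) \<in> W"
    and cong: "\<And>v w. v \<in> W \<Longrightarrow> (\<And>i. i \<in> I \<Longrightarrow> w i = v i) \<Longrightarrow> w \<in> W"
    using W by (auto simp: subspace_on_def)
  define inj where "inj J \<longleftrightarrow> J \<subseteq> I \<and> (\<forall>w\<in>W. (\<forall>j\<in>J. w j = 0) \<longrightarrow> (\<forall>i\<in>I. w i = 0))" for J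
  have "inj I" by (auto simp: inj_def)
  then obtain J where J: "inj J" and min: "\<And>J'. inj J' \<Longrightarrow> card J \<le> card J'"
    using arg_min_nat_lemma[of inj I card] by blast
  have JI: "J \<subseteq> I" using J by (simp add: inj_def)
  then have finJ: "finite J" using fin finite_subset by blast
  have "\<exists>w\<in>W. \<forall>k\<in>J. w k = (if k = j then 1 else 0)" if j: "j \<in> J" for j
  proof -
    have "card (J - {j}) < card J" using finJ j by (intro card_Diff1_less)
    then have "\<not> inj (J - {j})" using min[of "J - {j}"] by auto
    then obtain w where w: "w \<in> W" "\<forall>k\<in>J - {j}. w k = 0" "\<exists>i\<in>I. w i \<noteq> 0"
      using JI by (auto simp: inj_def)
    have "w j \<noteq> 0"
    proof
      assume "w j = 0"
      then have "\<forall>k\<in>J. w k = 0" using w(2) by blast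
      then have "\<forall>i\<in>I. w i = 0" using J w(1) unfolding inj_def by blast
      then show False using w(3) by blast
    qed
    then have "\<forall>k\<in>J. inverse (w j) * w k = (if k = j then 1 else 0)" using w(2) by simp
    then show ?thesis using scale[OF w(1), of "inverse (w j)"] by (rule bexI)
  qed
  then obtain e where e: "\<And>j. j \<in> J \<Longrightarrow> e j \<in> W"
      "\<And>j k. j \<in> J \<Longrightarrow> k \<in> J \<Longrightarrow> e j k = (if k = j then 1 else 0)"
    by metis
  have comb: "(\<lambda>i. \<Sum>j\<in>J'. a j * e j i) \<in> W" if "finite J'" "J' \<subseteq> J" for a J'
    using that by (induction J') (auto intro!: zero add scale e)
  have "v \<in> W \<longleftrightarrow> (\<forall>i\<in>I - J. v i = (\<Sum>j\<in>J. e j i * v j))" for v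
  proof
    assume v: "v \<in> W"
    let ?u = "\<lambda>i. v i + (- 1) * (\<Sum>j\<in>J. v j * e j i)"
    have "?u \<in> W" by (rule add[OF v scale[OF comb]]) (use finJ in auto)
    moreover have "\<forall>k\<in>J. ?u k = 0" using finJ by (auto simp: e if_distrib[of "\<lambda>x. _ * x"] cong: if_cong)
    ultimately have "\<forall>i\<in>I. ?u i = 0" using J by (auto simp: inj_def)
    then show "\<forall>i\<in>I - J. v i = (\<Sum>j\<in>J. e j i * v j)" by (auto simp: mult.commute)
  next
    assume v: "\<forall>i\<in>I - J. v i = (\<Sum>j\<in>J. e j i * v j)"
    show "v \<in> W"
    proof (rule cong[OF comb[of J v]])
      fix i assume i: "i \<in> I"
      show "v i = (\<Sum>j\<in>J. v j * e j i)"
      proof (cases "i \<in> J")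
        case True
        then show ?thesis using finJ by (simp add: e if_distrib[of "\<lambda>x. _ * x"] cong: if_cong)
      next
        case False
        then show ?thesis using i v by (simp add: mult.commute)
      qed
    qed (use finJ in auto)
  qed
  with JI show ?thesis by (rule that)
qed

text \<open>The equation of one nonpivot coordinate \<open>i\<close> is already a linear form
  vanishing on \<open>W\<close>. The normalization \<open>y i = 1\<close> keeps it visibly nonzero
  when scalars are extended.\<close>

lemma proper_subspace_annihilator:
  assumes fin: "finite I" and W: "subspace_on I W" and proper: "W \<noteq> UNIV"
  obtains y i where "i \<in> I" "y i = 1" "\<And>v. v \<in> W \<Longrightarrow> (\<Sum>j\<in>I. y j * v j) = 0"
proof -
  have "\<exists>J c. J \<subseteq> I \<and> (\<forall>v. v \<in> W \<longleftrightarrow> (\<forall>i\<in>I - J. v i = (\<Sum>j\<in>J. c i j * v j)))"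
    by (rule reduced_echelon_form[OF fin W]) blast
  then obtain J c where J: "J \<subseteq> I" "\<And>v. v \<in> W \<longleftrightarrow> (\<forall>i\<in>I - J. v i = (\<Sum>j\<in>J. c i j * v j))"
    by blast
  have "I - J \<noteq> {}" using proper J(2) by auto
  then obtain i where i: "i \<in> I" "i \<notin> J" by blast
  define y where "y j = (if j = i then 1 else if j \<in> J then - c i j else 0)" for j
  have "(\<Sum>j\<in>I. y j * v j) = 0" if "v \<in> W" for v
  proof -
    have "v i = (\<Sum>j\<in>J. c i j * v j)" using J(2) that i by auto
    moreover have "(\<Sum>j\<in>I. y j * v j) = (\<Sum>j\<in>insert i J. y j * v j)"
      using J(1) i fin by (intro sum.mono_neutral_right) (auto simp: y_def)
    moreover have "(\<Sum>j\<in>insert i J. y j * v j) = v i + (\<Sum>j\<in>J. - (c i j * v j))"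
      using i finite_subset[OF J(1) fin] by (auto simp: y_def intro!: sum.cong)
    ultimately show ?thesis by (simp add: sum_negf)
  qed
  moreover have "y i = 1" by (simp add: y_def)
  ultimately show ?thesis using i(1) that by blast
qed

section \<open>Eigenvectors and transitive matrix algebras\<close>

lemma mat_mult_entry:
  assumes "A \<in> carrier_mat n m" "B \<in> carrier_mat m l" "i < n" "j < l"
  shows "(A * B) $$ (i, j) = (\<Sum>k<m. A $$ (i, k) * B $$ (k, j))"
  using assms by (auto simp: scalar_prod_def lessThan_atLeast0 intro!: sum.cong)

text \<open>The index set is an arbitrary finite set because the matrix in question acts on the
  inner indices of a rank factorization. The eigenvalue is a root of the characteristic
  polynomial.\<close>

lemma finite_matrix_eigenvector:
  fixes M :: "'i \<Rightarrow> 'i \<Rightarrow> 'f::alg_closed_field"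
  assumes "finite K" "K \<noteq> {}"
  obtains \<mu> z where "\<exists>k\<in>K. z k \<noteq> 0" "\<And>k. k \<in> K \<Longrightarrow> (\<Sum>l\<in>K. M k l * z l) = \<mu> * z k"
proof -
  define r where "r = card K"
  obtain h where h: "bij_betw h {0..<r} K"
    using ex_bij_betw_nat_finite[OF assms(1)] r_def by auto
  have r: "r > 0" using assms r_def by (simp add: card_gt_0_iff)
  define N where "N = mat r r (\<lambda>(i, j). M (h i) (h j))"
  have N: "N \<in> carrier_mat r r" by (simp add: N_def)
  obtain \<mu> where "poly (char_poly N) \<mu> = 0"
    using alg_closed_imp_poly_has_root[of "char_poly N"] degree_monic_char_poly[OF N] r by auto
  then obtain v where v: "v \<in> carrier_vec r" "v \<noteq> 0\<^sub>v r" "N *\<^sub>v v = \<mu> \<cdot>\<^sub>v v"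
    using eigenvalue_root_char_poly[OF N] N by (auto simp: eigenvalue_def eigenvector_def)
  define z where "z k = v $ (the_inv_into {0..<r} h k)" for k
  have z: "z (h i) = v $ i" if "i < r" for i
    using that h by (simp add: z_def the_inv_into_f_f bij_betw_def)
  obtain i where "i < r" "v $ i \<noteq> 0"
    using v(1,2) by (metis carrier_vecD eq_vecI index_zero_vec)
  then have 1: "\<exists>k\<in>K. z k \<noteq> 0" using h z by (intro bexI[of _ "h i"]) (auto simp: bij_betw_def)
  have 2: "(\<Sum>l\<in>K. M k l * z l) = \<mu> * z k" if "k \<in> K" for k
  proof -
    obtain i where i: "i < r" "k = h i" using \<open>k \<in> K\<close> h by (auto simp: bij_betw_def)
    have "(\<Sum>l\<in>K. M k l * z l) = (\<Sum>j\<in>{0..<r}. M k (h j) * z (h j))"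
      by (rule sum.reindex_bij_betw[OF h, symmetric])
    also have "\<dots> = (N *\<^sub>v v) $ i"
      using i v(1) by (auto simp: N_def scalar_prod_def z intro!: sum.cong)
    finally show ?thesis using v i by (simp add: z)
  qed
  show ?thesis by (rule that[OF 1 2])
qed

definition matrix_algebra :: "nat \<Rightarrow> 'f::comm_ring_1 mat set \<Rightarrow> bool" where
  "matrix_algebra n A \<longleftrightarrow> A \<subseteq> carrier_mat n n \<and> 1\<^sub>m n \<in> A \<and>
     (\<forall>a\<in>A. \<forall>b\<in>A. a + b \<in> A \<and> a * b \<in> A) \<and> (\<forall>c. \<forall>a\<in>A. c \<cdot>\<^sub>m a \<in> A)"

lemma matrix_algebraD:
  assumes "matrix_algebra n A"
  shows "a \<in> A \<Longrightarrow> a \<in> carrier_mat n n" "1\<^sub>m n \<in> A"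
    "a \<in> A \<Longrightarrow> b \<in> A \<Longrightarrow> a + b \<in> A" "a \<in> A \<Longrightarrow> b \<in> A \<Longrightarrow> a * b \<in> A" "a \<in> A \<Longrightarrow> c \<cdot>\<^sub>m a \<in> A"
  using assms unfolding matrix_algebra_def by blast+

text \<open>This covers both kinds of orbits that occur, columns \<open>a y\<close> and rows
  \<open>w a\<close> for \<open>a\<close> in the algebra, with \<open>\<phi> a i\<close> as the
  \<open>i\<close>-th coordinate.\<close>

lemma linear_image_subspace_on:
  fixes \<phi> :: "'f::field mat \<Rightarrow> nat \<Rightarrow> 'f"
  assumes A: "matrix_algebra n A"
    and add: "\<And>a b i. a \<in> carrier_mat n n \<Longrightarrow> b \<in> carrier_mat n n \<Longrightarrow> i < n \<Longrightarrow> \<phi> (a + b) i = \<phi> a i + \<phi> b i"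
    and smult: "\<And>c a i. a \<in> carrier_mat n n \<Longrightarrow> i < n \<Longrightarrow> \<phi> (c \<cdot>\<^sub>m a) i = c * \<phi> a i"
  shows "subspace_on {..<n} {v. \<exists>a\<in>A. \<forall>i<n. v i = \<phi> a i}"
  unfolding subspace_on_def
proof (intro conjI ballI allI impI)
  note carr = matrix_algebraD(1)[OF A] and one = matrix_algebraD(2)[OF A] and addA = matrix_algebraD(3)[OF A]
    and smultA = matrix_algebraD(5)[OF A]
  let ?W = "{v. \<exists>a\<in>A. \<forall>i<n. v i = \<phi> a i}"
  show "(\<lambda>_. 0) \<in> ?W"
    by (intro CollectI bexI[OF _ smultA[OF one, of 0]]) (simp add: smult)
  fix v assume "v \<in> ?W"
  then obtain a where a: "a \<in> A" "\<And>i. i < n \<Longrightarrow> v i = \<phi> a i" by blast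
  show "(\<lambda>i. c * v i) \<in> ?W" for c
    by (intro CollectI bexI[OF _ smultA[OF a(1), of c]]) (simp add: smult carr a)
  show "(\<lambda>i. v i + w i) \<in> ?W" if "w \<in> ?W" for w
  proof -
    obtain b where b: "b \<in> A" "\<And>i. i < n \<Longrightarrow> w i = \<phi> b i" using \<open>w \<in> ?W\<close> by blast
    show ?thesis
      by (intro CollectI bexI[OF _ addA[OF a(1) b(1)]]) (simp add: add carr a b)
  qed
  show "w \<in> ?W" if "\<forall>i\<in>{..<n}. w i = v i" for w
    using that a by auto
qed

text \<open>Read for all rows \<open>U\<close> of a matrix at once: a kernel vector with
  \<open>z k0 \<noteq> 0\<close> makes column \<open>k0\<close> a combination of the other columns,
  so the inner index \<open>k0\<close> of a product can be eliminated.\<close>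

lemma sum_drop_kernel_vector:
  fixes U :: "'i \<Rightarrow> 'f::field"
  assumes "finite K" "k0 \<in> K" "z k0 \<noteq> 0" "(\<Sum>k\<in>K. U k * z k) = 0"
  shows "(\<Sum>k\<in>K. U k * W k) = (\<Sum>k\<in>K - {k0}. U k * (W k - z k / z k0 * W k0))"
proof -
  have "(\<Sum>k\<in>K. U k * W k) = (\<Sum>k\<in>K. U k * W k) - W k0 / z k0 * (\<Sum>k\<in>K. U k * z k)"
    using assms by simp
  also have "\<dots> = (\<Sum>k\<in>K. U k * (W k - z k / z k0 * W k0))"
    by (simp add: sum_distrib_left sum_subtractf algebra_simps)
  also have "\<dots> = (\<Sum>k\<in>K - {k0}. U k * (W k - z k / z k0 * W k0))"
    using assms by (subst sum.remove[of K k0]) auto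
  finally show ?thesis .
qed

text \<open>The argument is that of Lomonosov and Rosenthal: an element \<open>U * W\<close> of minimal positive rank has
  rank one, since otherwise subtracting an eigenvalue of the inner matrix \<open>W * a * U\<close> lowers the rank.\<close>
lemma transitive_matrix_algebra:
  fixes A :: "'f::alg_closed_field mat set"
  assumes n: "n > 0" and A: "matrix_algebra n A"
    and trans: "\<And>y z. (\<exists>i<n. y i \<noteq> 0) \<Longrightarrow> \<exists>a\<in>A. \<forall>i<n. (\<Sum>j<n. a $$ (i, j) * y j) = z i"
  shows "A = carrier_mat n n"
proof -
  note carr = matrix_algebraD(1)[OF A] and one = matrix_algebraD(2)[OF A] and addA = matrix_algebraD(3)[OF A]
    and multA = matrix_algebraD(4)[OF A] and smultA = matrix_algebraD(5)[OF A]
  \<comment> \<open>\<open>fac\<close> says that \<open>a\<close> is the product of \<open>U\<close>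
    and \<open>W\<close> through the inner index set \<open>K\<close>. Rank enters only as the least
    size of \<open>K\<close> over all nonzero elements of the algebra.\<close>
  define fac where "fac a K U W \<longleftrightarrow> finite (K::nat set) \<and>
      (\<forall>i<n. \<forall>j<n. a $$ (i, j) = (\<Sum>k\<in>K. U i k * W k j))" for a :: "'f mat" and K U W
  define nz where "nz a \<longleftrightarrow> (\<exists>i<n. \<exists>j<n. a $$ (i, j) \<noteq> 0)" for a :: "'f mat"
  define P where "P r \<longleftrightarrow> (\<exists>a\<in>A. nz a \<and> (\<exists>K U W. fac a K U W \<and> card K = r))" for r
  have "P n"
  proof -
    have "fac (1\<^sub>m n) {..<n} (\<lambda>i k. if i = k then 1 else 0) (\<lambda>k j. if k = j then 1 else 0)"
      by (auto simp: fac_def if_distrib[of "\<lambda>x. x * _"] cong: if_cong)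
    moreover have "nz (1\<^sub>m n)" unfolding nz_def using n by (intro exI[of _ 0] conjI) auto
    ultimately show ?thesis unfolding P_def using one by (metis card_lessThan)
  qed
  define r where "r = (LEAST r. P r)"
  have Pr: "P r" unfolding r_def using \<open>P n\<close> by (rule LeastI)
  have min: False if "P s" "s < r" for s using not_less_Least[of s P] that r_def by simp
  obtain a K U W where a: "a \<in> A" "nz a" "fac a K U W" "card K = r"
    using Pr by (auto simp: P_def)
  have finK: "finite K" using a by (simp add: fac_def)
  have aent: "\<And>i j. i < n \<Longrightarrow> j < n \<Longrightarrow> a $$ (i, j) = (\<Sum>k\<in>K. U i k * W k j)"
    using a(3) by (simp add: fac_def)
  have Knz: "K \<noteq> {}" using a(2) aent by (auto simp: nz_def)
  have smaller: "\<not> nz b" if "b \<in> A" "fac b (K - {k}) U' W'" "k \<in> K" for b k U' W'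
  proof
    assume "nz b"
    then have "P (card (K - {k}))" unfolding P_def using that by blast
    moreover have "card (K - {k}) < r" using finK that(3) a(4) by (metis card_Diff1_less)
    ultimately show False by (rule min)
  qed
  \<comment> \<open>Minimality makes the columns of \<open>U\<close> independent, and below likewise
    the rows of \<open>W\<close>: a dependency would eliminate an inner index of the nonzero matrix
    \<open>a\<close>.\<close>
  have Uinj: "z k = 0" if z: "\<And>i. i < n \<Longrightarrow> (\<Sum>k\<in>K. U i k * z k) = 0" and k: "k \<in> K" for z k
  proof (rule ccontr)
    assume nz: "z k \<noteq> 0"
    have "fac a (K - {k}) U (\<lambda>l j. W l j - z l / z k * W k j)"
      using finK aent sum_drop_kernel_vector[OF finK k nz z] by (auto simp: fac_def)
    then show False using smaller a k by blast
  qed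
  have Winj: "z k = 0" if z: "\<And>j. j < n \<Longrightarrow> (\<Sum>k\<in>K. z k * W k j) = 0" and k: "k \<in> K" for z k
  proof (rule ccontr)
    assume nz: "z k \<noteq> 0"
    have z': "\<And>j. j < n \<Longrightarrow> (\<Sum>k\<in>K. W k j * z k) = 0" using z by (simp add: mult.commute)
    have "fac a (K - {k}) (\<lambda>i l. U i l - z l / z k * U i k) W"
      using finK aent sum_drop_kernel_vector[OF finK k nz z']
      by (auto simp: fac_def mult.commute)
    then show False using smaller a k by blast
  qed
  have "k1 = k2" if k: "k1 \<in> K" "k2 \<in> K" for k1 k2
  proof (rule ccontr)
    assume ne: "k1 \<noteq> k2"
    have "\<exists>i<n. U i k1 \<noteq> 0"
    proof (rule ccontr)
      assume "\<not> ?thesis"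
      then have "(\<Sum>k\<in>K. U i k * (if k = k1 then 1 else 0)) = 0" if "i < n" for i
        using that finK k by (simp add: if_distrib cong: if_cong)
      from Uinj[OF this k(1)] show False by simp
    qed
    then have tr: "\<exists>b\<in>A. \<forall>i<n. (\<Sum>j<n. b $$ (i, j) * U j k1) = z i" for z
      using trans[of "\<lambda>j. U j k1"] by blast
    \<comment> \<open>If \<open>b\<close> sends column \<open>k1\<close> of \<open>U\<close> to the
      \<open>p\<close>-th unit vector, then \<open>W k2 p\<close> is the entry
      \<open>(k2, k1)\<close> of the inner matrix \<open>M\<close> of \<open>a * b * a\<close>. It
      vanishes because \<open>M\<close> turns out to be scalar. For all \<open>p\<close> together
      this contradicts the independence of the rows of \<open>W\<close>.\<close>
    have "W k2 p = 0" if p: "p < n" for p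
    proof -
      obtain b where b: "b \<in> A" "\<And>i. i < n \<Longrightarrow> (\<Sum>j<n. b $$ (i, j) * U j k1) = (if i = p then 1 else 0)"
        using tr[of "\<lambda>i. if i = p then 1 else 0"] by blast
      define M where "M k l = (\<Sum>i<n. W k i * (\<Sum>j<n. b $$ (i, j) * U j l))" for k l
      obtain \<mu> z where z: "\<exists>k\<in>K. z k \<noteq> 0" "\<And>k. k \<in> K \<Longrightarrow> (\<Sum>l\<in>K. M k l * z l) = \<mu> * z k"
        using finite_matrix_eigenvector[OF finK Knz] by metis
      obtain k0 where k0: "k0 \<in> K" "z k0 \<noteq> 0" using z(1) by blast
      define N where "N k l = M k l - (if k = l then \<mu> else 0)" for k l
      have Nz: "(\<Sum>l\<in>K. N k l * z l) = 0" if "k \<in> K" for k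
        using that z(2)[OF that] finK
        by (simp add: N_def left_diff_distrib sum_subtractf if_distrib[of "\<lambda>x. x * _"] cong: if_cong)
      \<comment> \<open>This is the product of \<open>U\<close>, \<open>N\<close> and
        \<open>W\<close> with \<open>N = M - \<mu>\<close> singular, so one inner index fewer
        suffices. By minimality \<open>a'\<close> vanishes, and independence of the columns of
        \<open>U\<close> and of the rows of \<open>W\<close> then forces \<open>N\<close> to
        vanish.\<close>
      define a' where "a' = a * b * a + (- \<mu>) \<cdot>\<^sub>m a"
      have a': "a' \<in> A" unfolding a'_def using a b by (intro addA multA smultA)
      have ca: "a \<in> carrier_mat n n" "b \<in> carrier_mat n n" "a * b \<in> carrier_mat n n"
        using carr a b multA by auto
      define V where "V i l = (\<Sum>k\<in>K. U i k * N k l)" for i l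
      have ent: "a' $$ (i, j) = (\<Sum>l\<in>K. V i l * W l j)" if ij: "i < n" "j < n" for i j
      proof -
        let ?t = "\<lambda>k l p q. U i k * W k p * b $$ (p, q) * (U q l * W l j)"
        have "(a * b * a) $$ (i, j) = (\<Sum>q<n. (\<Sum>p<n. a $$ (i, p) * b $$ (p, q)) * a $$ (q, j))"
          using ij by (simp add: mat_mult_entry[OF ca(3,1)] mat_mult_entry[OF ca(1,2)] del: index_mult_mat)
        also have "\<dots> = (\<Sum>q<n. (\<Sum>p<n. (\<Sum>k\<in>K. U i k * W k p) * b $$ (p, q)) * (\<Sum>l\<in>K. U q l * W l j))"
          using ij by (simp add: aent)
        also have "\<dots> = (\<Sum>q<n. \<Sum>l\<in>K. \<Sum>p<n. \<Sum>k\<in>K. ?t k l p q)"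
          by (simp add: sum_distrib_left sum_distrib_right)
        also have "\<dots> = (\<Sum>l\<in>K. \<Sum>q<n. \<Sum>k\<in>K. \<Sum>p<n. ?t k l p q)"
          by (subst sum.swap, intro sum.cong refl sum.swap)
        also have "\<dots> = (\<Sum>l\<in>K. \<Sum>k\<in>K. \<Sum>q<n. \<Sum>p<n. ?t k l p q)"
          by (intro sum.cong refl sum.swap)
        also have "\<dots> = (\<Sum>l\<in>K. \<Sum>k\<in>K. \<Sum>p<n. \<Sum>q<n. ?t k l p q)"
          by (intro sum.cong refl sum.swap)
        also have "\<dots> = (\<Sum>l\<in>K. (\<Sum>k\<in>K. U i k * M k l) * W l j)"
          by (simp add: M_def sum_distrib_left sum_distrib_right mult_ac)
        finally have 1: "(a * b * a) $$ (i, j) = (\<Sum>l\<in>K. (\<Sum>k\<in>K. U i k * M k l) * W l j)" .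
        have "V i l = (\<Sum>k\<in>K. U i k * M k l) - U i l * \<mu>" if "l \<in> K" for l
        proof -
          have "V i l = (\<Sum>k\<in>K. U i k * M k l - (if k = l then U i l * \<mu> else 0))"
            unfolding V_def by (intro sum.cong) (auto simp: N_def algebra_simps)
          then show ?thesis using that finK by (simp add: sum_subtractf)
        qed
        then have "(\<Sum>l\<in>K. V i l * W l j) =
            (\<Sum>l\<in>K. ((\<Sum>k\<in>K. U i k * M k l) - U i l * \<mu>) * W l j)"
          by (intro sum.cong) auto
        also have "\<dots> = (\<Sum>l\<in>K. (\<Sum>k\<in>K. U i k * M k l) * W l j) - (\<Sum>l\<in>K. U i l * \<mu> * W l j)"
          by (simp only: left_diff_distrib sum_subtractf)
        also have "(\<Sum>l\<in>K. U i l * \<mu> * W l j) = \<mu> * a $$ (i, j)"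
          using ij by (simp add: aent sum_distrib_left mult_ac)
        finally have "(\<Sum>l\<in>K. V i l * W l j) =
            (\<Sum>l\<in>K. (\<Sum>k\<in>K. U i k * M k l) * W l j) - \<mu> * a $$ (i, j)" .
        then show ?thesis using 1 ij ca by (simp add: a'_def)
      qed
      have "fac a' (K - {k0}) V (\<lambda>l j. W l j - z l / z k0 * W k0 j)"
      proof -
        have "(\<Sum>l\<in>K. V i l * z l) = 0" for i
        proof -
          have "(\<Sum>l\<in>K. V i l * z l) = (\<Sum>l\<in>K. \<Sum>k\<in>K. U i k * (N k l * z l))"
            by (simp add: V_def sum_distrib_left sum_distrib_right mult_ac)
          also have "\<dots> = (\<Sum>k\<in>K. U i k * (\<Sum>l\<in>K. N k l * z l))"
            by (subst sum.swap) (simp add: sum_distrib_left)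
          finally show ?thesis by (simp add: Nz)
        qed
        from sum_drop_kernel_vector[OF finK k0(1,2) this]
        show ?thesis using finK ent by (auto simp: fac_def)
      qed
      then have "\<not> nz a'" using smaller a' k0 by blast
      then have 0: "(\<Sum>l\<in>K. V i l * W l j) = 0" if "i < n" "j < n" for i j
        using that ent by (auto simp: nz_def)
      have "(\<Sum>l\<in>K. N k l * W l j) = 0" if "j < n" "k \<in> K" for k j
      proof (rule Uinj[where z = "\<lambda>k. \<Sum>l\<in>K. N k l * W l j"])
        fix i assume "i < n"
        have "(\<Sum>k\<in>K. U i k * (\<Sum>l\<in>K. N k l * W l j)) = (\<Sum>k\<in>K. \<Sum>l\<in>K. U i k * N k l * W l j)"
          by (simp add: sum_distrib_left mult_ac)
        also have "\<dots> = (\<Sum>l\<in>K. V i l * W l j)"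
          by (subst sum.swap) (simp add: V_def sum_distrib_right)
        finally show "(\<Sum>k\<in>K. U i k * (\<Sum>l\<in>K. N k l * W l j)) = 0"
          using 0[OF \<open>i < n\<close> \<open>j < n\<close>] by simp
      qed fact
      from Winj[where z = "N k2", OF this[OF _ k(2)] k(1)] have "M k2 k1 = 0"
        using ne by (simp add: N_def)
      then show ?thesis using p by (simp add: M_def b(2) if_distrib cong: if_cong)
    qed
    then have "(\<Sum>k\<in>K. (if k = k2 then 1 else 0) * W k j) = 0" if "j < n" for j
      using that finK k by (simp add: if_distrib[of "\<lambda>x. x * _"] cong: if_cong)
    from Winj[OF this k(2)] show False by simp
  qed
  then obtain k where K: "K = {k}" using Knz by blast
  define u where "u i = U i k" for i
  define w where "w j = W k j" for j
  have auw: "\<And>i j. i < n \<Longrightarrow> j < n \<Longrightarrow> a $$ (i, j) = u i * w j" by (simp add: aent K u_def w_def)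
  have unz: "\<exists>i<n. u i \<noteq> 0" and wnz: "\<exists>j<n. w j \<noteq> 0" using a(2) auw by (auto simp: nz_def)
  \<comment> \<open>Transitivity on rows: if the orbit of \<open>w\<close> were proper, a nonzero
    column \<open>y\<close> would be annihilated by every row \<open>w b\<close>. Since the algebra
    moves \<open>y\<close> to every unit vector, all entries of \<open>w\<close> would
    vanish.\<close>
  have rows: "\<exists>b\<in>A. \<forall>j<n. (\<Sum>i<n. w i * b $$ (i, j)) = x j" for x
  proof -
    define R where "R = {v. \<exists>b\<in>A. \<forall>j<n. v j = (\<Sum>i<n. w i * b $$ (i, j))}"
    have subR: "subspace_on {..<n} R" unfolding R_def
      by (rule linear_image_subspace_on[OF A])
        (auto simp: distrib_left distrib_right sum.distrib sum_distrib_left mult_ac)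
    have "R = UNIV"
    proof (rule ccontr)
      assume "R \<noteq> UNIV"
      then obtain y i0 where y: "i0 \<in> {..<n}" "y i0 = 1" "\<And>v. v \<in> R \<Longrightarrow> (\<Sum>j<n. y j * v j) = 0"
        by (rule proper_subspace_annihilator[OF finite_lessThan subR]) auto
      have "w i = 0" if i: "i < n" for i
      proof -
        have "\<exists>i<n. y i \<noteq> 0" using y by (intro exI[of _ i0]) auto
        from trans[OF this, of "\<lambda>l. if l = i then 1 else 0"] obtain b where
          b: "b \<in> A" "\<And>l. l < n \<Longrightarrow> (\<Sum>j<n. b $$ (l, j) * y j) = (if l = i then 1 else 0)" by blast
        have "(\<lambda>j. \<Sum>i<n. w i * b $$ (i, j)) \<in> R" using b(1) by (auto simp: R_def)
        from y(3)[OF this] have "(\<Sum>l<n. w l * (\<Sum>j<n. b $$ (l, j) * y j)) = 0"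
          unfolding sum_distrib_left sum_distrib_right by (subst sum.swap) (simp add: mult_ac)
        then show ?thesis using i by (simp add: b(2) if_distrib cong: if_cong)
      qed
      then show False using wnz by blast
    qed
    then have "x \<in> R" by simp
    then show ?thesis by (auto simp: R_def)
  qed
  \<comment> \<open>The matrix \<open>x\<close> is assembled row by row. If \<open>b u\<close> is
    the \<open>m\<close>-th unit vector and \<open>w d\<close> is row \<open>m\<close> of
    \<open>x\<close>, then \<open>b * a * d\<close> consists of that row alone.\<close>
  have "mat n n (\<lambda>(i, j). if i < m then x $$ (i, j) else 0) \<in> A" if "m \<le> n" for m and x :: "'f mat"
    using that
  proof (induction m)
    case 0
    have "mat n n (\<lambda>(i, j). if i < 0 then x $$ (i, j) else 0) = 0 \<cdot>\<^sub>m 1\<^sub>m n"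
      by (intro eq_matI) auto
    then show ?case using smultA[OF one, of 0] by (simp only:)
  next
    case (Suc m)
    obtain b where b: "b \<in> A" "\<And>i. i < n \<Longrightarrow> (\<Sum>j<n. b $$ (i, j) * u j) = (if i = m then 1 else 0)"
      using trans[OF unz, of "\<lambda>i. if i = m then 1 else 0"] by blast
    obtain d where d: "d \<in> A" "\<And>j. j < n \<Longrightarrow> (\<Sum>i<n. w i * d $$ (i, j)) = x $$ (m, j)"
      using rows[of "\<lambda>j. x $$ (m, j)"] by blast
    have c: "a \<in> carrier_mat n n" "b \<in> carrier_mat n n" "d \<in> carrier_mat n n" "b * a \<in> carrier_mat n n"
      using a b d carr multA by auto
    have "(b * a * d) $$ (i, j) = (if i = m then x $$ (m, j) else 0)" if ij: "i < n" "j < n" for i j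
    proof -
      have "(b * a * d) $$ (i, j) = (\<Sum>q<n. (\<Sum>p<n. b $$ (i, p) * a $$ (p, q)) * d $$ (q, j))"
        using ij by (simp add: mat_mult_entry[OF c(4,3)] mat_mult_entry[OF c(2,1)] del: index_mult_mat)
      also have "\<dots> = (\<Sum>q<n. (\<Sum>p<n. b $$ (i, p) * u p) * (w q * d $$ (q, j)))"
        by (simp add: auw sum_distrib_left sum_distrib_right mult_ac)
      also have "\<dots> = (if i = m then x $$ (m, j) else 0)"
        using ij by (simp add: b(2) d(2)[symmetric])
      finally show ?thesis .
    qed
    then have "mat n n (\<lambda>(i, j). if i < Suc m then x $$ (i, j) else 0) =
        mat n n (\<lambda>(i, j). if i < m then x $$ (i, j) else 0) + b * a * d"
      using c by (intro eq_matI) (auto simp del: index_mult_mat(1) simp: less_Suc_eq)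
    then show ?case using Suc a b d by (auto intro!: addA multA)
  qed
  note full = this[OF order_refl]
  have "x \<in> A" if x: "x \<in> carrier_mat n n" for x
  proof -
    have "mat n n (\<lambda>(i, j). if i < n then x $$ (i, j) else 0) = x"
      using x by (intro eq_matI) auto
    then show ?thesis using full[of x] by simp
  qed
  then show ?thesis using carr by blast
qed

text \<open>The matrix \<open>a\<close> preserves the column space of the reduced echelon form with pivot rows \<open>J\<close> and
  other entries \<open>c\<close>.\<close>
definition preserves :: "nat \<Rightarrow> nat set \<Rightarrow> (nat \<Rightarrow> nat \<Rightarrow> 'f::comm_ring_1) \<Rightarrow> 'f mat \<Rightarrow> bool" where
  "preserves n J c a \<longleftrightarrow> (\<forall>i\<in>{..<n} - J. \<forall>j\<in>J.
     a $$ (i, j) + (\<Sum>l\<in>{..<n} - J. a $$ (i, l) * c l j) =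
     (\<Sum>k\<in>J. c i k * (a $$ (k, j) + (\<Sum>l\<in>{..<n} - J. a $$ (k, l) * c l j))))"

text \<open>As \<open>A\<close> is not transitive, some nonzero \<open>y\<close> has an orbit that
  misses a vector \<open>z\<close>. The orbit is invariant and contains \<open>y\<close> because of
  the identity matrix, so its pivot set is neither empty nor everything.\<close>

lemma burnside:
  fixes A :: "'f::alg_closed_field mat set"
  assumes n: "n > 0" and A: "matrix_algebra n A" and ne: "A \<noteq> carrier_mat n n"
  obtains J c where "J \<subseteq> {..<n}" "J \<noteq> {}" "J \<noteq> {..<n}" "\<And>a. a \<in> A \<Longrightarrow> preserves n J c a"
proof -
  note carr = matrix_algebraD(1)[OF A] and one = matrix_algebraD(2)[OF A] and multA = matrix_algebraD(4)[OF A]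
  have "\<not> (\<forall>y z. (\<exists>i<n. y i \<noteq> 0) \<longrightarrow> (\<exists>a\<in>A. \<forall>i<n. (\<Sum>j<n. a $$ (i, j) * y j) = z i))"
  proof
    assume *: "\<forall>y z. (\<exists>i<n. y i \<noteq> 0) \<longrightarrow> (\<exists>a\<in>A. \<forall>i<n. (\<Sum>j<n. a $$ (i, j) * y j) = z i)"
    have "A = carrier_mat n n"
      by (rule transitive_matrix_algebra[OF n A]) (rule *[rule_format])
    then show False using ne by simp
  qed
  then obtain y z where yz: "\<exists>i<n. y i \<noteq> 0"
    "\<And>a. a \<in> A \<Longrightarrow> \<exists>i<n. (\<Sum>j<n. a $$ (i, j) * y j) \<noteq> z i" by blast
  define W where "W = {v. \<exists>b\<in>A. \<forall>i<n. v i = (\<Sum>j<n. b $$ (i, j) * y j)}"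
  have subW: "subspace_on {..<n} W" unfolding W_def
    by (rule linear_image_subspace_on[OF A])
      (auto simp: distrib_left distrib_right sum.distrib sum_distrib_left mult_ac)
  have act: "(\<lambda>i. \<Sum>j<n. a $$ (i, j) * v j) \<in> W" if v: "v \<in> W" and a: "a \<in> A" for v a
  proof -
    obtain b where b: "b \<in> A" "\<And>i. i < n \<Longrightarrow> v i = (\<Sum>j<n. b $$ (i, j) * y j)"
      using v unfolding W_def by blast
    have "(\<Sum>j<n. a $$ (i, j) * v j) = (\<Sum>j<n. (a * b) $$ (i, j) * y j)" if i: "i < n" for i
    proof -
      have "(\<Sum>j<n. a $$ (i, j) * v j) = (\<Sum>k<n. \<Sum>j<n. a $$ (i, k) * b $$ (k, j) * y j)"
        by (simp add: b(2) sum_distrib_left mult_ac)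
      also have "\<dots> = (\<Sum>j<n. (a * b) $$ (i, j) * y j)"
        using i carr[OF a] carr[OF b(1)]
        by (subst sum.swap) (simp add: mat_mult_entry[of _ n n _ n] sum_distrib_right del: index_mult_mat)
      finally show ?thesis .
    qed
    then show ?thesis unfolding W_def using multA[OF a b(1)] by blast
  qed
  have "\<exists>J c. J \<subseteq> {..<n} \<and> (\<forall>v. v \<in> W \<longleftrightarrow> (\<forall>i\<in>{..<n} - J. v i = (\<Sum>j\<in>J. c i j * v j)))"
    by (rule reduced_echelon_form[OF finite_lessThan subW]) blast
  then obtain J c where J: "J \<subseteq> {..<n}"
    "\<And>v. v \<in> W \<longleftrightarrow> (\<forall>i\<in>{..<n} - J. v i = (\<Sum>j\<in>J. c i j * v j))"
    by blast
  have finJ: "finite J" using J(1) finite_subset by blast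
  have "y \<in> W" unfolding W_def
    by (intro CollectI bexI[OF _ one]) (auto simp: if_distrib[of "\<lambda>x. x * _"] cong: if_cong)
  then have "J \<noteq> {}" using yz(1) J(2)[of y] by auto
  moreover have "z \<notin> W" using yz(2) unfolding W_def by force
  then have "J \<noteq> {..<n}" using J(2)[of z] by auto
  moreover have "preserves n J c a" if a: "a \<in> A" for a
    unfolding preserves_def
  proof (intro ballI)
    fix i j assume i: "i \<in> {..<n} - J" and j: "j \<in> J"
    \<comment> \<open>The \<open>j\<close>-th echelon basis vector: a unit vector on the pivots,
      \<open>c k j\<close> off them. The equation in \<open>preserves\<close> says that its image
      under \<open>a\<close> lies in \<open>W\<close> again.\<close>
    define e where "e k = (if k \<in> J then if k = j then 1 else 0 else c k j)" for k
    have "(\<Sum>k\<in>J. c i k * e k) = c i j" for i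
    proof -
      have "(\<Sum>k\<in>J. c i k * e k) = (\<Sum>k\<in>J. if k = j then c i k else 0)"
        by (intro sum.cong) (auto simp: e_def)
      then show ?thesis using j finJ by simp
    qed
    then have "e \<in> W" by (auto simp: J(2) e_def)
    then have "(\<lambda>i. \<Sum>l<n. a $$ (i, l) * e l) \<in> W" by (rule act[OF _ a])
    then have "(\<Sum>l<n. a $$ (i, l) * e l) = (\<Sum>k\<in>J. c i k * (\<Sum>l<n. a $$ (k, l) * e l))"
      using J(2) i by auto
    moreover have "(\<Sum>l<n. a $$ (k, l) * e l) = a $$ (k, j) + (\<Sum>l\<in>{..<n} - J. a $$ (k, l) * c l j)" for k
    proof -
      have "(\<Sum>l<n. a $$ (k, l) * e l) = (\<Sum>l\<in>{..<n} - J. a $$ (k, l) * e l) + (\<Sum>l\<in>J. a $$ (k, l) * e l)"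
        using J(1) by (intro sum.subset_diff) auto
      moreover have "(\<Sum>l\<in>J. a $$ (k, l) * e l) = (\<Sum>l\<in>J. if l = j then a $$ (k, l) else 0)"
        by (intro sum.cong) (auto simp: e_def)
      then have "(\<Sum>l\<in>J. a $$ (k, l) * e l) = a $$ (k, j)" using j finJ by simp
      ultimately show ?thesis by (simp add: e_def)
    qed
    ultimately show "a $$ (i, j) + (\<Sum>l\<in>{..<n} - J. a $$ (i, l) * c l j) =
     (\<Sum>k\<in>J. c i k * (a $$ (k, j) + (\<Sum>l\<in>{..<n} - J. a $$ (k, l) * c l j)))" by simp
  qed
  ultimately show ?thesis using J(1) that by blast
qed

section \<open>Matrix algebras with involution\<close>

abbreviation mat_pairs :: "nat \<Rightarrow> ('f mat \<times> 'f mat) set" where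
  "mat_pairs n \<equiv> carrier_mat n n \<times> carrier_mat n n"

definition invol_matrix_algebra :: "nat \<Rightarrow> ('f::comm_ring_1 mat \<times> 'f mat) set \<Rightarrow> bool" where
  "invol_matrix_algebra n B \<longleftrightarrow> B \<subseteq> mat_pairs n \<and> (1\<^sub>m n, 1\<^sub>m n) \<in> B \<and>
     (\<forall>a b c d. (a, b) \<in> B \<longrightarrow> (c, d) \<in> B \<longrightarrow> (a + c, b + d) \<in> B \<and> (a * c, b * d) \<in> B) \<and>
     (\<forall>k a b. (a, b) \<in> B \<longrightarrow> (k \<cdot>\<^sub>m a, k \<cdot>\<^sub>m b) \<in> B) \<and>
     (\<forall>a b. (a, b) \<in> B \<longrightarrow> (transpose_mat b, transpose_mat a) \<in> B)"

lemma invol_matrix_algebraD: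
  assumes "invol_matrix_algebra n B"
  shows "(a, b) \<in> B \<Longrightarrow> a \<in> carrier_mat n n" "(a, b) \<in> B \<Longrightarrow> b \<in> carrier_mat n n"
    "(1\<^sub>m n, 1\<^sub>m n) \<in> B"
    "(a, b) \<in> B \<Longrightarrow> (c, d) \<in> B \<Longrightarrow> (a + c, b + d) \<in> B"
    "(a, b) \<in> B \<Longrightarrow> (c, d) \<in> B \<Longrightarrow> (a * c, b * d) \<in> B"
    "(a, b) \<in> B \<Longrightarrow> (k \<cdot>\<^sub>m a, k \<cdot>\<^sub>m b) \<in> B"
    "(a, b) \<in> B \<Longrightarrow> (transpose_mat b, transpose_mat a) \<in> B"
  using assms unfolding invol_matrix_algebra_def by blast+

section \<open>Matrix units and simplicity of the matrix ring\<close>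

definition unit_mat :: "nat \<Rightarrow> nat \<Rightarrow> nat \<Rightarrow> 'f::comm_ring_1 mat" where
  "unit_mat n i j = mat n n (\<lambda>(p, q). if p = i \<and> q = j then 1 else 0)"

lemma unit_mat_carrier [simp]: "unit_mat n i j \<in> carrier_mat n n"
  by (simp add: unit_mat_def)

lemma unit_mat_mult:
  assumes "x \<in> carrier_mat n n" "i < n" "j < n" "p < n" "q < n"
  shows "(unit_mat n i j * x) $$ (p, q) = (if p = i then x $$ (j, q) else 0)"
    and "(x * unit_mat n i j) $$ (p, q) = (if q = j then x $$ (p, i) else 0)"
proof -
  have "(unit_mat n i j * x) $$ (p, q) = (\<Sum>k<n. if k = j then if p = i then x $$ (j, q) else 0 else 0)"
    unfolding mat_mult_entry[OF unit_mat_carrier assms(1,4,5)] using assms by (intro sum.cong refl) (auto simp: unit_mat_def)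
  then show "(unit_mat n i j * x) $$ (p, q) = (if p = i then x $$ (j, q) else 0)"
    using assms by simp
  have "(x * unit_mat n i j) $$ (p, q) = (\<Sum>k<n. if k = i then if q = j then x $$ (p, i) else 0 else 0)"
    unfolding mat_mult_entry[OF assms(1) unit_mat_carrier assms(4,5)] using assms by (intro sum.cong refl) (auto simp: unit_mat_def)
  then show "(x * unit_mat n i j) $$ (p, q) = (if q = j then x $$ (p, i) else 0)"
    using assms by simp
qed

lemma mat_in_unit_mat_span:
  assumes "x \<in> carrier_mat n n" and zero: "0\<^sub>m n n \<in> S"
    and add: "\<And>a b. a \<in> S \<Longrightarrow> b \<in> S \<Longrightarrow> a + b \<in> S"
    and smult: "\<And>c a. a \<in> S \<Longrightarrow> c \<cdot>\<^sub>m a \<in> S"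
    and units: "\<And>i j. i < n \<Longrightarrow> j < n \<Longrightarrow> unit_mat n i j \<in> S"
  shows "x \<in> S"
proof -
  have "mat n n (\<lambda>ij. if ij \<in> P then x $$ ij else 0) \<in> S" if "finite P" "P \<subseteq> {..<n} \<times> {..<n}" for P
    using that
  proof (induction P)
    case empty
    have "mat n n (\<lambda>ij. if ij \<in> {} then x $$ ij else 0) = 0\<^sub>m n n" by (intro eq_matI) auto
    then show ?case using zero by simp
  next
    case (insert q P)
    obtain i j where q: "q = (i, j)" "i < n" "j < n" using insert.prems by auto
    have "mat n n (\<lambda>ij. if ij \<in> insert q P then x $$ ij else 0) =
        mat n n (\<lambda>ij. if ij \<in> P then x $$ ij else 0) + x $$ q \<cdot>\<^sub>m unit_mat n i j"
      using insert.hyps q(1) by (intro eq_matI) (auto simp: unit_mat_def)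
    then show ?case using insert q by (auto intro!: add smult units)
  qed
  from this[of "{..<n} \<times> {..<n}"] have "mat n n (\<lambda>ij. if ij \<in> {..<n} \<times> {..<n} then x $$ ij else 0) \<in> S"
    by simp
  also have "mat n n (\<lambda>ij. if ij \<in> {..<n} \<times> {..<n} then x $$ ij else 0) = x"
    using assms(1) by (intro eq_matI) auto
  finally show ?thesis .
qed

text \<open>Because the first projection is onto, the elements of \<open>B\<close> with second
  component zero form a two-sided ideal of the matrix ring. By simplicity the whole first factor
  lies in \<open>B\<close>, and the involution carries it onto the second factor.\<close>

lemma invol_matrix_algebra_first_ideal:
  fixes B :: "('f::field mat \<times> 'f mat) set"
  assumes B: "invol_matrix_algebra n B" and onto: "fst ` B = carrier_mat n n"
    and x: "(x, 0\<^sub>m n n) \<in> B" "x \<noteq> 0\<^sub>m n n"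
  shows "B = mat_pairs n"
proof -
  note D = invol_matrix_algebraD[OF B]
  have xc: "x \<in> carrier_mat n n" using D(1)[OF x(1)] .
  then obtain k l where kl: "k < n" "l < n" "x $$ (k, l) \<noteq> 0"
    using x(2) by (metis carrier_matD eq_matI index_zero_mat)
  have two_sided: "(p * y * q, 0\<^sub>m n n) \<in> B"
    if pq: "p \<in> carrier_mat n n" "q \<in> carrier_mat n n" and y: "(y, 0\<^sub>m n n) \<in> B" for p q y
  proof -
    obtain p' q' where p': "(p, p') \<in> B" "(q, q') \<in> B"
      using pq onto by (metis (no_types, lifting) imageE prod.collapse)
    have "(p * y * q, p' * 0\<^sub>m n n * q') \<in> B" by (intro D(5) p' y)
    moreover have "p' * 0\<^sub>m n n * q' = 0\<^sub>m n n" using D(2)[OF p'(1)] D(2)[OF p'(2)] by simp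
    ultimately show ?thesis by simp
  qed
  have E: "(unit_mat n i j, 0\<^sub>m n n) \<in> B" if ij: "i < n" "j < n" for i j
  proof -
    have u: "unit_mat n i k * x \<in> carrier_mat n n" using xc by (intro mult_carrier_mat) auto
    \<comment> \<open>Multiplication by matrix units isolates the nonzero entry: \<open>?y\<close>
      is \<open>x $$ (k, l)\<close> times the matrix unit at \<open>(i, j)\<close>.\<close>
    let ?y = "unit_mat n i k * x * unit_mat n l j"
    let ?e = "inverse (x $$ (k, l)) \<cdot>\<^sub>m ?y"
    have "unit_mat n i j = ?e"
    proof (rule eq_matI)
      fix p q assume "p < dim_row ?e"
        "q < dim_col ?e"
      then have pq: "p < n" "q < n" by (auto simp: unit_mat_def)
      then have "(?y) $$ (p, q) =
          (if p = i \<and> q = j then x $$ (k, l) else 0)"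
        unfolding unit_mat_mult(2)[OF u kl(2) ij(2) pq] unit_mat_mult(1)[OF xc ij(1) kl(1) pq(1) kl(2)]
        by auto
      then show "unit_mat n i j $$ (p, q) = ?e $$ (p, q)"
        using pq kl(3) by (subst index_smult_mat) (auto simp: unit_mat_def)
    qed (auto simp: unit_mat_def)
    moreover have "(?e,
        inverse (x $$ (k, l)) \<cdot>\<^sub>m 0\<^sub>m n n) \<in> B"
      by (intro D(6) two_sided x) auto
    moreover have "inverse (x $$ (k, l)) \<cdot>\<^sub>m 0\<^sub>m n n = 0\<^sub>m n n" by (intro eq_matI) auto
    ultimately show ?thesis by simp
  qed
  have all: "(y, 0\<^sub>m n n) \<in> B" if y: "y \<in> carrier_mat n n" for y
  proof (rule mat_in_unit_mat_span[where S = "{y. (y, 0\<^sub>m n n) \<in> B}", simplified, OF y])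
    have "(0 \<cdot>\<^sub>m 1\<^sub>m n, 0 \<cdot>\<^sub>m 1\<^sub>m n) \<in> B" by (intro D(6) D(3))
    moreover have "0 \<cdot>\<^sub>m 1\<^sub>m n = (0\<^sub>m n n :: 'f mat)" by (intro eq_matI) auto
    ultimately show "(0\<^sub>m n n, 0\<^sub>m n n) \<in> B" by simp
  next
    fix a b assume "(a, 0\<^sub>m n n) \<in> B" "(b, 0\<^sub>m n n) \<in> B"
    from D(4)[OF this] show "(a + b, 0\<^sub>m n n) \<in> B" by simp
  next
    fix c a assume "(a, 0\<^sub>m n n) \<in> B"
    moreover have "c \<cdot>\<^sub>m 0\<^sub>m n n = (0\<^sub>m n n :: 'f mat)" by (intro eq_matI) auto
    ultimately show "(c \<cdot>\<^sub>m a, 0\<^sub>m n n) \<in> B" using D(6)[of a "0\<^sub>m n n" c] by simp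
  qed (rule E)
  show ?thesis
  proof
    show "mat_pairs n \<subseteq> B"
    proof clarify
      fix a b :: "'f mat" assume ab: "a \<in> carrier_mat n n" "b \<in> carrier_mat n n"
      have "(transpose_mat (0\<^sub>m n n), transpose_mat (transpose_mat b)) \<in> B"
        using all[of "transpose_mat b"] ab by (intro D(7)) simp
      then have "(0\<^sub>m n n, b) \<in> B" by simp
      from D(4)[OF all[OF ab(1)] this] show "(a, b) \<in> B" using ab by simp
    qed
  qed (use D(1,2) in auto)
qed

text \<open>The intertwiner is \<open>g e\<^sub>i = \<phi>(E\<^sub>i\<^sub>0) w\<close> for a column \<open>w\<close> of \<open>\<phi>(E\<^sub>0\<^sub>0)\<close>, where \<open>\<phi>\<close> is the
  automorphism with graph \<open>B\<close>. By the involution \<open>g\<^sup>t\<close> intertwines as well, so Schur's lemma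
  makes it a multiple of \<open>g\<close>.\<close>
lemma invol_matrix_algebra_graph:
  fixes B :: "('f::field mat \<times> 'f mat) set"
  assumes n: "n > 0" and B: "invol_matrix_algebra n B" and onto: "fst ` B = carrier_mat n n"
    and proper: "B \<noteq> mat_pairs n"
  obtains g \<epsilon> where "g \<in> carrier_mat n n" "det g \<noteq> 0" "\<epsilon> = 1 \<or> \<epsilon> = - 1"
    "transpose_mat g = \<epsilon> \<cdot>\<^sub>m g" "\<And>a b. (a, b) \<in> B \<Longrightarrow> b * g = g * a"
proof -
  note D = invol_matrix_algebraD[OF B]
  \<comment> \<open>No nonzero element of \<open>B\<close> has second component zero, and by the
    involution none has first component zero. Hence the second component is determined by the
    first.\<close>
  have zero: "a = 0\<^sub>m n n" if "(a, 0\<^sub>m n n) \<in> B" for a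
    using invol_matrix_algebra_first_ideal[OF B onto that] proper by blast
  have inj: "b = 0\<^sub>m n n" if "(0\<^sub>m n n, b) \<in> B" for b
  proof -
    have "(transpose_mat b, 0\<^sub>m n n) \<in> B" using D(7)[OF that] by simp
    from zero[OF this] show ?thesis by (metis transpose_transpose zero_transpose_mat)
  qed
  have uniq: "b = b'" if ab: "(a, b) \<in> B" "(a, b') \<in> B" for a b b'
  proof -
    note c = D(1)[OF ab(1)] D(2)[OF ab(1)] D(2)[OF ab(2)]
    have "(a + (- 1) \<cdot>\<^sub>m a, b + (- 1) \<cdot>\<^sub>m b') \<in> B" by (intro D(4) D(6) ab)
    moreover have "a + (- 1) \<cdot>\<^sub>m a = 0\<^sub>m n n" using c by (intro eq_matI) auto
    ultimately have "b + (- 1) \<cdot>\<^sub>m b' = 0\<^sub>m n n" using inj by simp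
    moreover have "b $$ (i, j) = (b + (- 1) \<cdot>\<^sub>m b') $$ (i, j) + b' $$ (i, j)" if "i < n" "j < n" for i j
      using that c by simp
    ultimately show ?thesis using c by (intro eq_matI) auto
  qed
  define \<phi> where "\<phi> a = (SOME b. (a, b) \<in> B)" for a
  have \<phi>: "(a, \<phi> a) \<in> B" if "a \<in> carrier_mat n n" for a
  proof -
    have "a \<in> fst ` B" using that onto by simp
    then have "\<exists>b. (a, b) \<in> B" by auto
    then show ?thesis unfolding \<phi>_def by (rule someI_ex)
  qed
  have \<phi>_eq: "\<phi> a = b" if "(a, b) \<in> B" for a b
    using uniq[OF \<phi> that] D(1)[OF that] by simp
  have E0: "(unit_mat n i j, \<phi> (unit_mat n i j)) \<in> B" for i j by (intro \<phi>) simp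
  have "\<phi> (unit_mat n 0 0) \<noteq> 0\<^sub>m n n"
  proof
    assume "\<phi> (unit_mat n 0 0) = 0\<^sub>m n n"
    then have "(unit_mat n 0 0 :: 'f mat) = 0\<^sub>m n n" using zero E0[of 0 0] by simp
    from arg_cong[OF this, of "\<lambda>m. m $$ (0, 0)"] n show False by (simp add: unit_mat_def)
  qed
  then obtain p0 q where pq: "p0 < n" "q < n" "\<phi> (unit_mat n 0 0) $$ (p0, q) \<noteq> 0"
    using D(2)[OF E0[of 0 0]] by (metis carrier_matD eq_matI index_zero_mat)
  \<comment> \<open>The matrix unit at \<open>(i, 0)\<close> equals its product with the one at
    \<open>(0, 0)\<close>. So this column is \<open>\<phi>\<close> of the former applied to column
    \<open>q\<close> of \<open>\<phi>\<close> of the latter, and the choice of \<open>q\<close>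
    makes \<open>g $$ (p0, 0)\<close> nonzero.\<close>
  define g where "g = mat n n (\<lambda>(p, i). \<phi> (unit_mat n i 0) $$ (p, q))"
  have g: "g \<in> carrier_mat n n" by (simp add: g_def)
  \<comment> \<open>Linearity of \<open>\<phi>\<close> on matrices supported in the first column,
    built up one entry at a time.\<close>
  have comb: "(mat n n (\<lambda>(p, s). if s = 0 \<and> p < m then x p else 0),
      mat n n (\<lambda>(p, s). \<Sum>k<m. x k * \<phi> (unit_mat n k 0) $$ (p, s))) \<in> B" if "m \<le> n" for m and x :: "nat \<Rightarrow> 'f"
    using that
  proof (induction m)
    case 0
    have "(0 \<cdot>\<^sub>m 1\<^sub>m n, 0 \<cdot>\<^sub>m 1\<^sub>m n) \<in> B" by (intro D(6) D(3))
    moreover have "mat n n (\<lambda>(p, s). if s = 0 \<and> p < 0 then x p else 0) = 0 \<cdot>\<^sub>m 1\<^sub>m n"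
      "mat n n (\<lambda>(p, s). \<Sum>k<0. x k * \<phi> (unit_mat n k 0) $$ (p, s)) = 0 \<cdot>\<^sub>m 1\<^sub>m n"
      by (intro eq_matI; simp)+
    ultimately show ?case by (simp only:)
  next
    case (Suc m)
    let ?u = "mat n n (\<lambda>(p, s). if s = 0 \<and> p < m then x p else 0) + x m \<cdot>\<^sub>m unit_mat n m 0"
    let ?v = "mat n n (\<lambda>(p, s). \<Sum>k<m. x k * \<phi> (unit_mat n k 0) $$ (p, s)) + x m \<cdot>\<^sub>m \<phi> (unit_mat n m 0)"
    have "(?u, ?v) \<in> B" by (intro D(4) D(6) E0 Suc.IH) (use Suc.prems in simp)
    moreover have "?u = mat n n (\<lambda>(p, s). if s = 0 \<and> p < Suc m then x p else 0)"
      by (intro eq_matI) (auto simp: unit_mat_def less_Suc_eq)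
    moreover have "?v = mat n n (\<lambda>(p, s). \<Sum>k<Suc m. x k * \<phi> (unit_mat n k 0) $$ (p, s))"
      using D(2)[OF E0[of m 0]] by (intro eq_matI) auto
    ultimately show ?case by (simp only:)
  qed
  have g_intertwines: "b * g = g * a" if ab: "(a, b) \<in> B" for a b
  proof (rule eq_matI)
    note c = D(1)[OF ab] D(2)[OF ab]
    fix p i assume "p < dim_row (g * a)" "i < dim_col (g * a)"
    then have pi: "p < n" "i < n" using g c by auto
    have "a * unit_mat n i 0 = mat n n (\<lambda>(p, s). if s = 0 \<and> p < n then a $$ (p, i) else 0)"
    proof (rule eq_matI)
      fix p s assume "p < dim_row (mat n n (\<lambda>(p, s). if s = 0 \<and> p < n then a $$ (p, i) else 0))"
        "s < dim_col (mat n n (\<lambda>(p, s). if s = 0 \<and> p < n then a $$ (p, i) else 0))"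
      then show "(a * unit_mat n i 0) $$ (p, s) =
          mat n n (\<lambda>(p, s). if s = 0 \<and> p < n then a $$ (p, i) else 0) $$ (p, s)"
        using unit_mat_mult(2)[OF c(1) pi(2) n] by auto
    qed (use c in \<open>auto simp: unit_mat_def\<close>)
    then have "\<phi> (a * unit_mat n i 0) = mat n n (\<lambda>(p, s). \<Sum>k<n. a $$ (k, i) * \<phi> (unit_mat n k 0) $$ (p, s))"
      using \<phi>_eq[OF comb[OF order_refl, of "\<lambda>k. a $$ (k, i)"]] by simp
    moreover have "\<phi> (a * unit_mat n i 0) = b * \<phi> (unit_mat n i 0)"
      by (intro \<phi>_eq D(5) ab E0)
    ultimately have "(b * \<phi> (unit_mat n i 0)) $$ (p, q) = (\<Sum>k<n. a $$ (k, i) * \<phi> (unit_mat n k 0) $$ (p, q))"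
      using pi pq by simp
    moreover have "(b * \<phi> (unit_mat n i 0)) $$ (p, q) = (b * g) $$ (p, i)"
      unfolding mat_mult_entry[OF c(2) D(2)[OF E0] pi(1) pq(2)] mat_mult_entry[OF c(2) g pi]
      using pi by (intro sum.cong) (auto simp: g_def)
    moreover have "(\<Sum>k<n. a $$ (k, i) * \<phi> (unit_mat n k 0) $$ (p, q)) = (g * a) $$ (p, i)"
      unfolding mat_mult_entry[OF g c(1) pi]
      using pi by (intro sum.cong) (auto simp: g_def mult.commute)
    ultimately show "(b * g) $$ (p, i) = (g * a) $$ (p, i)" by simp
  qed (use D(1,2)[OF ab] g in auto)
  have g_nz: "g $$ (p0, 0) \<noteq> 0" using pq n by (simp add: g_def)
  have det: "det g \<noteq> 0"
  proof
    assume "det g = 0"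
    then obtain v where v: "v \<in> carrier_vec n" "v \<noteq> 0\<^sub>v n" "g *\<^sub>v v = 0\<^sub>v n"
      using det_0_iff_vec_prod_zero_field[OF g] by auto
    then obtain j where j: "j < n" "v $ j \<noteq> 0" by (metis carrier_vecD eq_vecI index_zero_vec)
    \<comment> \<open>The matrix unit at \<open>(0, j)\<close> maps \<open>v\<close> to
      \<open>v $ j\<close> times the first unit vector. By intertwining, the kernel of
      \<open>g\<close> is stable under all matrices, so the first column of \<open>g\<close> would
      vanish.\<close>
    let ?E = "unit_mat n 0 j :: 'f mat"
    note c = D(2)[OF E0[of 0 j]]
    have "(g * ?E) *\<^sub>v v = \<phi> ?E *\<^sub>v (g *\<^sub>v v)"
      using g_intertwines[OF E0[of 0 j]] assoc_mult_mat_vec[OF c g v(1)] by simp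
    also have "\<dots> = 0\<^sub>v n" using v(3) c by auto
    finally have "((g * ?E) *\<^sub>v v) $ p0 = 0" using pq by simp
    moreover have "(x *\<^sub>v v) $ p0 = (\<Sum>s<n. x $$ (p0, s) * v $ s)" if "x \<in> carrier_mat n n" for x
      using that pq v by (auto simp: scalar_prod_def lessThan_atLeast0 intro!: sum.cong)
    from this[OF mult_carrier_mat[OF g unit_mat_carrier]]
    have "((g * ?E) *\<^sub>v v) $ p0 = (\<Sum>s<n. (g * ?E) $$ (p0, s) * v $ s)" .
    moreover have "\<dots> = (\<Sum>s<n. if s = j then g $$ (p0, 0) * v $ j else 0)"
      using unit_mat_mult(2)[OF g n j(1) pq(1)] by (intro sum.cong) auto
    ultimately show False using j g_nz by simp
  qed
  define h where "h = inverse (det g) \<cdot>\<^sub>m adj_mat g"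
  have adj: "adj_mat g \<in> carrier_mat n n" using adj_mat(1)[OF g] .
  have h: "h \<in> carrier_mat n n" using adj by (simp add: h_def)
  have gh: "g * h = 1\<^sub>m n" unfolding h_def mult_smult_distrib[OF g adj] adj_mat(2)[OF g]
    using det by (intro eq_matI) auto
  have hg: "h * g = 1\<^sub>m n" unfolding h_def mult_smult_assoc_mat[OF adj g] adj_mat(3)[OF g]
    using det by (intro eq_matI) auto
  have gt: "transpose_mat g \<in> carrier_mat n n" using g by simp
  define z where "z = h * transpose_mat g"
  have z: "z \<in> carrier_mat n n" unfolding z_def using h gt by (rule mult_carrier_mat)
  \<comment> \<open>The transpose of \<open>g\<close> also intertwines \<open>x\<close> with
    \<open>\<phi> x\<close>: this is the transposed relation for the image of
    \<open>(x, \<phi> x)\<close> under the involution. Hence \<open>z\<close>, the inverse of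
    \<open>g\<close> times this transpose, commutes with every matrix.\<close>
  have comm: "x * z = z * x" if x: "x \<in> carrier_mat n n" for x
  proof -
    note xy = \<phi>[OF x]
    note y = D(2)[OF xy]
    have "x * h = h * g * (x * h)" using hg x h by simp
    also have "\<dots> = h * (g * x) * h" using x h g by (simp add: assoc_mult_mat[of _ n n _ n _ n])
    also have "g * x = \<phi> x * g" using g_intertwines[OF xy] ..
    also have "h * (\<phi> x * g) * h = h * \<phi> x * (g * h)"
      using y h g by (simp add: assoc_mult_mat[of _ n n _ n _ n])
    finally have xh: "x * h = h * \<phi> x" using gh h y by simp
    have "transpose_mat x * g = g * transpose_mat (\<phi> x)"
      by (rule g_intertwines[OF D(7)[OF xy]])
    from arg_cong[OF this, of transpose_mat]
    have "transpose_mat g * x = \<phi> x * transpose_mat g"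
      using x y g by (simp add: transpose_mult[of _ n n _ n])
    then have "h * (transpose_mat g * x) = x * h * transpose_mat g"
      unfolding xh using assoc_mult_mat[OF h y gt] by simp
    then show ?thesis unfolding z_def
      using assoc_mult_mat[OF x h gt] assoc_mult_mat[OF h gt x] by simp
  qed
  define \<epsilon> where "\<epsilon> = z $$ (0, 0)"
  have z_scalar: "z = \<epsilon> \<cdot>\<^sub>m 1\<^sub>m n"
  proof (rule eq_matI)
    fix i j assume "i < dim_row (\<epsilon> \<cdot>\<^sub>m 1\<^sub>m n)" "j < dim_col (\<epsilon> \<cdot>\<^sub>m 1\<^sub>m n)"
    then have ij: "i < n" "j < n" by auto
    have "(unit_mat n 0 i * z) $$ (0, j) = (z * unit_mat n 0 i) $$ (0, j)" by (simp add: comm)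
    then show "z $$ (i, j) = (\<epsilon> \<cdot>\<^sub>m 1\<^sub>m n) $$ (i, j)"
      using unit_mat_mult[OF z n ij(1) n ij(2)] ij by (auto simp: \<epsilon>_def)
  qed (use z in auto)
  have "transpose_mat g = g * z" unfolding z_def
    using assoc_mult_mat[OF g h gt] gh gt by simp
  then have tg: "transpose_mat g = \<epsilon> \<cdot>\<^sub>m g"
    unfolding z_scalar using mult_smult_distrib[OF g one_carrier_mat] g by simp
  \<comment> \<open>Transposing twice returns \<open>g\<close>, which forces
    \<open>\<epsilon> * \<epsilon> = 1\<close>.\<close>
  have "g = transpose_mat (\<epsilon> \<cdot>\<^sub>m g)" by (simp flip: tg)
  also have "\<dots> = \<epsilon> \<cdot>\<^sub>m transpose_mat g" by (intro eq_matI) auto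
  finally have "g = \<epsilon> \<cdot>\<^sub>m (\<epsilon> \<cdot>\<^sub>m g)" unfolding tg .
  from arg_cong[OF this, of "\<lambda>m. m $$ (p0, 0)"] have "\<epsilon> * \<epsilon> = 1"
    using g_nz g pq n by simp
  then have \<epsilon>: "\<epsilon> = 1 \<or> \<epsilon> = - 1" by (simp add: square_eq_1_iff)
  show ?thesis by (rule that[OF g det \<epsilon> tg g_intertwines])
qed

text \<open>Burnside's theorem is applied to the first projection of \<open>B\<close>. The
  involution puts \<open>transpose_mat b\<close> into that projection, so the invariant subspace
  serves for the second components as well.\<close>

lemma proper_invol_matrix_algebra_cases:
  fixes B :: "('f::alg_closed_field mat \<times> 'f mat) set"
  assumes n: "n > 0" and B: "invol_matrix_algebra n B"
    and proper: "B \<noteq> mat_pairs n"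
  obtains (invariant_subspace) J c where "J \<subseteq> {..<n}" "J \<noteq> {}" "J \<noteq> {..<n}"
      "\<And>a b. (a, b) \<in> B \<Longrightarrow> preserves n J c a \<and> preserves n J c (transpose_mat b)"
    | (intertwiner) g \<epsilon> where "g \<in> carrier_mat n n" "det g \<noteq> 0" "\<epsilon> = 1 \<or> \<epsilon> = - 1"
      "transpose_mat g = \<epsilon> \<cdot>\<^sub>m g" "\<And>a b. (a, b) \<in> B \<Longrightarrow> b * g = g * a"
proof (cases "fst ` B = carrier_mat n n")
  case True
  show ?thesis
    by (rule invol_matrix_algebra_graph[OF n B True proper]) (rule intertwiner)
next
  case False
  note D = invol_matrix_algebraD[OF B]
  have "matrix_algebra n (fst ` B)"
    unfolding matrix_algebra_def
  proof (intro conjI ballI allI)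
    show "fst ` B \<subseteq> carrier_mat n n" using D(1) by auto
    show "1\<^sub>m n \<in> fst ` B" using D(3) by (auto simp: image_iff intro: bexI[rotated])
  next
    fix a b assume "a \<in> fst ` B" "b \<in> fst ` B"
    then obtain a' b' where "(a, a') \<in> B" "(b, b') \<in> B" by auto
    from D(4)[OF this] D(5)[OF this] show "a + b \<in> fst ` B" "a * b \<in> fst ` B"
      by (auto simp: image_iff intro: bexI[rotated])
  next
    fix c a assume "a \<in> fst ` B"
    then obtain a' where "(a, a') \<in> B" by auto
    from D(6)[OF this, of c] show "c \<cdot>\<^sub>m a \<in> fst ` B" by (auto simp: image_iff intro: bexI[rotated])
  qed
  from burnside[OF n this False] obtain J c where J: "J \<subseteq> {..<n}" "J \<noteq> {}" "J \<noteq> {..<n}"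
      "\<And>a. a \<in> fst ` B \<Longrightarrow> preserves n J c a" by metis
  have "preserves n J c a \<and> preserves n J c (transpose_mat b)" if "(a, b) \<in> B" for a b
    using J(4)[OF imageI[OF that]] J(4)[OF imageI[OF D(7)[OF that]]] by simp
  with J(1-3) show ?thesis by (rule invariant_subspace)
qed

section \<open>Polynomials, primes and chains\<close>

definition meval :: "(var \<Rightarrow> 'l::comm_ring_1) \<Rightarrow> (var \<Rightarrow>\<^sub>0 nat) \<Rightarrow> 'l" where
  "meval x m = (\<Prod>v\<in>Poly_Mapping.keys m. x v ^ Poly_Mapping.lookup m v)"

text \<open>The counterpart of \<open>mpoly_eval\<close> for rings given by type classes;
  \<open>mpoly_eval_transport\<close> connects the two.\<close>

definition peval :: "('k::comm_ring_1 \<Rightarrow> 'l::comm_ring_1) \<Rightarrow> (var \<Rightarrow> 'l) \<Rightarrow> 'k mpoly \<Rightarrow> 'l" where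
  "peval \<kappa> x f = (\<Sum>m\<in>Poly_Mapping.keys f. \<kappa> (Poly_Mapping.lookup f m) * meval x m)"

definition Const :: "'k::comm_ring_1 \<Rightarrow> 'k mpoly" where
  "Const c = Poly_Mapping.single 0 c"

definition Var :: "var \<Rightarrow> 'k::comm_ring_1 mpoly" where
  "Var v = Poly_Mapping.single (Poly_Mapping.single v 1) 1"

lemma meval_superset:
  assumes "finite S" "Poly_Mapping.keys m \<subseteq> S"
  shows "meval x m = (\<Prod>v\<in>S. x v ^ Poly_Mapping.lookup m v)"
  unfolding meval_def by (rule prod.mono_neutral_left) (use assms in \<open>auto simp: in_keys_iff\<close>)

lemma meval_add: "meval x (m + m') = meval x m * meval x m'"
proof -
  let ?S = "Poly_Mapping.keys m \<union> Poly_Mapping.keys m'"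
  have "Poly_Mapping.keys (m + m') \<subseteq> ?S" by (rule keys_add)
  then show ?thesis
    by (simp add: meval_superset[of ?S] lookup_add power_add prod.distrib)
qed

lemma peval_superset:
  assumes "\<kappa> 0 = 0" "finite S" "Poly_Mapping.keys f \<subseteq> S"
  shows "peval \<kappa> x f = (\<Sum>m\<in>S. \<kappa> (Poly_Mapping.lookup f m) * meval x m)"
  unfolding peval_def by (rule sum.mono_neutral_left) (use assms in \<open>auto simp: in_keys_iff\<close>)

lemma mpoly_sum_singles: "f = (\<Sum>m\<in>Poly_Mapping.keys f. Poly_Mapping.single m (Poly_Mapping.lookup f m))"
proof (rule poly_mapping_eqI)
  fix k
  show "Poly_Mapping.lookup f k =
      Poly_Mapping.lookup (\<Sum>m\<in>Poly_Mapping.keys f. Poly_Mapping.single m (Poly_Mapping.lookup f m)) k"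
    by (auto simp: lookup_sum lookup_single when_def in_keys_iff)
qed

lemma mpoly_induct [case_names single add]:
  assumes "\<And>m c. P (Poly_Mapping.single m c)" and "\<And>f g. P f \<Longrightarrow> P g \<Longrightarrow> P (f + g)"
  shows "P (f :: 'k::comm_ring_1 mpoly)"
proof -
  have "P (\<Sum>m\<in>S. Poly_Mapping.single m (c m))" if "finite S" for S and c :: "(var \<Rightarrow>\<^sub>0 nat) \<Rightarrow> 'k"
    using that
  proof (induction S)
    case empty
    show ?case using assms(1)[of 0 0] by simp
  qed (auto intro: assms)
  then show ?thesis by (subst mpoly_sum_singles) auto
qed

context comm_ring_hom
begin

lemma peval_add: "peval hom x (f + g) = peval hom x f + peval hom x g"
proof -
  let ?S = "Poly_Mapping.keys f \<union> Poly_Mapping.keys g"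
  have "Poly_Mapping.keys (f + g) \<subseteq> ?S" by (rule keys_add)
  then show ?thesis
    by (simp add: peval_superset[of hom ?S] lookup_add hom_add distrib_right sum.distrib)
qed

lemma peval_single: "peval hom x (Poly_Mapping.single m c) = hom c * meval x m"
  by (subst peval_superset[of hom "{m}"]) auto

lemma peval_mult: "peval hom x (f * g) = peval hom x f * peval hom x g"
proof (induction f rule: mpoly_induct)
  case (single m c)
  show ?case
    by (induction g rule: mpoly_induct)
      (simp_all add: mult_single peval_single peval_add hom_mult meval_add distrib_left)
qed (simp add: distrib_right peval_add)

lemma peval_Const: "peval hom x (Const c) = hom c"
  by (simp add: Const_def peval_single meval_def)

lemma peval_Var: "peval hom x (Var v) = x v"
  by (simp add: Var_def peval_single meval_def)

lemma comm_ring_hom_peval: "comm_ring_hom (peval hom x)"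
  using peval_Const[of x 1] peval_Const[of x 0]
  by unfold_locales (auto simp: peval_add peval_mult Const_def)

end

lemma peval_hom:
  assumes "comm_ring_hom h"
  shows "h (peval \<kappa> x f) = peval (\<lambda>c. h (\<kappa> c)) (\<lambda>v. h (x v)) f"
proof -
  interpret comm_ring_hom h by fact
  show ?thesis by (simp add: peval_def meval_def hom_sum hom_prod hom_mult hom_power)
qed

lemma peval_cong:
  assumes "\<And>m v. m \<in> Poly_Mapping.keys f \<Longrightarrow> v \<in> Poly_Mapping.keys m \<Longrightarrow> x v = y v"
  shows "peval \<kappa> x f = peval \<kappa> y f"
  unfolding peval_def meval_def by (intro sum.cong prod.cong arg_cong2[of _ _ _ _ "(*)"] refl) (simp add: assms)

lemma comm_ring_hom_Const: "comm_ring_hom (Const :: 'k::comm_ring_1 \<Rightarrow> 'k mpoly)"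
  by unfold_locales (auto simp: Const_def single_add mult_single)

lemma meval_Var: "meval Var m = (Poly_Mapping.single m 1 :: 'k::comm_ring_1 mpoly)"
proof -
  have pow: "(Var v ^ e :: 'k mpoly) = Poly_Mapping.single (Poly_Mapping.single v e) 1" for v e
    by (induction e) (auto simp: Var_def mult_single simp flip: single_add)
  have "(\<Prod>v\<in>S. Var v ^ Poly_Mapping.lookup m v :: 'k mpoly) =
      Poly_Mapping.single (\<Sum>v\<in>S. Poly_Mapping.single v (Poly_Mapping.lookup m v)) 1" if "finite S" for S
    using that by (induction S) (auto simp: pow mult_single)
  moreover have "(\<Sum>v\<in>Poly_Mapping.keys m. Poly_Mapping.single v (Poly_Mapping.lookup m v)) = m"
    by (rule poly_mapping_eqI) (auto simp: lookup_sum lookup_single when_def in_keys_iff)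
  ultimately show ?thesis by (simp add: meval_def)
qed

lemma peval_Const_Var: "peval Const Var f = f"
  by (subst (3) mpoly_sum_singles) (simp add: peval_def meval_Var Const_def mult_single)

text \<open>The ring is a subset \<open>R\<close> of a type, so that one notion covers the
  coordinate ring and, with \<open>R = UNIV\<close>, the ring of polynomials in all
  variables.\<close>

definition prime_in :: "'a::comm_ring_1 set \<Rightarrow> 'a set \<Rightarrow> bool" where
  "prime_in R P \<longleftrightarrow> P \<subseteq> R \<and> 0 \<in> P \<and> (\<forall>x\<in>P. \<forall>y\<in>P. x + y \<in> P) \<and> (\<forall>a\<in>R. \<forall>x\<in>P. a * x \<in> P) \<and>
     1 \<notin> P \<and> (\<forall>a\<in>R. \<forall>b\<in>R. a * b \<in> P \<longrightarrow> a \<in> P \<or> b \<in> P)"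

section \<open>The coordinate ring and its prime ideals\<close>

definition coords :: "nat \<Rightarrow> nat \<Rightarrow> 'k::comm_ring_1 mpoly set" where
  "coords n r = {f. \<forall>m\<in>Poly_Mapping.keys f. Poly_Mapping.keys m \<subseteq> vars n r}"

lemma coords_add: "f \<in> coords n r \<Longrightarrow> g \<in> coords n r \<Longrightarrow> f + g \<in> coords n r"
  using keys_add[of f g] by (auto simp: coords_def)

lemma coords_mult:
  assumes "f \<in> coords n r" "g \<in> coords n r" shows "f * g \<in> coords n r"
proof -
  have "Poly_Mapping.keys m \<subseteq> vars n r" if m: "m \<in> Poly_Mapping.keys (f * g)" for m
  proof -
    obtain a b where ab: "m = a + b" "a \<in> Poly_Mapping.keys f" "b \<in> Poly_Mapping.keys g"
      using m keys_mult[of f g] by blast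
    then have "Poly_Mapping.keys a \<subseteq> vars n r" "Poly_Mapping.keys b \<subseteq> vars n r"
      using assms by (auto simp: coords_def)
    then show ?thesis using keys_add[of a b] ab(1) by blast
  qed
  then show ?thesis by (auto simp: coords_def)
qed

lemma coords_Const: "Const c \<in> coords n r"
  by (auto simp: coords_def Const_def)

lemma coords_0: "0 \<in> coords n r" and coords_1: "1 \<in> coords n r"
  using coords_Const[of 0 n r] coords_Const[of 1 n r] by (auto simp: Const_def)

lemma coords_uminus: "f \<in> coords n r \<Longrightarrow> - f \<in> coords n r"
  by (auto simp: coords_def in_keys_iff)

lemma coords_Var: "v \<in> vars n r \<Longrightarrow> Var v \<in> coords n r"
  by (auto simp: coords_def Var_def)

lemma coords_sum: "(\<And>i. i \<in> I \<Longrightarrow> f i \<in> coords n r) \<Longrightarrow> sum f I \<in> coords n r"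
  by (induction I rule: infinite_finite_induct) (auto simp: coords_0 coords_add)

lemma coords_prod: "(\<And>i. i \<in> I \<Longrightarrow> f i \<in> coords n r) \<Longrightarrow> prod f I \<in> coords n r"
  by (induction I rule: infinite_finite_induct) (auto simp: coords_1 coords_mult)

lemma coords_power: "f \<in> coords n r \<Longrightarrow> f ^ e \<in> coords n r"
  by (induction e) (auto simp: coords_1 coords_mult)

lemma coord_ring_simps:
  "carrier (coord_ring n r) = coords n r"
  "f \<oplus>\<^bsub>coord_ring n r\<^esub> g = f + g" "f \<otimes>\<^bsub>coord_ring n r\<^esub> g = f * g"
  "\<zero>\<^bsub>coord_ring n r\<^esub> = 0" "\<one>\<^bsub>coord_ring n r\<^esub> = 1"
  by (auto simp: coord_ring_def coords_def ring_of_type_algebra_def)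

lemma cring_coord_ring: "cring (coord_ring n r :: 'k::comm_ring_1 mpoly ring)"
proof (rule cringI)
  show "abelian_group (coord_ring n r :: 'k mpoly ring)"
  proof (rule abelian_groupI)
    fix x :: "'k mpoly" assume "x \<in> carrier (coord_ring n r)"
    then show "\<exists>y\<in>carrier (coord_ring n r). y \<oplus>\<^bsub>coord_ring n r\<^esub> x = \<zero>\<^bsub>coord_ring n r\<^esub>"
      by (intro bexI[of _ "- x"]) (auto simp: coord_ring_simps coords_uminus)
  qed (auto simp: coord_ring_simps coords_0 coords_add)
  show "Group.comm_monoid (coord_ring n r :: 'k mpoly ring)"
    by (rule comm_monoidI) (auto simp: coord_ring_simps coords_1 coords_mult)
qed (auto simp: coord_ring_simps distrib_right)

lemma prime_inD:
  assumes "prime_in R P"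
  shows "x \<in> P \<Longrightarrow> x \<in> R" "0 \<in> P" "x \<in> P \<Longrightarrow> y \<in> P \<Longrightarrow> x + y \<in> P"
    "a \<in> R \<Longrightarrow> x \<in> P \<Longrightarrow> a * x \<in> P" "1 \<notin> P"
    "a \<in> R \<Longrightarrow> b \<in> R \<Longrightarrow> a * b \<in> P \<Longrightarrow> a \<in> P \<or> b \<in> P"
  using assms unfolding prime_in_def by blast+

lemma primeideal_coord_ring:
  "primeideal P (coord_ring n r) \<longleftrightarrow> prime_in (coords n r) P"
proof
  assume "primeideal P (coord_ring n r)"
  then interpret primeideal P "coord_ring n r" .
  have "1 \<notin> P"
    using one_imp_carrier I_notcarr by (auto simp: coord_ring_simps)
  then show "prime_in (coords n r) P"
    using Icarr additive_subgroup.zero_closed[OF additive_subgroup_axioms]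
      additive_subgroup.a_closed[OF additive_subgroup_axioms] I_l_closed I_prime
    by (auto simp: prime_in_def coord_ring_simps)
next
  let ?R = "coord_ring n r :: 'a mpoly ring"
  assume P: "prime_in (coords n r) P"
  have neg: "- x \<in> P" if "x \<in> P" for x
  proof -
    have "- 1 * x \<in> P" using P that coords_uminus[OF coords_1] unfolding prime_in_def by blast
    then show ?thesis by simp
  qed
  show "primeideal P ?R"
  proof (rule primeidealI)
    show "ideal P ?R"
    proof (rule idealI)
      show "ring ?R" using cring_coord_ring cring.axioms(1) by blast
      show "subgroup P (add_monoid ?R)"
      proof (rule group.subgroupI)
        show "Group.group (add_monoid ?R)"
          using cring_coord_ring abelian_group.a_group cring.axioms(1) ring.is_abelian_group by blast
        fix x assume x: "x \<in> P"
        have "inv\<^bsub>add_monoid ?R\<^esub> x = - x"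
        proof (rule group.inv_equality[OF \<open>Group.group (add_monoid ?R)\<close>])
          show "- x \<otimes>\<^bsub>add_monoid ?R\<^esub> x = \<one>\<^bsub>add_monoid ?R\<^esub>"
            by (simp add: coord_ring_simps)
        qed (use P x neg in \<open>auto simp: coord_ring_simps prime_in_def\<close>)
        then show "inv\<^bsub>add_monoid ?R\<^esub> x \<in> P" using neg[OF x] by simp
      qed (use P in \<open>auto simp: prime_in_def coord_ring_simps\<close>)
    next
      fix a x :: "'a mpoly" assume "a \<in> P" "x \<in> carrier ?R"
      then have "x * a \<in> P" using prime_inD(4)[OF P] by (simp add: coord_ring_simps)
      then show "x \<otimes>\<^bsub>?R\<^esub> a \<in> P" "a \<otimes>\<^bsub>?R\<^esub> x \<in> P"
        by (simp_all add: coord_ring_simps mult.commute)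
    qed
    show "carrier ?R \<noteq> P"
      using P coords_1 by (auto simp: prime_in_def coord_ring_simps)
  qed (use P cring_coord_ring in \<open>auto simp: prime_in_def coord_ring_simps\<close>)
qed

lemma prime_in_power:
  assumes "prime_in (coords n r) P" "f \<in> coords n r" "f \<notin> P" "g \<in> coords n r" "f ^ e * g \<in> P"
  shows "g \<in> P"
  using assms(5)
proof (induction e)
  case (Suc e)
  then have "f * (f ^ e * g) \<in> P" by (simp add: mult.assoc)
  then show ?case
    using prime_inD(6)[OF assms(1,2)] assms(2,3,4) coords_mult coords_power Suc.IH by blast
qed simp

text \<open>A relation among \<open>f\<^sub>n, f\<^sub>n\<^sub>+\<^sub>1, \<dots>\<close> modulo \<open>P\<^sub>n\<close> is divided by the largest possible power of
  \<open>f\<^sub>n \<notin> P\<^sub>n\<close>; modulo \<open>P\<^sub>n\<^sub>+\<^sub>1 \<ni> f\<^sub>n\<close> it becomes a relation among \<open>f\<^sub>n\<^sub>+\<^sub>1, \<dots>\<close>.\<close>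
lemma prime_chain_independent:
  fixes P :: "nat \<Rightarrow> 'k::field mpoly set"
  assumes P: "\<And>i. i \<le> d \<Longrightarrow> prime_in (coords n r) (P i)"
    and chain: "\<And>i. i < d \<Longrightarrow> P i \<subseteq> P (Suc i)"
    and f: "\<And>i. i < d \<Longrightarrow> f i \<in> P (Suc i) - P i"
    and rel: "(\<Sum>m\<in>{..<d} \<rightarrow>\<^sub>E {..s}. Const (g m) * (\<Prod>i<d. f i ^ m i)) \<in> P 0"
  shows "\<forall>m\<in>{..<d} \<rightarrow>\<^sub>E {..s}. g m = 0"
proof -
  have fR: "f i \<in> coords n r" if "i < d" for i
    using f[OF that] prime_inD(1)[OF P[of "Suc i"]] that by auto
  \<comment> \<open>Downward induction on \<open>e\<close>. At \<open>e = d\<close> the box contains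
    a single function, and a relation is a constant in a proper ideal, hence zero.\<close>
  have "\<forall>g. (\<Sum>m\<in>{e..<d} \<rightarrow>\<^sub>E {..s}. Const (g m) * (\<Prod>i\<in>{e..<d}. f i ^ m i)) \<in> P e \<longrightarrow>
      (\<forall>m\<in>{e..<d} \<rightarrow>\<^sub>E {..s}. g m = 0)" if "e \<le> d" for e
    using that
  proof (induction rule: inc_induct)
    case base
    show ?case
    proof (intro allI impI ballI)
      fix g :: "(nat \<Rightarrow> nat) \<Rightarrow> 'k" and m
      assume *: "(\<Sum>m\<in>{d..<d} \<rightarrow>\<^sub>E {..s}. Const (g m) * (\<Prod>i\<in>{d..<d}. f i ^ m i)) \<in> P d"
        and m: "m \<in> {d..<d} \<rightarrow>\<^sub>E {..s}"
      then have "Const (g m) \<in> P d" by (simp add: PiE_empty_domain)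
      then have "Const (inverse (g m)) * Const (g m) \<in> P d"
        using prime_inD(4)[OF P[of d]] coords_Const by blast
      then show "g m = 0" using prime_inD(5)[OF P[of d]]
        by (cases "g m = 0") (auto simp: Const_def mult_single)
    qed
  next
    case (step e)
    let ?S = "{Suc e..<d}"
    note Pe = P[of e] and PSe = P[of "Suc e"]
    have ins: "{e..<d} = insert e ?S" using step.hyps by auto
    show ?case
    proof (intro allI impI)
      fix g :: "(nat \<Rightarrow> nat) \<Rightarrow> 'k"
      assume *: "(\<Sum>m\<in>{e..<d} \<rightarrow>\<^sub>E {..s}. Const (g m) * (\<Prod>i\<in>{e..<d}. f i ^ m i)) \<in> P e"
      \<comment> \<open>The relation is read as a polynomial in \<open>f e\<close>, with
        \<open>h j\<close> as coefficient of its \<open>j\<close>-th power.\<close>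
      define h where "h j = (\<Sum>m\<in>?S \<rightarrow>\<^sub>E {..s}. Const (g (m(e := j))) * (\<Prod>i\<in>?S. f i ^ m i))" for j
      have hR: "h j \<in> coords n r" for j
        unfolding h_def by (intro coords_sum coords_mult coords_Const coords_prod coords_power fR) auto
      have "(\<Sum>m\<in>{e..<d} \<rightarrow>\<^sub>E {..s}. Const (g m) * (\<Prod>i\<in>{e..<d}. f i ^ m i)) =
          (\<Sum>(j, m)\<in>{..s} \<times> (?S \<rightarrow>\<^sub>E {..s}). Const (g (m(e := j))) * (\<Prod>i\<in>{e..<d}. f i ^ (m(e := j)) i))"
        unfolding ins PiE_insert_eq
        by (subst sum.reindex[OF inj_combinator]) (auto simp: case_prod_beta)
      also have "\<dots> = (\<Sum>(j, m)\<in>{..s} \<times> (?S \<rightarrow>\<^sub>E {..s}). f e ^ j * (Const (g (m(e := j))) * (\<Prod>i\<in>?S. f i ^ m i)))"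
      proof (intro sum.cong refl, clarify)
        fix j m
        have "(\<Prod>i\<in>{e..<d}. f i ^ (m(e := j)) i) = f e ^ j * (\<Prod>i\<in>?S. f i ^ (m(e := j)) i)"
          unfolding ins by (subst prod.insert) auto
        also have "(\<Prod>i\<in>?S. f i ^ (m(e := j)) i) = (\<Prod>i\<in>?S. f i ^ m i)"
          by (intro prod.cong) auto
        finally show "Const (g (m(e := j))) * (\<Prod>i\<in>{e..<d}. f i ^ (m(e := j)) i) =
            f e ^ j * (Const (g (m(e := j))) * (\<Prod>i\<in>?S. f i ^ m i))" by (simp add: mult_ac)
      qed
      also have "\<dots> = (\<Sum>j\<le>s. f e ^ j * h j)"
        by (simp add: sum.cartesian_product[symmetric] h_def sum_distrib_left)
      finally have sum_e: "(\<Sum>j\<le>s. f e ^ j * h j) \<in> P e" using * by simp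
      have restR: "(\<Sum>i\<in>I. f e ^ a i * h i) \<in> coords n r" for I and a :: "nat \<Rightarrow> nat"
        by (intro coords_sum coords_mult coords_power hR fR) (use step.hyps in simp)
      have vanish: "\<forall>m\<in>?S \<rightarrow>\<^sub>E {..s}. g (m(e := j)) = 0" if "j \<le> s" for j
        using that
      proof (induction j rule: less_induct)
        case (less j)
        \<comment> \<open>Once the coefficients below \<open>j\<close> vanish, the relation is
          \<open>f e ^ j * ?q\<close>, and the power can be cancelled modulo \<open>P e\<close>.
          Modulo \<open>P (Suc e)\<close> only the constant term \<open>h j\<close> of
          \<open>?q\<close> remains, to which the outer induction applies.\<close>
        let ?q = "\<Sum>i\<in>{j..s}. f e ^ (i - j) * h i"
        have "h i = 0" if "i < j" for i
        proof -
          have "Const (g (m(e := i))) = 0" if "m \<in> ?S \<rightarrow>\<^sub>E {..s}" for m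
          proof -
            have "i \<le> s" using less.prems \<open>i < j\<close> by simp
            from bspec[OF less.IH[OF \<open>i < j\<close> this] that] show ?thesis
              by (simp only: Const_def single_zero)
          qed
          then show ?thesis unfolding h_def by (intro sum.neutral ballI) simp
        qed
        then have "(\<Sum>i\<le>s. f e ^ i * h i) = (\<Sum>i\<in>{j..s}. f e ^ i * h i)"
          by (intro sum.mono_neutral_right) auto
        also have "\<dots> = (\<Sum>i\<in>{j..s}. f e ^ j * (f e ^ (i - j) * h i))"
          by (intro sum.cong) (auto simp flip: mult.assoc power_add)
        also have "\<dots> = f e ^ j * ?q"
          by (simp add: sum_distrib_left)
        finally have "f e ^ j * ?q \<in> P e" using sum_e by simp
        with prime_in_power[OF Pe fR _ restR] have "?q \<in> P e"
          using step.hyps f[of e] by auto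
        then have 1: "?q \<in> P (Suc e)"
          using chain[of e] step.hyps by auto
        let ?t = "\<Sum>i\<in>{Suc j..s}. f e ^ (i - Suc j) * h i"
        have "{j..s} = insert j {Suc j..s}" using less.prems by auto
        then have "?q = h j + (\<Sum>i\<in>{Suc j..s}. f e ^ (i - j) * h i)"
          by simp
        also have "(\<Sum>i\<in>{Suc j..s}. f e ^ (i - j) * h i) = (\<Sum>i\<in>{Suc j..s}. f e * (f e ^ (i - Suc j) * h i))"
          by (intro sum.cong) (auto simp: Suc_diff_Suc mult.assoc simp flip: power_Suc)
        also have "\<dots> = ?t * f e" by (simp add: sum_distrib_left mult_ac)
        finally have "h j = ?q + (- ?t) * f e" by simp
        also have "\<dots> \<in> P (Suc e)"
          by (intro prime_inD(3)[OF PSe] 1 prime_inD(4)[OF PSe] coords_uminus restR)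
            (use step.hyps f[of e] in auto)
        finally have "h j \<in> P (Suc e)" .
        then show ?case unfolding h_def
          by (rule mp[OF spec[OF step.IH, of "\<lambda>m. g (m(e := j))"]])
      qed
      show "\<forall>m\<in>{e..<d} \<rightarrow>\<^sub>E {..s}. g m = 0"
        unfolding ins PiE_insert_eq using vanish by auto
    qed
  qed
  from this[of 0] rel show ?thesis by (simp add: lessThan_atLeast0)
qed

text \<open>Image and preimage under the projection relate the primes of the quotient to the primes
  containing \<open>I\<close>, and both preserve strict inclusions. The dimension can thus be
  computed with chains of ideals of \<open>R\<close> itself.\<close>

lemma krull_dim_quot:
  assumes "cring R" and I: "ideal I R"
  shows "krull_dim (R Quot I) = Sup {ereal (real d) | d. \<exists>P :: nat \<Rightarrow> 'a set.
      (\<forall>i\<le>d. primeideal (P i) R \<and> I \<subseteq> P i) \<and> (\<forall>i<d. P i \<subset> P (Suc i))}"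
proof -
  let ?q = "\<lambda>x. I +>\<^bsub>R\<^esub> x"
  have carr: "carrier (R Quot I) = ?q ` carrier R"
    unfolding FactRing_def A_RCOSETS_def' by auto
  have zero: "?q x = \<zero>\<^bsub>R Quot I\<^esub>" if "x \<in> I" for x
    using ring.a_rcos_zero[OF cring.axioms(1)[OF \<open>cring R\<close>] I that] unfolding FactRing_def by simp
  interpret R: cring R by fact
  interpret I: ideal I R by fact
  interpret q: ring_hom_ring R "R Quot I" ?q by (rule I.rcos_ring_hom_ring)
  have cq: "cring (R Quot I)" by (rule I.quotient_is_cring) (rule R.is_cring)
  have down: "primeideal {x \<in> carrier R. ?q x \<in> Q} R \<and> I \<subseteq> {x \<in> carrier R. ?q x \<in> Q}"
    if Q: "primeideal Q (R Quot I)" for Q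
  proof
    show "primeideal {x \<in> carrier R. ?q x \<in> Q} R"
      by (rule q.primeideal_vimage[OF R.is_cring Q])
    interpret Q: primeideal Q "R Quot I" by fact
    have "\<zero>\<^bsub>R Quot I\<^esub> \<in> Q" by (rule additive_subgroup.zero_closed[OF Q.additive_subgroup_axioms])
    then show "I \<subseteq> {x \<in> carrier R. ?q x \<in> Q}" using zero I.Icarr by auto
  qed
  \<comment> \<open>An ideal containing \<open>I\<close> is a union of cosets of \<open>I\<close>,
    so membership in its image can be tested on any representative.\<close>
  have mem: "?q x \<in> ?q ` P \<longleftrightarrow> x \<in> P" if P: "ideal P R" "I \<subseteq> P" and x: "x \<in> carrier R" for P x
  proof
    assume "?q x \<in> ?q ` P"
    then obtain y where y: "y \<in> P" "?q x = ?q y" by auto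
    interpret P: ideal P R by fact
    have yc: "y \<in> carrier R" using y by auto
    have "x \<ominus>\<^bsub>R\<^esub> y \<in> I"
      using R.quotient_eq_iff_same_a_r_cos[OF I x yc] y(2) by simp
    then have "x \<ominus>\<^bsub>R\<^esub> y \<oplus>\<^bsub>R\<^esub> y \<in> P" using P(2) y(1) by (intro P.a_closed) auto
    then show "x \<in> P" using x yc by (simp add: R.minus_eq R.a_assoc R.l_neg)
  qed auto
  have up: "primeideal (?q ` P) (R Quot I)" if P: "primeideal P R" "I \<subseteq> P" for P
  proof (rule primeidealI)
    interpret P: primeideal P R by fact
    show "ideal (?q ` P) (R Quot I)"
      by (rule R.ring_ideal_imp_quot_ideal[OF I P.is_ideal])
    show "carrier (R Quot I) \<noteq> ?q ` P"
    proof
      assume "carrier (R Quot I) = ?q ` P"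
      then have "?q x \<in> ?q ` P" if "x \<in> carrier R" for x using carr that by blast
      then have "carrier R \<subseteq> P" using mem[OF P.is_ideal P(2)] by blast
      then show False using P.I_notcarr P.Icarr by blast
    qed
    fix a b assume "a \<in> carrier (R Quot I)" "b \<in> carrier (R Quot I)" "a \<otimes>\<^bsub>R Quot I\<^esub> b \<in> ?q ` P"
    then obtain x y where xy: "x \<in> carrier R" "y \<in> carrier R" "a = ?q x" "b = ?q y" unfolding carr by auto
    then have "?q (x \<otimes>\<^bsub>R\<^esub> y) \<in> ?q ` P" using \<open>a \<otimes>\<^bsub>R Quot I\<^esub> b \<in> ?q ` P\<close> by simp
    then have "x \<otimes>\<^bsub>R\<^esub> y \<in> P"
      by (rule mem[OF P.is_ideal P(2), THEN iffD1, rotated]) (use xy in simp)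
    then have "x \<in> P \<or> y \<in> P" using P.I_prime xy by blast
    then show "a \<in> ?q ` P \<or> b \<in> ?q ` P" using xy by blast
  qed (rule cq)
  have "(\<exists>Q. (\<forall>i\<le>d. primeideal (Q i) (R Quot I)) \<and> (\<forall>i<d. Q i \<subset> Q (Suc i))) \<longleftrightarrow>
      (\<exists>P. (\<forall>i\<le>d. primeideal (P i) R \<and> I \<subseteq> P i) \<and> (\<forall>i<d. P i \<subset> P (Suc i)))" (is "?Q \<longleftrightarrow> ?P") for d :: nat
  proof
    assume ?Q
    then obtain Q where Q: "\<And>i. i \<le> d \<Longrightarrow> primeideal (Q i) (R Quot I)" "\<And>i. i < d \<Longrightarrow> Q i \<subset> Q (Suc i)"
      by blast
    have "{x \<in> carrier R. ?q x \<in> Q i} \<subset> {x \<in> carrier R. ?q x \<in> Q (Suc i)}" if i: "i < d" for i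
    proof -
      obtain z where z: "z \<in> Q (Suc i)" "z \<notin> Q i" using Q(2)[OF i] by blast
      interpret primeideal "Q (Suc i)" "R Quot I" by (rule Q) (use i in simp)
      obtain x where "x \<in> carrier R" "z = ?q x" using Icarr[OF z(1)] unfolding carr by auto
      then show ?thesis using z Q(2)[OF i] by blast
    qed
    then show ?P
      using down[OF Q(1)] by (intro exI[of _ "\<lambda>i. {x \<in> carrier R. ?q x \<in> Q i}"]) blast
  next
    assume ?P
    then obtain P where P: "\<And>i. i \<le> d \<Longrightarrow> primeideal (P i) R" "\<And>i. i \<le> d \<Longrightarrow> I \<subseteq> P i"
        "\<And>i. i < d \<Longrightarrow> P i \<subset> P (Suc i)" by blast
    have "?q ` P i \<subset> ?q ` P (Suc i)" if i: "i < d" for i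
    proof -
      obtain z where z: "z \<in> P (Suc i)" "z \<notin> P i" using P(3)[OF i] by blast
      interpret a: primeideal "P (Suc i)" R by (rule P) (use i in simp)
      interpret b: primeideal "P i" R by (rule P) (use i in simp)
      have "?q z \<notin> ?q ` P i"
        using mem[OF b.is_ideal P(2)[OF less_imp_le[OF i]] a.Icarr[OF z(1)]] z(2) by simp
      then show ?thesis using z(1) P(3)[OF i] by blast
    qed
    then show ?Q
      using up[OF P(1,2)] by (intro exI[of _ "\<lambda>i. ?q ` P i"] conjI allI impI)
  qed
  then show ?thesis unfolding krull_dim_def by simp
qed

section \<open>Typed fields as extension fields\<close>

text \<open>Turns a typed field into a ring record on a prescribed carrier type. In this way residue
  fields and fields of rational functions, which exist as types, become admissible extension fields
  in \<open>nongenerating_subscheme\<close>.\<close>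

definition transport :: "('l::field \<Rightarrow> 'c) \<Rightarrow> 'c ring" where
  "transport \<iota> = \<lparr> carrier = range \<iota>,
     monoid.mult = (\<lambda>x y. \<iota> (inv_into UNIV \<iota> x * inv_into UNIV \<iota> y)), monoid.one = \<iota> 1,
     ring.zero = \<iota> 0, ring.add = (\<lambda>x y. \<iota> (inv_into UNIV \<iota> x + inv_into UNIV \<iota> y)) \<rparr>"

definition matpair :: "('l \<Rightarrow> 'c) \<Rightarrow> 'l mat \<times> 'l mat \<Rightarrow> 'c mat \<times> 'c mat" where
  "matpair \<iota> p = (map_mat \<iota> (fst p), map_mat \<iota> (snd p))"

lemma matpair_simp: "matpair \<iota> (a, b) = (map_mat \<iota> a, map_mat \<iota> b)"
  by (simp add: matpair_def)

context
  fixes \<iota> :: "'l::field \<Rightarrow> 'c"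
  assumes inj: "inj \<iota>"
begin

lemma transport_simps:
  "carrier (transport \<iota>) = range \<iota>"
  "\<iota> x \<otimes>\<^bsub>transport \<iota>\<^esub> \<iota> y = \<iota> (x * y)" "\<iota> x \<oplus>\<^bsub>transport \<iota>\<^esub> \<iota> y = \<iota> (x + y)"
  "\<one>\<^bsub>transport \<iota>\<^esub> = \<iota> 1" "\<zero>\<^bsub>transport \<iota>\<^esub> = \<iota> 0"
  by (simp_all add: transport_def inv_f_f[OF inj])

lemma cring_transport: "cring (transport \<iota>)"
proof (rule cringI)
  show "abelian_group (transport \<iota>)"
  proof (rule abelian_groupI)
    fix x assume "x \<in> carrier (transport \<iota>)"
    then obtain a where "x = \<iota> a" by (auto simp: transport_simps)
    then show "\<exists>y\<in>carrier (transport \<iota>). y \<oplus>\<^bsub>transport \<iota>\<^esub> x = \<zero>\<^bsub>transport \<iota>\<^esub>"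
      by (intro bexI[of _ "\<iota> (- a)"]) (auto simp: transport_simps)
  qed (auto simp: transport_simps algebra_simps)
  show "Group.comm_monoid (transport \<iota>)"
    by (rule comm_monoidI) (auto simp: transport_simps algebra_simps)
qed (auto simp: transport_simps algebra_simps)

lemma field_transport: "field (transport \<iota>)"
proof (rule cring.cring_fieldI2[OF cring_transport])
  show "\<zero>\<^bsub>transport \<iota>\<^esub> \<noteq> \<one>\<^bsub>transport \<iota>\<^esub>"
    using inj by (auto simp: transport_simps dest: injD)
  fix a assume "a \<in> carrier (transport \<iota>)" "a \<noteq> \<zero>\<^bsub>transport \<iota>\<^esub>"
  then obtain x where "a = \<iota> x" "x \<noteq> 0" by (auto simp: transport_simps)
  then show "\<exists>b\<in>carrier (transport \<iota>). a \<otimes>\<^bsub>transport \<iota>\<^esub> b = \<one>\<^bsub>transport \<iota>\<^esub>"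
    by (intro bexI[of _ "\<iota> (inverse x)"]) (auto simp: transport_simps)
qed

interpretation T: field "transport \<iota>" by (rule field_transport)

lemma ring_hom_transport:
  assumes "comm_ring_hom \<kappa>"
  shows "(\<lambda>c. \<iota> (\<kappa> c)) \<in> Ring.ring_hom ring_of_type_algebra (transport \<iota>)"
proof -
  interpret comm_ring_hom \<kappa> by fact
  show ?thesis
    by (rule ring_hom_memI) (auto simp: transport_simps ring_of_type_algebra_def hom_add hom_mult)
qed

lemma transport_finsum:
  "(\<And>i. i \<in> I \<Longrightarrow> g i = \<iota> (f i)) \<Longrightarrow> (\<Oplus>\<^bsub>transport \<iota>\<^esub>i\<in>I. g i) = \<iota> (\<Sum>i\<in>I. f i)"
proof (induction I rule: infinite_finite_induct)
  case (insert i I)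
  then have "(\<Oplus>\<^bsub>transport \<iota>\<^esub>i\<in>insert i I. g i) = g i \<oplus>\<^bsub>transport \<iota>\<^esub> (\<Oplus>\<^bsub>transport \<iota>\<^esub>i\<in>I. g i)"
    by (intro T.finsum_insert) (auto simp: transport_simps)
  then show ?case using insert by (simp add: transport_simps)
qed (simp_all add: transport_simps T.finsum_infinite)

lemma transport_finprod:
  "(\<And>i. i \<in> I \<Longrightarrow> g i = \<iota> (f i)) \<Longrightarrow> (\<Otimes>\<^bsub>transport \<iota>\<^esub>i\<in>I. g i) = \<iota> (\<Prod>i\<in>I. f i)"
proof (induction I rule: infinite_finite_induct)
  case (insert i I)
  then have "(\<Otimes>\<^bsub>transport \<iota>\<^esub>i\<in>insert i I. g i) = g i \<otimes>\<^bsub>transport \<iota>\<^esub> (\<Otimes>\<^bsub>transport \<iota>\<^esub>i\<in>I. g i)"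
    by (intro T.finprod_insert) (auto simp: transport_simps)
  then show ?case using insert by (simp add: transport_simps)
qed (simp_all add: transport_simps T.finprod_infinite)

lemma transport_power: "\<iota> x [^]\<^bsub>transport \<iota>\<^esub> (e::nat) = \<iota> (x ^ e)"
  by (induction e) (simp_all add: transport_simps mult.commute)

text \<open>Agreement is required only at the variables occurring in \<open>f\<close>, because a
  tuple of matrices determines coordinates only on \<open>vars n r\<close>.\<close>

lemma mpoly_eval_transport:
  assumes "\<And>m v. m \<in> Poly_Mapping.keys f \<Longrightarrow> v \<in> Poly_Mapping.keys m \<Longrightarrow> y v = \<iota> (x v)"
  shows "mpoly_eval (transport \<iota>) (\<lambda>c. \<iota> (\<kappa> c)) y f = \<iota> (peval \<kappa> x f)"
  unfolding mpoly_eval_def peval_def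
proof (rule transport_finsum)
  fix m assume "m \<in> Poly_Mapping.keys f"
  then have "(\<Otimes>\<^bsub>transport \<iota>\<^esub>v\<in>Poly_Mapping.keys m. y v [^]\<^bsub>transport \<iota>\<^esub> Poly_Mapping.lookup m v) = \<iota> (meval x m)"
    unfolding meval_def by (intro transport_finprod) (simp add: assms transport_power)
  then show "\<iota> (\<kappa> (Poly_Mapping.lookup f m)) \<otimes>\<^bsub>transport \<iota>\<^esub>
      (\<Otimes>\<^bsub>transport \<iota>\<^esub>v\<in>Poly_Mapping.keys m. y v [^]\<^bsub>transport \<iota>\<^esub> Poly_Mapping.lookup m v) =
      \<iota> (\<kappa> (Poly_Mapping.lookup f m) * meval x m)"
    by (simp add: transport_simps)
qed

lemma inj_matpair: "inj (matpair \<iota>)"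
proof -
  have "inj (map_mat \<iota>)"
  proof (rule injI)
    fix x y assume eq: "map_mat \<iota> x = map_mat \<iota> y"
    from arg_cong[OF eq, of dim_row] arg_cong[OF eq, of dim_col]
    have d: "dim_row x = dim_row y" "dim_col x = dim_col y" by auto
    show "x = y"
    proof (rule eq_matI)
      fix i j assume "i < dim_row y" "j < dim_col y"
      then show "x $$ (i, j) = y $$ (i, j)"
        using arg_cong[OF eq, of "\<lambda>m. m $$ (i, j)"] d injD[OF inj] by auto
    qed (use d in auto)
  qed
  then show ?thesis by (auto simp: inj_def matpair_def prod_eq_iff)
qed

section \<open>The algebra with involution over a transported field\<close>

lemma carrier_matrix_ring: "carrier (matrix_ring (transport \<iota>) n) = map_mat \<iota> ` carrier_mat n n"
proof
  show "carrier (matrix_ring (transport \<iota>) n) \<subseteq> map_mat \<iota> ` carrier_mat n n"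
  proof
    fix M assume "M \<in> carrier (matrix_ring (transport \<iota>) n)"
    then have M: "M \<in> carrier_mat n n" "elements_mat M \<subseteq> range \<iota>"
      by (auto simp: matrix_ring_def transport_simps)
    have "M $$ (i, j) \<in> range \<iota>" if "i < n" "j < n" for i j
      using M(2) elements_matI[OF M(1) that refl] by blast
    then have "M = map_mat \<iota> (map_mat (inv_into UNIV \<iota>) M)"
      using M(1) by (intro eq_matI) (auto simp: f_inv_into_f)
    then show "M \<in> map_mat \<iota> ` carrier_mat n n" using M(1) by (intro image_eqI) auto
  qed
  show "map_mat \<iota> ` carrier_mat n n \<subseteq> carrier (matrix_ring (transport \<iota>) n)"
    by (auto simp: matrix_ring_def transport_simps elements_mat_def)
qed

lemma matrix_ring_ops:
  assumes "M \<in> carrier_mat n n" "N \<in> carrier_mat n n"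
  shows "map_mat \<iota> M \<otimes>\<^bsub>matrix_ring (transport \<iota>) n\<^esub> map_mat \<iota> N = map_mat \<iota> (M * N)"
    and "map_mat \<iota> M \<oplus>\<^bsub>matrix_ring (transport \<iota>) n\<^esub> map_mat \<iota> N = map_mat \<iota> (M + N)"
proof -
  show "map_mat \<iota> M \<otimes>\<^bsub>matrix_ring (transport \<iota>) n\<^esub> map_mat \<iota> N = map_mat \<iota> (M * N)"
  proof (rule eq_matI)
    fix i j assume "i < dim_row (map_mat \<iota> (M * N))" "j < dim_col (map_mat \<iota> (M * N))"
    then have ij: "i < n" "j < n" using assms by auto
    have "(\<Oplus>\<^bsub>transport \<iota>\<^esub>k\<in>{..<n}. map_mat \<iota> M $$ (i, k) \<otimes>\<^bsub>transport \<iota>\<^esub> map_mat \<iota> N $$ (k, j)) =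
        \<iota> (\<Sum>k<n. M $$ (i, k) * N $$ (k, j))"
      using assms ij by (intro transport_finsum) (auto simp: transport_simps)
    then show "(map_mat \<iota> M \<otimes>\<^bsub>matrix_ring (transport \<iota>) n\<^esub> map_mat \<iota> N) $$ (i, j) = map_mat \<iota> (M * N) $$ (i, j)"
      using assms ij mat_mult_entry[OF assms ij] by (simp add: matrix_ring_def)
  qed (use assms in \<open>auto simp: matrix_ring_def\<close>)
  show "map_mat \<iota> M \<oplus>\<^bsub>matrix_ring (transport \<iota>) n\<^esub> map_mat \<iota> N = map_mat \<iota> (M + N)"
    using assms by (intro eq_matI) (auto simp: matrix_ring_def transport_simps)
qed

lemma alg_ops:
  assumes "a \<in> carrier_mat n n" "b \<in> carrier_mat n n" "c \<in> carrier_mat n n" "d \<in> carrier_mat n n"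
  shows "matpair \<iota> (a, b) \<otimes>\<^bsub>alg (transport \<iota>) n\<^esub> matpair \<iota> (c, d) = matpair \<iota> (a * c, b * d)"
    and "matpair \<iota> (a, b) \<oplus>\<^bsub>alg (transport \<iota>) n\<^esub> matpair \<iota> (c, d) = matpair \<iota> (a + c, b + d)"
  using assms by (auto simp: matpair_simp alg_def RDirProd_def DirProd_def monoid.defs matrix_ring_ops)

lemma alg_consts:
  "\<one>\<^bsub>alg (transport \<iota>) n\<^esub> = matpair \<iota> (1\<^sub>m n, 1\<^sub>m n)"
  "\<zero>\<^bsub>alg (transport \<iota>) n\<^esub> = matpair \<iota> (0\<^sub>m n n, 0\<^sub>m n n)"
  by (auto simp: matpair_simp alg_def RDirProd_def DirProd_def monoid.defs matrix_ring_def transport_simps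
      intro!: eq_matI)

lemma carrier_alg: "carrier (alg (transport \<iota>) n) = matpair \<iota> ` mat_pairs n"
  unfolding alg_def RDirProd_carrier carrier_matrix_ring
proof (intro equalityI subsetI)
  fix p assume "p \<in> map_mat \<iota> ` carrier_mat n n \<times> map_mat \<iota> ` carrier_mat n n"
  then obtain a b where "a \<in> carrier_mat n n" "b \<in> carrier_mat n n" "p = matpair \<iota> (a, b)"
    unfolding matpair_simp by blast
  then show "p \<in> matpair \<iota> ` mat_pairs n" by blast
qed (auto simp: matpair_def)

lemma scalars_transport: "scalars (transport \<iota>) n = (\<lambda>c. matpair \<iota> (c \<cdot>\<^sub>m 1\<^sub>m n, c \<cdot>\<^sub>m 1\<^sub>m n)) ` UNIV"
proof -
  have "mat n n (\<lambda>(i, j). if i = j then \<iota> c else \<zero>\<^bsub>transport \<iota>\<^esub>) = map_mat \<iota> (c \<cdot>\<^sub>m 1\<^sub>m n)" for c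
    by (intro eq_matI) (auto simp: transport_simps)
  then show ?thesis by (simp add: scalars_def transport_simps image_image Let_def matpair_simp)
qed

lemma invol_matpair: "invol (matpair \<iota> (a, b)) = matpair \<iota> (transpose_mat b, transpose_mat a)"
  by (auto simp: invol_def matpair_simp)

lemma smult_as_mult:
  assumes "a \<in> carrier_mat n n"
  shows "(c \<cdot>\<^sub>m 1\<^sub>m n) * a = c \<cdot>\<^sub>m (a :: 'l mat)"
  using mult_smult_assoc_mat[OF one_carrier_mat assms, of c] assms by simp

lemma invol_subalgebra_image:
  assumes B: "invol_matrix_algebra n B"
  shows "invol_subalgebra (transport \<iota>) n (matpair \<iota> ` B)"
proof -
  note D = invol_matrix_algebraD[OF B]
  let ?A = "alg (transport \<iota>) n"
  let ?B = "matpair \<iota> ` B"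
  have sub: "?B \<subseteq> carrier ?A" using D(1,2) by (auto simp: carrier_alg)
  have mult: "x \<otimes>\<^bsub>?A\<^esub> y \<in> ?B" and add: "x \<oplus>\<^bsub>?A\<^esub> y \<in> ?B"
    if xy: "x \<in> ?B" "y \<in> ?B" for x y
  proof -
    obtain p q where "p \<in> B" "x = matpair \<iota> p" "q \<in> B" "y = matpair \<iota> q"
      using xy by blast
    then obtain a b c d where x: "x = matpair \<iota> (a, b)" and y: "y = matpair \<iota> (c, d)"
        and ab: "(a, b) \<in> B" and cd: "(c, d) \<in> B"
      by (cases p, cases q) blast
    note ops = alg_ops[OF D(1)[OF ab] D(2)[OF ab] D(1)[OF cd] D(2)[OF cd]]
    show "x \<otimes>\<^bsub>?A\<^esub> y \<in> ?B" unfolding x y ops(1) by (rule imageI[OF D(5)[OF ab cd]])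
    show "x \<oplus>\<^bsub>?A\<^esub> y \<in> ?B" unfolding x y ops(2) by (rule imageI[OF D(4)[OF ab cd]])
  qed
  have one: "\<one>\<^bsub>?A\<^esub> \<in> ?B" unfolding alg_consts by (rule imageI[OF D(3)])
  have smult: "matpair \<iota> (c \<cdot>\<^sub>m a, c \<cdot>\<^sub>m b) \<in> ?B" if "(a, b) \<in> B" for a b c
    by (rule imageI[OF D(6)[OF that]])
  have zero: "\<zero>\<^bsub>?A\<^esub> \<in> ?B"
  proof -
    have "0 \<cdot>\<^sub>m 1\<^sub>m n = (0\<^sub>m n n :: 'l mat)" by (intro eq_matI) auto
    then show ?thesis using smult[OF D(3), of 0] by (simp only: alg_consts(2))
  qed
  have inv: "inv\<^bsub>add_monoid ?A\<^esub> x \<in> ?B" if x: "x \<in> ?B" for x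
  proof -
    obtain p where "p \<in> B" "x = matpair \<iota> p" using x by blast
    then obtain a b where ab: "x = matpair \<iota> (a, b)" "(a, b) \<in> B" by (cases p) blast
    note c = D(1)[OF ab(2)] D(2)[OF ab(2)]
    \<comment> \<open>The inverse in the additive monoid is a definite description, so
      \<open>?y\<close> has to be shown to be an inverse and the only one in the carrier.\<close>
    let ?y = "matpair \<iota> (- 1 \<cdot>\<^sub>m a, - 1 \<cdot>\<^sub>m b)"
    have minus: "d = - 1 \<cdot>\<^sub>m e" if "d \<in> carrier_mat n n" "e \<in> carrier_mat n n" "e + d = 0\<^sub>m n n" for d e :: "'l mat"
    proof (rule eq_matI)
      fix i j assume "i < dim_row (- 1 \<cdot>\<^sub>m e)" "j < dim_col (- 1 \<cdot>\<^sub>m e)"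
      then have ij: "i < n" "j < n" using that(2) by auto
      have "(e + d) $$ (i, j) = 0" using that(3) ij by simp
      then have "e $$ (i, j) + d $$ (i, j) = 0" using that(1) ij by simp
      then show "d $$ (i, j) = (- 1 \<cdot>\<^sub>m e) $$ (i, j)"
        using that(2) ij by (simp add: eq_neg_iff_add_eq_0 add.commute)
    qed (use that in auto)
    have neg: "e + - 1 \<cdot>\<^sub>m e = 0\<^sub>m n n" "- 1 \<cdot>\<^sub>m e + e = 0\<^sub>m n n" if "e \<in> carrier_mat n n" for e :: "'l mat"
      using that by (auto intro!: eq_matI)
    have "inv\<^bsub>add_monoid ?A\<^esub> x = ?y"
      unfolding m_inv_def
    proof (rule the_equality)
      have yc: "?y \<in> carrier ?A" using c unfolding carrier_alg by (intro imageI) auto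
      show "?y \<in> carrier (add_monoid ?A) \<and> x \<otimes>\<^bsub>add_monoid ?A\<^esub> ?y = \<one>\<^bsub>add_monoid ?A\<^esub> \<and>
          ?y \<otimes>\<^bsub>add_monoid ?A\<^esub> x = \<one>\<^bsub>add_monoid ?A\<^esub>"
        using yc alg_ops(2)[of a n b "- 1 \<cdot>\<^sub>m a" "- 1 \<cdot>\<^sub>m b"] alg_ops(2)[of "- 1 \<cdot>\<^sub>m a" n "- 1 \<cdot>\<^sub>m b" a b] c neg
        unfolding ab(1) by (simp add: alg_consts(2))
    next
      fix y assume y: "y \<in> carrier (add_monoid ?A) \<and> x \<otimes>\<^bsub>add_monoid ?A\<^esub> y = \<one>\<^bsub>add_monoid ?A\<^esub> \<and>
          y \<otimes>\<^bsub>add_monoid ?A\<^esub> x = \<one>\<^bsub>add_monoid ?A\<^esub>"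
      then obtain d e where de: "y = matpair \<iota> (d, e)" "d \<in> carrier_mat n n" "e \<in> carrier_mat n n"
        by (auto simp: carrier_alg)
      have "matpair \<iota> (a + d, b + e) = matpair \<iota> (0\<^sub>m n n, 0\<^sub>m n n)"
        using y alg_ops(2)[OF c de(2,3)] unfolding de(1) ab(1) by (simp add: alg_consts(2))
      then have "a + d = 0\<^sub>m n n" "b + e = 0\<^sub>m n n" using injD[OF inj_matpair] by blast+
      then show "y = ?y" using minus de c by simp
    qed
    then show ?thesis using smult[OF ab(2)] by simp
  qed
  have grp: "subgroup ?B (add_monoid ?A)"
    using sub add zero inv by (intro subgroup.intro) auto
  have mon: "submonoid ?B ?A"
    using sub mult one by (intro submonoid.intro) auto
  have sm: "k \<otimes>\<^bsub>?A\<^esub> v \<in> ?B" if k: "k \<in> scalars (transport \<iota>) n" and v: "v \<in> ?B" for k v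
  proof -
    obtain c where "k = matpair \<iota> (c \<cdot>\<^sub>m 1\<^sub>m n, c \<cdot>\<^sub>m 1\<^sub>m n)" using k by (auto simp: scalars_transport)
    moreover have "\<dots> \<in> ?B" by (rule smult[OF D(3)])
    ultimately show ?thesis using mult v by blast
  qed
  have "invol ` ?B \<subseteq> ?B"
    using D(7) invol_matpair by auto
  then show ?thesis unfolding invol_subalgebra_def
    by (intro conjI subring.intro subalgebra.intro subalgebra_axioms.intro grp mon sm)
qed

lemma invol_subalgebra_preimage:
  assumes B: "invol_subalgebra (transport \<iota>) n B"
  shows "invol_matrix_algebra n {(a, b). a \<in> carrier_mat n n \<and> b \<in> carrier_mat n n \<and> matpair \<iota> (a, b) \<in> B}"
proof -
  let ?A = "alg (transport \<iota>) n"
  let ?P = "{(a, b). a \<in> carrier_mat n n \<and> b \<in> carrier_mat n n \<and> matpair \<iota> (a, b) \<in> B}"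
  interpret S: subring B ?A using B by (simp add: invol_subalgebra_def)
  interpret L: subalgebra "scalars (transport \<iota>) n" B ?A using B by (simp add: invol_subalgebra_def)
  have add: "x \<oplus>\<^bsub>?A\<^esub> y \<in> B" if "x \<in> B" "y \<in> B" for x y
    using S.subgroup_axioms that subgroup.m_closed by fastforce
  have mult: "x \<otimes>\<^bsub>?A\<^esub> y \<in> B" if "x \<in> B" "y \<in> B" for x y
    using S.submonoid_axioms that submonoid.m_closed by fastforce
  have one: "\<one>\<^bsub>?A\<^esub> \<in> B"
    using S.submonoid_axioms submonoid.one_closed by fastforce
  have inv: "invol x \<in> B" if "x \<in> B" for x using B that by (auto simp: invol_subalgebra_def)
  have sm: "matpair \<iota> (c \<cdot>\<^sub>m 1\<^sub>m n, c \<cdot>\<^sub>m 1\<^sub>m n) \<otimes>\<^bsub>?A\<^esub> x \<in> B" if "x \<in> B" for c x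
    using L.smult_closed[OF _ that] by (auto simp: scalars_transport )
  show ?thesis
    unfolding invol_matrix_algebra_def
  proof (intro conjI allI impI)
    show "?P \<subseteq> mat_pairs n"
      by auto
    show "(1\<^sub>m n, 1\<^sub>m n) \<in> ?P"
      using one unfolding alg_consts by simp
  next
    fix a b c d
    assume "(a, b) \<in> ?P"
      "(c, d) \<in> ?P"
    then have *: "a \<in> carrier_mat n n" "b \<in> carrier_mat n n" "c \<in> carrier_mat n n" "d \<in> carrier_mat n n"
        "matpair \<iota> (a, b) \<in> B" "matpair \<iota> (c, d) \<in> B" by auto
    show "(a + c, b + d) \<in> ?P"
      using add[OF *(5,6)] * unfolding alg_ops(2)[OF *(1-4)] by simp
    show "(a * c, b * d) \<in> ?P"
      using mult[OF *(5,6)] * unfolding alg_ops(1)[OF *(1-4)] by simp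
  next
    fix k :: 'l and a b
    assume "(a, b) \<in> ?P"
    then have *: "a \<in> carrier_mat n n" "b \<in> carrier_mat n n" "matpair \<iota> (a, b) \<in> B" by auto
    have kc: "k \<cdot>\<^sub>m 1\<^sub>m n \<in> carrier_mat n n" by simp
    show "(k \<cdot>\<^sub>m a, k \<cdot>\<^sub>m b) \<in> ?P"
      using sm[OF *(3), of k] * unfolding alg_ops(1)[OF kc kc *(1,2)] smult_as_mult[OF *(1)] smult_as_mult[OF *(2)]
      by simp
  next
    fix a b
    assume "(a, b) \<in> ?P"
    then have *: "a \<in> carrier_mat n n" "b \<in> carrier_mat n n" "matpair \<iota> (a, b) \<in> B" by auto
    show "(transpose_mat b, transpose_mat a) \<in> ?P"
      using inv[OF *(3)] * unfolding invol_matpair by simp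
  qed
qed

text \<open>An intersection of subalgebras falls short of the whole algebra exactly when one of them
  is proper. Images and preimages under the injection \<open>matpair \<iota>\<close> preserve
  properness, which moves the question to matrices over the typed field.\<close>

lemma not_generates_transport_iff:
  "\<not> generates (transport \<iota>) n S \<longleftrightarrow>
     (\<exists>B. invol_matrix_algebra n B \<and> B \<noteq> mat_pairs n \<and> S \<subseteq> matpair \<iota> ` B)"
  if S: "S \<subseteq> carrier (alg (transport \<iota>) n)"
proof
  let ?A = "alg (transport \<iota>) n" and ?full = "mat_pairs n :: ('l mat \<times> 'l mat) set"
  assume "\<not> generates (transport \<iota>) n S"
  then have ne: "\<Inter>{B. invol_subalgebra (transport \<iota>) n B \<and> S \<subseteq> B} \<noteq> carrier ?A"
    by (simp add: generates_def)
  have "invol_matrix_algebra n ?full" by (auto simp: invol_matrix_algebra_def)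
  then have full: "invol_subalgebra (transport \<iota>) n (carrier ?A)"
    unfolding carrier_alg by (rule invol_subalgebra_image)
  obtain B where B: "invol_subalgebra (transport \<iota>) n B" "S \<subseteq> B" "\<not> carrier ?A \<subseteq> B"
    using ne full S by blast
  have sub: "B \<subseteq> carrier ?A"
    using B(1) unfolding invol_subalgebra_def subring_def submonoid_def by blast
  let ?B = "{(a, b). a \<in> carrier_mat n n \<and> b \<in> carrier_mat n n \<and> matpair \<iota> (a, b) \<in> B}"
  have "matpair \<iota> ` ?B = B"
  proof (intro equalityI subsetI)
    fix x assume x: "x \<in> B"
    then obtain p where p: "p \<in> ?full" "x = matpair \<iota> p" using sub unfolding carrier_alg by blast
    then have "p \<in> ?B" using x by auto
    then show "x \<in> matpair \<iota> ` ?B" using p(2) by blast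
  qed auto
  then have "S \<subseteq> matpair \<iota> ` ?B" using B(2) by simp
  moreover have "?B \<noteq> ?full"
  proof
    assume "?B = ?full"
    with \<open>matpair \<iota> ` ?B = B\<close> have "B = carrier ?A" by (simp only: carrier_alg)
    then show False using B(3) by simp
  qed
  ultimately show "\<exists>B. invol_matrix_algebra n B \<and> B \<noteq> ?full \<and> S \<subseteq> matpair \<iota> ` B"
    by (intro exI[of _ ?B] conjI invol_subalgebra_preimage[OF B(1)])
next
  let ?A = "alg (transport \<iota>) n" and ?full = "mat_pairs n :: ('l mat \<times> 'l mat) set"
  assume "\<exists>B. invol_matrix_algebra n B \<and> B \<noteq> ?full \<and> S \<subseteq> matpair \<iota> ` B"
  then obtain B where B: "invol_matrix_algebra n B" "B \<noteq> ?full" "S \<subseteq> matpair \<iota> ` B" by blast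
  have "matpair \<iota> ` B \<noteq> carrier ?A"
    unfolding carrier_alg inj_image_eq_iff[OF inj_matpair] by (rule B(2))
  moreover have "matpair \<iota> ` B \<subseteq> carrier ?A"
    using B(1) unfolding carrier_alg invol_matrix_algebra_def by blast
  ultimately show "\<not> generates (transport \<iota>) n S"
    unfolding generates_def using invol_subalgebra_image[OF B(1)] B(3) by blast
qed

end

section \<open>Extension of scalars and parameter counts\<close>

text \<open>The span of the image of \<open>B\<close> over the larger ring. Scalars are built in
  only at the generators; closure under scalars, products and the involution then follows by
  induction.\<close>

inductive_set scalar_ext :: "('l::comm_ring_1 \<Rightarrow> 'f::comm_ring_1) \<Rightarrow> ('l mat \<times> 'l mat) set \<Rightarrow> ('f mat \<times> 'f mat) set"
  for h B where
  base: "(a, b) \<in> B \<Longrightarrow> (k \<cdot>\<^sub>m map_mat h a, k \<cdot>\<^sub>m map_mat h b) \<in> scalar_ext h B"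
| add: "(a, b) \<in> scalar_ext h B \<Longrightarrow> (c, d) \<in> scalar_ext h B \<Longrightarrow> (a + c, b + d) \<in> scalar_ext h B"

definition pair_entry :: "'f mat \<times> 'f mat \<Rightarrow> bool \<times> nat \<times> nat \<Rightarrow> 'f" where
  "pair_entry p = (\<lambda>(s, i, j). (if s then snd p else fst p) $$ (i, j))"

text \<open>A proper subspace satisfies a linear equation with one coefficient equal to 1. Its image
  under \<open>h\<close> still annihilates the scalar extension and is still nontrivial, so the
  extension is proper. This takes a nongenerating tuple from the residue field to its algebraic
  closure.\<close>

lemma invol_matrix_algebra_scalar_ext:
  fixes B :: "('l::field mat \<times> 'l mat) set" and h :: "'l \<Rightarrow> 'f::field"
  assumes h: "comm_ring_hom h" and B: "invol_matrix_algebra n B"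
    and proper: "B \<noteq> mat_pairs n"
  shows "invol_matrix_algebra n (scalar_ext h B)"
    and "scalar_ext h B \<noteq> mat_pairs n"
    and "(a, b) \<in> B \<Longrightarrow> (map_mat h a, map_mat h b) \<in> scalar_ext h B"
proof -
  interpret h: comm_ring_hom h by fact
  note D = invol_matrix_algebraD[OF B]
  let ?C = "scalar_ext h B"
  have smult1: "1 \<cdot>\<^sub>m x = x" for x :: "'f mat" by (intro eq_matI) auto
  have smult2: "k \<cdot>\<^sub>m (l \<cdot>\<^sub>m x) = (k * l) \<cdot>\<^sub>m x" for k l and x :: "'f mat"
    by (intro eq_matI) (auto simp: mult.assoc)
  have inc: "(map_mat h a, map_mat h b) \<in> ?C" if "(a, b) \<in> B" for a b
    using scalar_ext.base[OF that, of 1 h] by (simp add: smult1)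
  then show "(a, b) \<in> B \<Longrightarrow> (map_mat h a, map_mat h b) \<in> ?C" .
  have carr: "a \<in> carrier_mat n n \<and> b \<in> carrier_mat n n" if "(a, b) \<in> ?C" for a b
    using that
  proof (induction rule: scalar_ext.induct)
    case (base a b k)
    then show ?case using D(1,2) by auto
  qed auto
  note carr1 = carr[THEN conjunct1] and carr2 = carr[THEN conjunct2]
  have smult: "(k \<cdot>\<^sub>m a, k \<cdot>\<^sub>m b) \<in> ?C" if "(a, b) \<in> ?C" for k a b
    using that
  proof (induction rule: scalar_ext.induct)
    case (base a b l)
    then show ?case by (simp add: smult2 scalar_ext.base)
  next
    case (add a b c d)
    have "k \<cdot>\<^sub>m (a + c) = k \<cdot>\<^sub>m a + k \<cdot>\<^sub>m c" "k \<cdot>\<^sub>m (b + d) = k \<cdot>\<^sub>m b + k \<cdot>\<^sub>m d"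
      using carr[OF add.hyps(1)] carr[OF add.hyps(2)] by (auto simp: add_smult_distrib_left_mat[of _ n n])
    then show ?case using scalar_ext.add[OF add.IH] by simp
  qed
  have trans: "(transpose_mat b, transpose_mat a) \<in> ?C" if "(a, b) \<in> ?C" for a b
    using that
  proof (induction rule: scalar_ext.induct)
    case (base a b l)
    have "transpose_mat (l \<cdot>\<^sub>m map_mat h x) = l \<cdot>\<^sub>m map_mat h (transpose_mat x)" for x
      by (intro eq_matI) auto
    then show ?case using scalar_ext.base[OF D(7)[OF base]] by simp
  next
    case (add a b c d)
    have "transpose_mat (a + c) = transpose_mat a + transpose_mat c"
      "transpose_mat (b + d) = transpose_mat b + transpose_mat d"
      using carr[OF add.hyps(1)] carr[OF add.hyps(2)] by (auto simp: transpose_add[of _ n n])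
    then show ?case using scalar_ext.add[OF add.IH] by simp
  qed
  have mult_base: "((k \<cdot>\<^sub>m map_mat h a) * c, (k \<cdot>\<^sub>m map_mat h b) * d) \<in> ?C"
    if ab: "(a, b) \<in> B" and "(c, d) \<in> ?C" for k a b c d
    using that(2)
  proof (induction rule: scalar_ext.induct)
    case (base c d l)
    have *: "(k \<cdot>\<^sub>m map_mat h x) * (l \<cdot>\<^sub>m map_mat h y) = (k * l) \<cdot>\<^sub>m map_mat h (x * y)"
      if "x \<in> carrier_mat n n" "y \<in> carrier_mat n n" for x y
    proof -
      have c: "map_mat h x \<in> carrier_mat n n" "map_mat h y \<in> carrier_mat n n" using that by auto
      have "(k \<cdot>\<^sub>m map_mat h x) * (l \<cdot>\<^sub>m map_mat h y) = k \<cdot>\<^sub>m (map_mat h x * (l \<cdot>\<^sub>m map_mat h y))"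
        using c by (intro mult_smult_assoc_mat[of _ n n _ n]) auto
      also have "\<dots> = k \<cdot>\<^sub>m (l \<cdot>\<^sub>m (map_mat h x * map_mat h y))"
        using c by (simp add: mult_smult_distrib[of _ n n _ n])
      finally show ?thesis by (simp add: smult2 h.mat_hom_mult[OF that])
    qed
    show ?case
      unfolding *[OF D(1)[OF ab] D(1)[OF base]] *[OF D(2)[OF ab] D(2)[OF base]]
      by (rule scalar_ext.base[OF D(5)[OF ab base]])
  next
    case (add c d e f)
    have x: "k \<cdot>\<^sub>m map_mat h a \<in> carrier_mat n n" "k \<cdot>\<^sub>m map_mat h b \<in> carrier_mat n n"
      using D(1,2)[OF ab] by auto
    note c = carr1[OF add.hyps(1)] carr2[OF add.hyps(1)] carr1[OF add.hyps(2)] carr2[OF add.hyps(2)]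
    show ?case
      unfolding mult_add_distrib_mat[OF x(1) c(1,3)] mult_add_distrib_mat[OF x(2) c(2,4)]
      by (rule scalar_ext.add[OF add.IH])
  qed
  have mult: "(a * c, b * d) \<in> ?C" if "(a, b) \<in> ?C" and cd: "(c, d) \<in> ?C" for a b c d
    using that(1)
  proof (induction rule: scalar_ext.induct)
    case (base a b k)
    then show ?case using cd by (rule mult_base)
  next
    case (add a b e f)
    note c = carr1[OF add.hyps(1)] carr2[OF add.hyps(1)] carr1[OF add.hyps(2)] carr2[OF add.hyps(2)]
      carr1[OF cd] carr2[OF cd]
    show ?case
      unfolding add_mult_distrib_mat[OF c(1,3,5)] add_mult_distrib_mat[OF c(2,4,6)]
      by (rule scalar_ext.add[OF add.IH])
  qed
  have one: "(1\<^sub>m n, 1\<^sub>m n) \<in> ?C"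
    using inc[OF D(3)] by (simp add: h.mat_hom_one)
  show "invol_matrix_algebra n ?C"
    unfolding invol_matrix_algebra_def
    using carr one scalar_ext.add mult smult trans by (intro conjI allI impI) auto
  let ?I = "(UNIV :: bool set) \<times> {..<n} \<times> {..<n}"
  define W where "W = {v. \<exists>p\<in>B. \<forall>x\<in>?I. v x = pair_entry p x}"
  have W: "subspace_on ?I W"
    unfolding subspace_on_def
  proof (intro conjI ballI allI impI)
    have "(0 \<cdot>\<^sub>m 1\<^sub>m n, 0 \<cdot>\<^sub>m 1\<^sub>m n) \<in> B" by (intro D(6) D(3))
    then show "(\<lambda>_. 0) \<in> W" unfolding W_def
      by (intro CollectI bexI[of _ "(0 \<cdot>\<^sub>m 1\<^sub>m n, 0 \<cdot>\<^sub>m 1\<^sub>m n)"]) (auto simp: pair_entry_def)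
  next
    fix v w assume "v \<in> W" "w \<in> W"
    then obtain p q where pq: "p \<in> B" "\<And>x. x \<in> ?I \<Longrightarrow> v x = pair_entry p x"
        "q \<in> B" "\<And>x. x \<in> ?I \<Longrightarrow> w x = pair_entry q x"
      unfolding W_def by blast
    obtain a b c d where [simp]: "p = (a, b)" "q = (c, d)" by fastforce
    have "(a + c, b + d) \<in> B" using D(4) pq by simp
    moreover have "\<forall>x\<in>?I. v x + w x = pair_entry (a + c, b + d) x"
      using D(1,2)[of a b] D(1,2)[of c d] pq by (auto simp: pair_entry_def)
    ultimately show "(\<lambda>x. v x + w x) \<in> W" unfolding W_def by blast
  next
    fix k v assume "v \<in> W"
    then obtain p where p: "p \<in> B" "\<And>x. x \<in> ?I \<Longrightarrow> v x = pair_entry p x"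
      unfolding W_def by blast
    obtain a b where [simp]: "p = (a, b)" by fastforce
    have "(k \<cdot>\<^sub>m a, k \<cdot>\<^sub>m b) \<in> B" using D(6) p by simp
    moreover have "\<forall>x\<in>?I. k * v x = pair_entry (k \<cdot>\<^sub>m a, k \<cdot>\<^sub>m b) x"
      using D(1,2)[of a b] p by (auto simp: pair_entry_def)
    ultimately show "(\<lambda>x. k * v x) \<in> W" unfolding W_def by blast
  next
    fix v w assume "v \<in> W" "\<forall>i\<in>?I. w i = v i"
    then show "w \<in> W" unfolding W_def by auto
  qed
  have "W \<noteq> UNIV"
  proof
    assume "W = UNIV"
    have all: "(a, b) \<in> B" if "a \<in> carrier_mat n n" "b \<in> carrier_mat n n" for a b
    proof -
      have "pair_entry (a, b) \<in> W" using \<open>W = UNIV\<close> by simp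
      then obtain p where p: "p \<in> B" "\<And>x. x \<in> ?I \<Longrightarrow> pair_entry (a, b) x = pair_entry p x"
        unfolding W_def by blast
      obtain c d where cd: "p = (c, d)" by fastforce
      have ent: "a $$ (i, j) = c $$ (i, j)" "b $$ (i, j) = d $$ (i, j)" if "i < n" "j < n" for i j
        using p(2)[of "(False, i, j)"] p(2)[of "(True, i, j)"] that unfolding cd
        by (auto simp: pair_entry_def)
      have "c \<in> carrier_mat n n" "d \<in> carrier_mat n n" using D(1,2) p(1) unfolding cd by blast+
      then have "a = c" "b = d" using that ent by (auto intro!: eq_matI)
      then show ?thesis using p(1) cd by simp
    qed
    have "B \<subseteq> mat_pairs n" using B by (simp add: invol_matrix_algebra_def)
    moreover have "mat_pairs n \<subseteq> B" using all by blast
    ultimately show False using proper by blast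
  qed
  then obtain y i0 where y: "i0 \<in> ?I" "y i0 = 1" "\<And>v. v \<in> W \<Longrightarrow> (\<Sum>x\<in>?I. y x * v x) = 0"
    by (rule proper_subspace_annihilator[OF _ W, rotated]) auto
  have ann: "(\<Sum>x\<in>?I. h (y x) * pair_entry (a, b) x) = 0" if "(a, b) \<in> ?C" for a b
    using that
  proof (induction rule: scalar_ext.induct)
    case (base a b k)
    have "(\<Sum>x\<in>?I. h (y x) * pair_entry (k \<cdot>\<^sub>m map_mat h a, k \<cdot>\<^sub>m map_mat h b) x) =
        (\<Sum>x\<in>?I. k * h (y x * pair_entry (a, b) x))"
    proof (intro sum.cong refl)
      fix x assume "x \<in> ?I"
      then have "pair_entry (k \<cdot>\<^sub>m map_mat h a, k \<cdot>\<^sub>m map_mat h b) x = k * h (pair_entry (a, b) x)"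
        using D(1,2)[OF base] by (auto simp: pair_entry_def)
      then show "h (y x) * pair_entry (k \<cdot>\<^sub>m map_mat h a, k \<cdot>\<^sub>m map_mat h b) x =
          k * h (y x * pair_entry (a, b) x)"
        by (simp only: h.hom_mult mult_ac)
    qed
    also have "\<dots> = k * h (\<Sum>x\<in>?I. y x * pair_entry (a, b) x)"
      by (simp add: sum_distrib_left h.hom_sum)
    also have "pair_entry (a, b) \<in> W" using base by (auto simp: W_def)
    then have "(\<Sum>x\<in>?I. y x * pair_entry (a, b) x) = 0" by (rule y(3))
    finally show ?case by simp
  next
    case (add a b c d)
    have "(\<Sum>x\<in>?I. h (y x) * pair_entry (a + c, b + d) x) =
        (\<Sum>x\<in>?I. h (y x) * pair_entry (a, b) x + h (y x) * pair_entry (c, d) x)"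
      using carr[OF add.hyps(1)] carr[OF add.hyps(2)]
      by (intro sum.cong) (auto simp: pair_entry_def distrib_left)
    then show ?case using add.IH by (simp add: sum.distrib)
  qed
  show "?C \<noteq> mat_pairs n"
  proof
    assume full: "?C = mat_pairs n"
    \<comment> \<open>The pair whose only nonzero entry is a 1 at \<open>i0\<close>; the extended
      linear form takes the value 1 on it.\<close>
    define e where "e s = mat n n (\<lambda>(i, j). if (s, i, j) = i0 then 1 else 0 :: 'f)" for s
    have "(e False, e True) \<in> ?C" unfolding full by (auto simp: e_def)
    from ann[OF this] have "(\<Sum>x\<in>?I. h (y x) * pair_entry (e False, e True) x) = 0" .
    moreover have "pair_entry (e False, e True) x = (if x = i0 then 1 else 0)" if "x \<in> ?I" for x
      using that by (auto simp: pair_entry_def e_def)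
    then have "(\<Sum>x\<in>?I. h (y x) * pair_entry (e False, e True) x) = (\<Sum>x\<in>?I. if x = i0 then 1 else 0)"
      using y(2) by (intro sum.cong) auto
    ultimately show False using y(1) by (simp add: sum.delta)
  qed
qed

context field_ext
begin

section \<open>Parameter counts for the two kinds of nongenerating tuples\<close>

lemma ratfun_det:
  assumes A: "A \<in> carrier_mat m m" and ent: "\<And>i j. i < m \<Longrightarrow> j < m \<Longrightarrow> A $$ (i, j) \<in> ratfun T"
  shows "det A \<in> ratfun T"
  unfolding det_def'[OF A]
proof (intro ratfun_sum ratfun_mult ratfun_prod ent)
  fix p
  show "(signof p :: 'f) \<in> ratfun T"
    by (auto simp: sign_def ratfun_1 ratfun_uminus)
next
  fix p i assume "p \<in> {p. p permutes {0..<m}}" "i \<in> {0..<m}"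
  then show "i < m" "p i < m" using permutes_in_image[of p "{0..<m}" i] by auto
qed

lemma ratfun_adj_mat:
  assumes A: "A \<in> carrier_mat m m" and ent: "\<And>i j. i < m \<Longrightarrow> j < m \<Longrightarrow> A $$ (i, j) \<in> ratfun T"
    and ij: "i < m" "j < m"
  shows "adj_mat A $$ (i, j) \<in> ratfun T"
proof -
  have "det (mat_delete A j i) \<in> ratfun T"
  proof (rule ratfun_det)
    show "mat_delete A j i \<in> carrier_mat (m - 1) (m - 1)" by (rule mat_delete_carrier[OF A])
    fix k l assume "k < m - 1" "l < m - 1"
    then show "mat_delete A j i $$ (k, l) \<in> ratfun T"
      using A ij by (auto simp: mat_delete_def intro!: ent)
  qed
  then show ?thesis
    using A ij by (auto simp: adj_mat_def cofactor_def intro!: ratfun_mult ratfun_power ratfun_uminus ratfun_1)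
qed

text \<open>\<open>T\<close> consists of the echelon entries \<open>c i j\<close> and of the matrix
  entries outside the block with rows off \<open>J\<close> and columns in \<open>J\<close>. Each
  equation in \<open>preserves\<close> contains a single entry of that block and expresses it by
  elements of \<open>T\<close>.\<close>

lemma preserved_subspace_parameters:
  fixes M :: "nat \<Rightarrow> bool \<Rightarrow> 'f mat"
  assumes J: "J \<subseteq> {..<n}" and pres: "\<And>k s. k < r \<Longrightarrow> preserves n J c (M k s)"
  shows "\<exists>T. finite T \<and> card T \<le> card J * (n - card J) + 2 * r * (n\<^sup>2 - card J * (n - card J)) \<and>
    (\<forall>k<r. \<forall>s. \<forall>i<n. \<forall>j<n. M k s $$ (i, j) \<in> ratfun T)"
proof -
  let ?N = "({..<n} - J) \<times> J"
  define P where "P = {..<r} \<times> (UNIV :: bool set) \<times> ({..<n} \<times> {..<n} - ?N)"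
  define T where "T = (\<lambda>(i, j). c i j) ` ?N \<union> (\<lambda>(k, s, ij). M k s $$ ij) ` P"
  have finJ: "finite J" using J finite_subset by blast
  have cN: "card ?N = card J * (n - card J)"
    using J finJ by (simp add: card_cartesian_product card_Diff_subset)
  have "card ({..<n} \<times> {..<n} - ?N) = n\<^sup>2 - card ?N"
    using J finJ by (subst card_Diff_subset) (auto simp: card_cartesian_product power2_eq_square)
  then have cD: "card ({..<n} \<times> {..<n} - ?N) = n\<^sup>2 - card J * (n - card J)" by (simp only: cN)
  have cP: "card P = 2 * r * (n\<^sup>2 - card J * (n - card J))"
    unfolding P_def card_cartesian_product[of "{..<r}"] card_cartesian_product[of UNIV] cD by simp
  have fin: "finite ?N" "finite P" using finJ by (auto simp: P_def)
  then have finT: "finite T" by (simp add: T_def)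
  have "card T \<le> card ?N + card P"
    unfolding T_def using fin by (meson add_mono card_Un_le card_image_le le_trans)
  then have cT: "card T \<le> card J * (n - card J) + 2 * r * (n\<^sup>2 - card J * (n - card J))"
    by (simp only: cN cP)
  have c: "c i j \<in> ratfun T" if "i \<in> {..<n} - J" "j \<in> J" for i j
    using that finT by (intro ratfun_gen) (force simp: T_def)+
  have free: "M k s $$ (i, j) \<in> ratfun T" if "k < r" "i < n" "j < n" "\<not> (i \<notin> J \<and> j \<in> J)" for k s i j
  proof (rule ratfun_gen[OF finT])
    have "(k, s, i, j) \<in> P" using that by (auto simp: P_def)
    then show "M k s $$ (i, j) \<in> T" unfolding T_def by force
  qed
  have "M k s $$ (i, j) \<in> ratfun T" if k: "k < r" and ij: "i < n" "j < n" for k s i j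
  proof (cases "i \<notin> J \<and> j \<in> J")
    case True
    have "M k s $$ (i, j) + (\<Sum>l\<in>{..<n} - J. M k s $$ (i, l) * c l j) =
        (\<Sum>p\<in>J. c i p * (M k s $$ (p, j) + (\<Sum>l\<in>{..<n} - J. M k s $$ (p, l) * c l j)))"
      using pres[OF k, of s] True ij unfolding preserves_def by blast
    then have "M k s $$ (i, j) =
        (\<Sum>p\<in>J. c i p * (M k s $$ (p, j) + (\<Sum>l\<in>{..<n} - J. M k s $$ (p, l) * c l j))) -
        (\<Sum>l\<in>{..<n} - J. M k s $$ (i, l) * c l j)" by (simp add: eq_diff_eq)
    also have "\<dots> \<in> ratfun T"
      by (intro ratfun_diff ratfun_sum ratfun_mult ratfun_add c free)
        (use k ij True J in auto)
    finally show ?thesis .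
  next
    case False
    then show ?thesis by (rule free[OF k ij])
  qed
  with finT cT show ?thesis by blast
qed

text \<open>Scaling one entry of \<open>g\<close> to 1 and using its symmetry leaves at most n(n +
  1)/2 - 1 parameters for \<open>g\<close>, for either sign. The entries of the \<open>a k\<close>
  add r n^2, and \<open>b k\<close> is the conjugate of \<open>a k\<close> by \<open>g\<close>. The
  bound is doubled to avoid a division.\<close>

lemma intertwined_parameters:
  fixes a b :: "nat \<Rightarrow> 'f mat"
  assumes n: "n > 0" and ab: "\<And>k. k < r \<Longrightarrow> a k \<in> carrier_mat n n" "\<And>k. k < r \<Longrightarrow> b k \<in> carrier_mat n n"
    and g: "g \<in> carrier_mat n n" "det g \<noteq> 0" and \<epsilon>: "\<epsilon> = 1 \<or> \<epsilon> = - 1"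
    and sym: "transpose_mat g = \<epsilon> \<cdot>\<^sub>m g" and int: "\<And>k. k < r \<Longrightarrow> b k * g = g * a k"
  shows "\<exists>T. finite T \<and> 2 * card T + 2 \<le> n * (n + 1) + 2 * (r * n\<^sup>2) \<and>
    (\<forall>k<r. \<forall>i<n. \<forall>j<n. a k $$ (i, j) \<in> ratfun T \<and> b k $$ (i, j) \<in> ratfun T)"
proof -
  have g_sym: "g $$ (j, i) = \<epsilon> * g $$ (i, j)" if "i < n" "j < n" for i j
    using arg_cong[OF sym, of "\<lambda>m. m $$ (i, j)"] that g by simp
  obtain i j where ij: "i < n" "j < n" "g $$ (i, j) \<noteq> 0"
  proof -
    have "\<exists>i<n. \<exists>j<n. g $$ (i, j) \<noteq> 0"
    proof (rule ccontr)
      assume "\<not> ?thesis"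
      then have "g = 0 \<cdot>\<^sub>m g" using g(1) by (intro eq_matI) auto
      then have "det g = 0 ^ n * det g" using det_smult[of 0 g] g(1) by simp
      then show False using g(2) n by (simp add: zero_power)
    qed
    then show ?thesis using that by blast
  qed
  \<comment> \<open>By symmetry up to sign the nonzero entry can be moved to or above the diagonal,
    where the parameters of \<open>g\<close> are taken from.\<close>
  define p q where "p = min i j" and "q = max i j"
  have pq: "p \<le> q" "q < n" "p < n" "g $$ (p, q) \<noteq> 0"
    using ij g_sym[OF ij(1,2)] \<epsilon> by (auto simp: p_def q_def min_def max_def)
  define g' where "g' = inverse (g $$ (p, q)) \<cdot>\<^sub>m g"
  have g': "g' \<in> carrier_mat n n" using g(1) by (simp add: g'_def)
  have det': "det g' \<noteq> 0" using g pq by (simp add: g'_def)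
  have g'_pq: "g' $$ (p, q) = 1" using g(1) pq by (simp add: g'_def)
  have g'_sym: "g' $$ (j, i) = \<epsilon> * g' $$ (i, j)" if "i < n" "j < n" for i j
    using g_sym[OF that] that g(1) by (simp add: g'_def)
  have int': "b k * g' = g' * a k" if k: "k < r" for k
    unfolding g'_def mult_smult_distrib[OF ab(2)[OF k] g(1)] mult_smult_assoc_mat[OF g(1) ab(1)[OF k]] int[OF k] ..
  define U where "U = {(i, j). i \<le> j \<and> j < n}"
  have U_eq: "U = (\<lambda>(j, i). (i, j)) ` (SIGMA j:{..<n}. {..j})" by (force simp: U_def)
  have "card U = (\<Sum>j<n. j + 1)"
    unfolding U_eq by (subst card_image) (auto simp: inj_on_def)
  also have "2 * (\<Sum>j<n. j + 1) = n * (n + 1)" by (induction n) auto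
  finally have cU: "2 * card U = n * (n + 1)" by simp
  have finU: "finite U" unfolding U_eq by auto
  define V where "V = {..<r} \<times> {..<n} \<times> {..<n}"
  have cV: "card V = r * n\<^sup>2" by (simp add: V_def card_cartesian_product power2_eq_square)
  define T where "T = (\<lambda>ij. g' $$ ij) ` (U - {(p, q)}) \<union> (\<lambda>(k, ij). a k $$ ij) ` V"
  have finT: "finite T" using finU by (simp add: T_def V_def)
  have "card T \<le> card (U - {(p, q)}) + card V"
    unfolding T_def using finU by (intro order_trans[OF card_Un_le] add_mono card_image_le) (auto simp: V_def)
  moreover have "card (U - {(p, q)}) + 1 = card U"
    using finU pq by (subst card_Suc_Diff1[of U "(p, q)", symmetric]) (auto simp: U_def)
  ultimately have cT: "2 * card T + 2 \<le> n * (n + 1) + 2 * (r * n\<^sup>2)"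
    using cU cV by simp
  have a_in: "a k $$ (i, j) \<in> ratfun T" if "k < r" "i < n" "j < n" for k i j
  proof (rule ratfun_gen[OF finT])
    have "(k, i, j) \<in> V" using that by (auto simp: V_def)
    then show "a k $$ (i, j) \<in> T" unfolding T_def by force
  qed
  have g'_upper: "g' $$ (i, j) \<in> ratfun T" if "i \<le> j" "j < n" for i j
  proof (cases "(i, j) = (p, q)")
    case True
    then show ?thesis using g'_pq ratfun_1 by simp
  next
    case False
    then show ?thesis using that finT by (intro ratfun_gen) (auto simp: T_def U_def)
  qed
  have g'_in: "g' $$ (i, j) \<in> ratfun T" if "i < n" "j < n" for i j
  proof (cases "i \<le> j")
    case False
    have "\<epsilon> \<in> ratfun T" using \<epsilon> ratfun_1 ratfun_uminus by auto
    then show ?thesis using g'_sym[OF that(2,1)] g'_upper[of j i] False that by (simp add: ratfun_mult)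
  qed (use that g'_upper in auto)
  have b_in: "b k $$ (i, j) \<in> ratfun T" if k: "k < r" and ij: "i < n" "j < n" for k i j
  proof -
    note c = ab[OF k] and adj = adj_mat[OF g']
    \<comment> \<open>The adjugate replaces the inverse of \<open>g'\<close>, so that only one
      division, by the determinant, remains.\<close>
    have "b k * g' * adj_mat g' = b k * (det g' \<cdot>\<^sub>m 1\<^sub>m n)"
      by (simp only: assoc_mult_mat[OF c(2) g' adj(1)] adj(2))
    also have "\<dots> = det g' \<cdot>\<^sub>m b k"
      using c by (simp add: mult_smult_distrib[OF c(2) one_carrier_mat])
    finally have "det g' \<cdot>\<^sub>m b k = g' * a k * adj_mat g'" by (simp only: int'[OF k])
    from arg_cong[OF this, of "\<lambda>m. m $$ (i, j)"]
    have "det g' * b k $$ (i, j) = (g' * a k * adj_mat g') $$ (i, j)" using c ij by simp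
    also have "\<dots> = (\<Sum>l<n. (\<Sum>m<n. g' $$ (i, m) * a k $$ (m, l)) * adj_mat g' $$ (l, j))"
      using ij by (simp add: mat_mult_entry[OF mult_carrier_mat[OF g' c(1)] adj(1)]
          mat_mult_entry[OF g' c(1)] del: index_mult_mat)
    also have "\<dots> \<in> ratfun T"
      using ij k by (intro ratfun_sum ratfun_mult g'_in a_in ratfun_adj_mat[OF g']) auto
    finally have "det g' * b k $$ (i, j) \<in> ratfun T" .
    from ratfun_mult[OF ratfun_inverse[OF ratfun_det[OF g' g'_in]] this]
    have "inverse (det g') * (det g' * b k $$ (i, j)) \<in> ratfun T" .
    then show ?thesis by (simp only: mult.assoc[symmetric] left_inverse[OF det'] mult_1)
  qed
  with finT cT a_in show ?thesis by blast
qed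

end

section \<open>The upper bound\<close>

definition alg_indep_mod :: "'k::field mpoly set \<Rightarrow> nat \<Rightarrow> (nat \<Rightarrow> 'k mpoly) \<Rightarrow> bool" where
  "alg_indep_mod P d f \<longleftrightarrow> (\<forall>s g. (\<Sum>m\<in>{..<d} \<rightarrow>\<^sub>E {..s}. Const (g m) * (\<Prod>i<d. f i ^ m i)) \<in> P \<longrightarrow>
     (\<forall>m\<in>{..<d} \<rightarrow>\<^sub>E {..s}. g m = 0))"

text \<open>The subtraction does not truncate for \<open>n > 1\<close> and \<open>r \<ge> 1\<close>,
  which makes the integer identity below available.\<close>

definition expected_dim :: "nat \<Rightarrow> nat \<Rightarrow> nat" where
  "expected_dim n r = (if n > 1 then 2 * r * n\<^sup>2 - (2 * r - 1) * (n - 1) else r)"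

section \<open>Comparison of the parameter counts\<close>

lemma int_expected_dim:
  assumes "n > 1" "r \<ge> 1"
  shows "int (expected_dim n r) = 2 * int r * (int n)\<^sup>2 - (2 * int r - 1) * (int n - 1)"
proof -
  have "(2 * r - 1) * (n - 1) \<le> (2 * r) * (n * n)"
    by (intro mult_mono order_trans[OF diff_le_self le_square]) auto
  then have "int (expected_dim n r) = int (2 * r * n\<^sup>2) - int ((2 * r - 1) * (n - 1))"
    using assms by (simp add: expected_dim_def of_nat_diff power2_eq_square del: of_nat_mult)
  moreover have "int ((2 * r - 1) * (n - 1)) = (2 * int r - 1) * (int n - 1)"
    using assms by (simp add: of_nat_diff)
  ultimately show ?thesis by simp
qed

text \<open>The left side is 2rn^2 - (2r - 1)m(n - m), and m(n - m) - (n - 1) = (m - 1)(n - m - 1)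
  is nonnegative.\<close>

lemma expected_dim_invariant_subspace:
  assumes m: "0 < m" "m < n" and r: "r \<ge> 1"
  shows "m * (n - m) + 2 * r * (n\<^sup>2 - m * (n - m)) \<le> expected_dim n r"
proof -
  define x where "x = int m * (int n - int m)"
  have "m * (n - m) \<le> n * n" using m by (intro mult_mono) auto
  then have "int (m * (n - m) + 2 * r * (n\<^sup>2 - m * (n - m))) = x + 2 * int r * ((int n)\<^sup>2 - x)"
    using m by (simp add: of_nat_diff x_def power2_eq_square)
  also have "\<dots> = 2 * int r * (int n)\<^sup>2 - (2 * int r - 1) * x" by (simp add: algebra_simps)
  also have "\<dots> \<le> 2 * int r * (int n)\<^sup>2 - (2 * int r - 1) * (int n - 1)"
  proof -
    have "0 \<le> (int m - 1) * (int n - int m - 1)" using m by (intro mult_nonneg_nonneg) auto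
    then have "int n - 1 \<le> x" by (simp add: x_def algebra_simps)
    then show ?thesis using r by (intro diff_left_mono mult_left_mono) auto
  qed
  also have "\<dots> = int (expected_dim n r)" using m r by (intro int_expected_dim[symmetric]) auto
  finally show ?thesis by (simp only: of_nat_le_iff)
qed

text \<open>For n > 1, twice the gap between the expected dimension and the largest admissible
  \<open>c\<close> is (2r - 1)((n - 1)^2 + 1) - (n - 2), which is at least (n - 1)(n - 2) + 2. For n
  = 1 the assumption amounts to \<open>c \<le> r\<close>.\<close>

lemma expected_dim_intertwiner:
  assumes "n \<ge> 1" "r \<ge> 1" "2 * c + 2 \<le> n * (n + 1) + 2 * (r * n\<^sup>2)"
  shows "c \<le> expected_dim n r"
proof (cases "n = 1")
  case True
  then show ?thesis using assms by (simp add: expected_dim_def)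
next
  case False
  then have n: "n > 1" using assms by simp
  have "2 * int c + 2 \<le> int n * (int n + 1) + 2 * (int r * (int n)\<^sup>2)"
    using assms(3) by (metis (mono_tags, lifting) of_nat_add of_nat_le_iff of_nat_mult of_nat_numeral of_nat_power of_nat_1)
  moreover have "1 * ((int n - 1)\<^sup>2 + 1) \<le> (2 * int r - 1) * ((int n - 1)\<^sup>2 + 1)"
    using assms(2) by (intro mult_right_mono) auto
  moreover have "0 \<le> (int n - 2) * (int n - 1)" using n by (intro mult_nonneg_nonneg) auto
  ultimately have "2 * int c \<le> 2 * (2 * int r * (int n)\<^sup>2 - (2 * int r - 1) * (int n - 1))"
    by (simp add: algebra_simps power2_eq_square)
  then show ?thesis using int_expected_dim[OF n assms(2)] by simp
qed

text \<open>All data other than the prime are quantified inside, so that the choice of a single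
  prime can account for every \<open>n\<close>, \<open>r\<close> and \<open>Z\<close> at
  once.\<close>

definition dim_bounded_at :: "'k::field mpoly set \<Rightarrow> bool" where
  "dim_bounded_at P \<longleftrightarrow> (\<forall>n r Z d f. 1 \<le> n \<longrightarrow> 1 \<le> r \<longrightarrow> nongenerating_subscheme n r Z \<longrightarrow> Z \<subseteq> P \<longrightarrow>
     (\<forall>i<d. f i \<in> coords n r) \<longrightarrow> alg_indep_mod P d f \<longrightarrow> d \<le> expected_dim n r)"

text \<open>HOL has no types depending on the term \<open>P\<close>, but the residue field at \<open>P\<close> has to be a type for
  its algebraic closure to be available. So it is formed at one prime only: a counterexample to the
  bound, if there is any.\<close>
definition critical_prime :: "'k::field mpoly set" where
  "critical_prime = (SOME P. prime_in UNIV P \<and>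
     ((\<exists>Q::'k mpoly set. prime_in UNIV Q \<and> \<not> dim_bounded_at Q) \<longrightarrow> \<not> dim_bounded_at P))"

lemma critical_prime:
  "prime_in UNIV (critical_prime :: 'k::field mpoly set)"
  "prime_in UNIV (Q :: 'k mpoly set) \<Longrightarrow> \<not> dim_bounded_at Q \<Longrightarrow>
     \<not> dim_bounded_at (critical_prime :: 'k mpoly set)"
proof -
  have "prime_in UNIV {0 :: 'k mpoly}" by (auto simp: prime_in_def)
  then have "\<exists>P::'k mpoly set. prime_in UNIV P \<and>
      ((\<exists>Q::'k mpoly set. prime_in UNIV Q \<and> \<not> dim_bounded_at Q) \<longrightarrow> \<not> dim_bounded_at P)" by blast
  from someI_ex[OF this] show "prime_in UNIV (critical_prime :: 'k mpoly set)"
    "prime_in UNIV (Q :: 'k mpoly set) \<Longrightarrow> \<not> dim_bounded_at Q \<Longrightarrow>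
      \<not> dim_bounded_at (critical_prime :: 'k mpoly set)"
    unfolding critical_prime_def by blast+
qed

lemmas critical_primeD = prime_inD[OF critical_prime(1)]

lemma critical_prime_uminus: "x \<in> critical_prime \<Longrightarrow> - x \<in> critical_prime"
  using critical_primeD(4)[of "- 1" x] by simp

\<comment> \<open>The residue domain at the critical prime\<close>
quotient_type (overloaded) 'k residue_dom = "'k::field mpoly" / "\<lambda>f g. f - g \<in> critical_prime"
proof (rule equivpI)
  show "reflp (\<lambda>f g. f - g \<in> (critical_prime :: 'k mpoly set))"
    by (auto intro: reflpI simp: critical_primeD(2))
  show "symp (\<lambda>f g. f - g \<in> (critical_prime :: 'k mpoly set))"
    using critical_prime_uminus by (auto intro!: sympI) fastforce
  show "transp (\<lambda>f g. f - g \<in> (critical_prime :: 'k mpoly set))"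
    using critical_primeD(3) by (auto intro!: transpI) fastforce
qed

instantiation residue_dom :: (field) idom
begin

lift_definition zero_residue_dom :: "'a residue_dom" is 0 .

lift_definition one_residue_dom :: "'a residue_dom" is 1 .

lift_definition plus_residue_dom :: "'a residue_dom \<Rightarrow> 'a residue_dom \<Rightarrow> 'a residue_dom" is "(+)"
  using critical_primeD(3) by (metis add_diff_add)

lift_definition uminus_residue_dom :: "'a residue_dom \<Rightarrow> 'a residue_dom" is uminus
  using critical_prime_uminus by (metis minus_diff_minus)

lift_definition minus_residue_dom :: "'a residue_dom \<Rightarrow> 'a residue_dom \<Rightarrow> 'a residue_dom" is "(-)"
proof -
  fix f f' g g' :: "'a mpoly"
  assume "f - f' \<in> critical_prime" "g - g' \<in> critical_prime"
  then have "(f - f') + - (g - g') \<in> critical_prime"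
    by (intro critical_primeD(3) critical_prime_uminus)
  then show "f - g - (f' - g') \<in> critical_prime" by (simp add: algebra_simps)
qed

lift_definition times_residue_dom :: "'a residue_dom \<Rightarrow> 'a residue_dom \<Rightarrow> 'a residue_dom" is "(*)"
proof -
  fix f f' g g' :: "'a mpoly"
  assume "f - f' \<in> critical_prime" "g - g' \<in> critical_prime"
  then have "g * (f - f') + f' * (g - g') \<in> critical_prime"
    by (intro critical_primeD(3,4)) auto
  then show "f * g - f' * g' \<in> critical_prime" by (simp add: algebra_simps)
qed

instance
proof
  fix a b c :: "'a residue_dom"
  show "a + b + c = a + (b + c)" by transfer (simp add: algebra_simps critical_primeD(2))
  show "a + b = b + a" by transfer (simp add: algebra_simps critical_primeD(2))
  show "0 + a = a" by transfer (simp add: critical_primeD(2))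
  show "- a + a = 0" by transfer (simp add: critical_primeD(2))
  show "a - b = a + - b" by transfer (simp add: critical_primeD(2))
  show "a * b * c = a * (b * c)" by transfer (simp add: algebra_simps critical_primeD(2))
  show "a * b = b * a" by transfer (simp add: algebra_simps critical_primeD(2))
  show "1 * a = a" by transfer (simp add: critical_primeD(2))
  show "(a + b) * c = a * c + b * c" by transfer (simp add: algebra_simps critical_primeD(2))
  show "a * (b + c) = a * b + a * c" by transfer (simp add: algebra_simps critical_primeD(2))
  show "0 * a = 0" by transfer (simp add: critical_primeD(2))
  show "a * 0 = 0" by transfer (simp add: critical_primeD(2))
  show "(0 :: 'a residue_dom) \<noteq> 1"
  proof transfer
    show "\<not> (0 :: 'a mpoly) - 1 \<in> critical_prime"
      using critical_prime_uminus[of "- 1 :: 'a mpoly"] critical_primeD(5) by auto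
  qed
  show "a \<noteq> 0 \<Longrightarrow> b \<noteq> 0 \<Longrightarrow> a * b \<noteq> 0"
  proof transfer
    fix a b :: "'a mpoly"
    show "\<not> a - 0 \<in> critical_prime \<Longrightarrow> \<not> b - 0 \<in> critical_prime \<Longrightarrow> \<not> a * b - 0 \<in> critical_prime"
      using critical_primeD(6)[of a b] by auto
  qed
qed

end

lemma comm_ring_hom_abs_residue_dom: "comm_ring_hom (abs_residue_dom :: 'k::field mpoly \<Rightarrow> _)"
  by unfold_locales
    (simp_all add: zero_residue_dom_def one_residue_dom_def plus_residue_dom.abs_eq times_residue_dom.abs_eq)

lemma abs_residue_dom_eq_0: "abs_residue_dom f = 0 \<longleftrightarrow> f \<in> critical_prime"
  by (simp add: zero_residue_dom_def residue_dom.abs_eq_iff)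

lemma comm_ring_hom_compose:
  assumes "comm_ring_hom f" "comm_ring_hom g" shows "comm_ring_hom (\<lambda>x. f (g x))"
proof -
  interpret f: comm_ring_hom f by fact
  interpret g: comm_ring_hom g by fact
  show ?thesis by unfold_locales (simp_all add: f.hom_add g.hom_add f.hom_mult g.hom_mult)
qed

section \<open>Points of the subscheme of nongenerating tuples\<close>

definition generic_tuple :: "nat \<Rightarrow> (var \<Rightarrow> 'l) \<Rightarrow> nat \<Rightarrow> 'l mat \<times> 'l mat" where
  "generic_tuple n x k = (mat n n (\<lambda>(i, j). x (k, False, i, j)), mat n n (\<lambda>(i, j). x (k, True, i, j)))"

lemma coord_generic_tuple:
  assumes "v \<in> vars n r"
  shows "coord (\<lambda>k\<in>{..<r}. matpair \<iota> (generic_tuple n x k)) v = \<iota> (x v)"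
  using assms by (auto simp: vars_def coord_def generic_tuple_def matpair_simp)

lemma generic_tuple_affine_points:
  assumes "inj \<iota>"
  shows "(\<lambda>k\<in>{..<r}. matpair \<iota> (generic_tuple n x k)) \<in> affine_points (transport \<iota>) n r"
  by (auto simp: affine_points_def carrier_alg[OF assms] generic_tuple_def)

lemma closed_points_generic_tuple:
  fixes \<kappa> :: "'k::field \<Rightarrow> 'l::field"
  assumes inj: "inj \<iota>" and Z: "Z \<subseteq> coords n r"
  shows "(\<lambda>k\<in>{..<r}. matpair \<iota> (generic_tuple n x k)) \<in> closed_points Z (transport \<iota>) (\<lambda>c. \<iota> (\<kappa> c)) n r
    \<longleftrightarrow> (\<forall>f\<in>Z. peval \<kappa> x f = 0)"
proof -
  have "mpoly_eval (transport \<iota>) (\<lambda>c. \<iota> (\<kappa> c)) (coord (\<lambda>k\<in>{..<r}. matpair \<iota> (generic_tuple n x k))) f =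
      \<iota> (peval \<kappa> x f)" if "f \<in> Z" for f
    using Z that by (intro mpoly_eval_transport[OF inj] coord_generic_tuple[of _ n]) (auto simp: coords_def)
  then show ?thesis
    using generic_tuple_affine_points[OF inj] inj
    by (auto simp: closed_points_def transport_simps[OF inj] inj_eq)
qed

text \<open>The fibres of the surjection \<open>q\<close> are distinct sets of pairs of polynomials
  and thus embed the typed field into the admissible carrier type. It is used for the residue field
  and for the field of rational functions, where \<open>q\<close> forms fractions.\<close>

lemma nongenerating_subscheme_point:
  fixes \<kappa> :: "'k::field \<Rightarrow> 'l::field" and q :: "'k mpoly \<times> 'k mpoly \<Rightarrow> 'l"
  assumes Z: "nongenerating_subscheme n r Z" and \<kappa>: "comm_ring_hom \<kappa>" and q: "surj q"
  shows "(\<forall>f\<in>Z. peval \<kappa> x f = 0) \<longleftrightarrow>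
    (\<exists>B. invol_matrix_algebra n B \<and> B \<noteq> mat_pairs n \<and>
      generic_tuple n x ` {..<r} \<subseteq> B)"
proof -
  define \<iota> where "\<iota> y = q -` {y}" for y
  have inj: "inj \<iota>"
  proof (rule injI)
    fix y z assume "\<iota> y = \<iota> z"
    moreover obtain p where "q p = y" using q by (metis surjD)
    ultimately show "y = z" by (auto simp: \<iota>_def)
  qed
  have "ideal Z (coord_ring n r)" using Z by (simp add: nongenerating_subscheme_def)
  then have "Z \<subseteq> coords n r"
    using additive_subgroup.a_subset ideal.axioms(1) coord_ring_simps(1) by blast
  let ?a = "\<lambda>k\<in>{..<r}. matpair \<iota> (generic_tuple n x k)"
  have aff: "?a \<in> affine_points (transport \<iota>) n r" by (rule generic_tuple_affine_points[OF inj])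
  have "closed_points Z (transport \<iota>) (\<lambda>c. \<iota> (\<kappa> c)) n r =
      {a \<in> affine_points (transport \<iota>) n r. \<not> generates (transport \<iota>) n (a ` {..<r})}"
    using Z field_transport[OF inj] ring_hom_transport[OF inj \<kappa>]
    unfolding nongenerating_subscheme_def by blast
  then have "(\<forall>f\<in>Z. peval \<kappa> x f = 0) \<longleftrightarrow> \<not> generates (transport \<iota>) n (?a ` {..<r})"
    using closed_points_generic_tuple[OF inj \<open>Z \<subseteq> coords n r\<close>, of x \<kappa>] aff by blast
  also have "\<dots> \<longleftrightarrow> (\<exists>B. invol_matrix_algebra n B \<and> B \<noteq> mat_pairs n \<and>
      ?a ` {..<r} \<subseteq> matpair \<iota> ` B)"
    using aff by (intro not_generates_transport_iff[OF inj]) (auto simp: affine_points_def)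
  also have "?a ` {..<r} = matpair \<iota> ` generic_tuple n x ` {..<r}" by auto
  finally show ?thesis unfolding inj_image_subset_iff[OF inj_matpair[OF inj]] .
qed

lemma surj_Fract:
  fixes h :: "'a \<Rightarrow> 'b::idom"
  assumes "surj h"
  shows "surj (\<lambda>(p, q). Fract (h p) (h q))"
  unfolding surj_def
proof
  fix x :: "'b fract"
  obtain a b where "x = Fract a b" by (cases x)
  then have "x = (case (inv_into UNIV h a, inv_into UNIV h b) of (p, q) \<Rightarrow> Fract (h p) (h q))"
    by (simp add: surj_f_inv_f[OF assms])
  then show "\<exists>pq. x = (case pq of (p, q) \<Rightarrow> Fract (h p) (h q))" by blast
qed

lemma surj_abs_residue_dom: "surj abs_residue_dom"
  by (rule surjI[of _ rep_residue_dom]) (rule Quotient3_abs_rep[OF Quotient3_residue_dom])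

text \<open>As \<open>Z \<subseteq> critical_prime\<close>, the residues of the variables form a
  zero of \<open>Z\<close>, hence a nongenerating tuple. Over the algebraic closure its coordinates,
  and with them the \<open>f i\<close>, are rational functions of at most
  \<open>expected_dim n r\<close> elements, while the \<open>f i\<close> remain independent.\<close>

lemma dim_bounded_at_critical_prime: "dim_bounded_at (critical_prime :: 'k::field mpoly set)"
  unfolding dim_bounded_at_def
proof (intro allI impI)
  fix n r d and Z :: "'k mpoly set" and f :: "nat \<Rightarrow> 'k mpoly"
  assume n: "1 \<le> n" and r: "1 \<le> r" and Z: "nongenerating_subscheme n r Z" "Z \<subseteq> critical_prime"
    and f: "\<forall>i<d. f i \<in> coords n r" and indep: "alg_indep_mod critical_prime d f"
  define \<pi> :: "'k mpoly \<Rightarrow> 'k residue_dom fract" where "\<pi> p = to_fract (abs_residue_dom p)" for p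
  have "comm_ring_hom (to_fract :: 'k residue_dom \<Rightarrow> _)" by (unfold_locales, simp_all)
  then have \<pi>: "comm_ring_hom \<pi>"
    unfolding \<pi>_def by (rule comm_ring_hom_compose[OF _ comm_ring_hom_abs_residue_dom])
  interpret \<pi>: comm_ring_hom \<pi> by (rule \<pi>)
  have \<pi>_0: "\<pi> p = 0 \<longleftrightarrow> p \<in> critical_prime" for p
    by (simp add: \<pi>_def abs_residue_dom_eq_0)
  have \<pi>_peval: "peval (\<lambda>c. \<pi> (Const c)) (\<lambda>v. \<pi> (Var v)) p = \<pi> p" for p
    using peval_hom[OF \<pi>, of Const Var p] by (simp add: peval_Const_Var)
  have "\<forall>p\<in>Z. peval (\<lambda>c. \<pi> (Const c)) (\<lambda>v. \<pi> (Var v)) p = 0"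
    using Z(2) by (auto simp: \<pi>_peval \<pi>_0)
  then obtain B where B: "invol_matrix_algebra n B" "B \<noteq> mat_pairs n"
      "generic_tuple n (\<lambda>v. \<pi> (Var v)) ` {..<r} \<subseteq> B"
    using nongenerating_subscheme_point[OF Z(1) comm_ring_hom_compose[OF \<pi> comm_ring_hom_Const] surj_Fract[OF surj_abs_residue_dom]]
    by blast
  have ac: "comm_ring_hom (to_ac :: 'k residue_dom fract \<Rightarrow> _)" by unfold_locales simp_all
  define C where "C = scalar_ext to_ac B"
  have C: "invol_matrix_algebra n C" "C \<noteq> mat_pairs n"
    unfolding C_def by (rule invol_matrix_algebra_scalar_ext[OF ac B(1,2)])+
  define y where "y v = to_ac (\<pi> (Var v))" for v
  define \<kappa> where "\<kappa> c = to_ac (\<pi> (Const c))" for c :: 'k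
  define a b where "a k = fst (generic_tuple n y k)" and "b k = snd (generic_tuple n y k)" for k
  have abC: "(a k, b k) \<in> C" if "k < r" for k
  proof -
    let ?g = "generic_tuple n (\<lambda>v. \<pi> (Var v)) k"
    have "(fst (?g), snd (?g)) \<in> B"
      using B(3) that by auto
    from invol_matrix_algebra_scalar_ext(3)[OF ac B(1,2) this]
    have "(map_mat to_ac (fst (?g)),
        map_mat to_ac (snd (?g))) \<in> C" by (simp add: C_def)
    moreover have "map_mat to_ac (fst (?g)) = a k"
      "map_mat to_ac (snd (?g)) = b k"
      by (auto simp: a_def b_def y_def generic_tuple_def)
    ultimately show ?thesis by simp
  qed
  have \<kappa>: "comm_ring_hom \<kappa>" unfolding \<kappa>_def
    by (rule comm_ring_hom_compose[OF ac comm_ring_hom_compose[OF \<pi> comm_ring_hom_Const]])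
  interpret field_ext \<kappa> by (rule field_ext.intro) (rule \<kappa>)
  have entries: "a k $$ (i, j) = y (k, False, i, j)" "b k $$ (i, j) = y (k, True, i, j)"
    if "i < n" "j < n" for i j k
    using that by (simp_all add: a_def b_def generic_tuple_def)
  have abc: "a k \<in> carrier_mat n n" "b k \<in> carrier_mat n n" for k
    by (simp_all add: a_def b_def generic_tuple_def)
  obtain T where T: "finite T" "card T \<le> expected_dim n r"
      "\<And>v. v \<in> vars n r \<Longrightarrow> y v \<in> ratfun T"
  proof -
    from n have n0: "n > 0" by simp
    show ?thesis
    proof (cases rule: proper_invol_matrix_algebra_cases[OF n0 C])
      case (1 J c)
      \<comment> \<open>With the second components transposed, all 2r matrices preserve the same
        subspace.\<close>
      have "preserves n J c (if s then transpose_mat (b k) else a k)" if "k < r" for k s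
        using 1(4)[OF abC[OF that]] by auto
      from preserved_subspace_parameters[OF 1(1), of r c "\<lambda>k s. if s then transpose_mat (b k) else a k", OF this]
      obtain T where T: "finite T"
        "card T \<le> card J * (n - card J) + 2 * r * (n\<^sup>2 - card J * (n - card J))"
        "\<And>k s i j. k < r \<Longrightarrow> i < n \<Longrightarrow> j < n \<Longrightarrow>
          (if s then transpose_mat (b k) else a k) $$ (i, j) \<in> ratfun T" by blast
      have finJ: "finite J" using 1(1) finite_subset by blast
      have "0 < card J" "card J < n"
        using 1(1-3) finJ psubset_card_mono[of "{..<n}" J] by (auto simp: card_gt_0_iff)
      then have "card T \<le> expected_dim n r"
        using T(2) expected_dim_invariant_subspace[OF _ _ r] le_trans by blast
      moreover have "y v \<in> ratfun T" if v: "v \<in> vars n r" for v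
      proof -
        obtain k s i j where kij: "v = (k, s, i, j)" "k < r" "i < n" "j < n"
          using v by (auto simp: vars_def)
        then have "transpose_mat (b k) $$ (j, i) = b k $$ (i, j)" using abc(2)[of k] by simp
        then show ?thesis
          using kij T(3)[of k i j False] T(3)[of k j i True] entries[of i j k] by (cases s) auto
      qed
      ultimately show ?thesis using T(1) that by blast
    next
      case (2 g \<epsilon>)
      have "\<exists>T. finite T \<and> 2 * card T + 2 \<le> n * (n + 1) + 2 * (r * n\<^sup>2) \<and>
          (\<forall>k<r. \<forall>i<n. \<forall>j<n. a k $$ (i, j) \<in> ratfun T \<and> b k $$ (i, j) \<in> ratfun T)"
        by (rule intertwined_parameters[OF n0 abc 2(1-4) 2(5)[OF abC]])
      then obtain T where T: "finite T"
        "2 * card T + 2 \<le> n * (n + 1) + 2 * (r * n\<^sup>2)"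
        "\<And>k i j. k < r \<Longrightarrow> i < n \<Longrightarrow> j < n \<Longrightarrow> a k $$ (i, j) \<in> ratfun T \<and> b k $$ (i, j) \<in> ratfun T"
        by blast
      have "card T \<le> expected_dim n r" by (rule expected_dim_intertwiner[OF n r T(2)])
      moreover have "y v \<in> ratfun T" if v: "v \<in> vars n r" for v
      proof -
        obtain k s i j where "v = (k, s, i, j)" "k < r" "i < n" "j < n" using v by (auto simp: vars_def)
        then show ?thesis using T(3)[of k i j] entries[of i j k] by (cases s) auto
      qed
      ultimately show ?thesis using T(1) that by blast
    qed
  qed
  have \<kappa>y: "peval \<kappa> y p = to_ac (\<pi> p)" for p
    using peval_hom[OF ac, of "\<lambda>c. \<pi> (Const c)" "\<lambda>v. \<pi> (Var v)" p]
    by (simp add: \<pi>_peval \<kappa>_def[abs_def] y_def[abs_def])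
  have "to_ac (\<pi> (f i)) \<in> ratfun T" if i: "i < d" for i
    unfolding \<kappa>y[symmetric] peval_def meval_def
  proof (intro ratfun_sum ratfun_mult ratfun_const ratfun_prod ratfun_power T(3))
    fix m v assume "m \<in> Poly_Mapping.keys (f i)" "v \<in> Poly_Mapping.keys m"
    then show "v \<in> vars n r" using f i by (auto simp: coords_def)
  qed
  \<comment> \<open>The coefficients of a relation come from the base field, so the relation is the
    image of one among polynomials. The kernel of the composite map is exactly
    \<open>critical_prime\<close>.\<close>
  moreover have "alg_indep d (\<lambda>i. to_ac (\<pi> (f i)))"
    unfolding alg_indep_def
  proof (intro allI impI)
    fix s g
    assume *: "(\<Sum>m\<in>{..<d} \<rightarrow>\<^sub>E {..s}. \<kappa> (g m) * (\<Prod>i<d. to_ac (\<pi> (f i)) ^ m i)) = 0"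
    have "to_ac (\<pi> (\<Sum>m\<in>{..<d} \<rightarrow>\<^sub>E {..s}. Const (g m) * (\<Prod>i<d. f i ^ m i))) = 0"
      using * by (simp add: \<pi>.hom_sum \<pi>.hom_prod \<pi>.hom_mult \<pi>.hom_power to_ac_sum to_ac_prod \<kappa>_def)
    then have "(\<Sum>m\<in>{..<d} \<rightarrow>\<^sub>E {..s}. Const (g m) * (\<Prod>i<d. f i ^ m i)) \<in> critical_prime"
      by (simp only: to_ac_eq_0_iff \<pi>_0)
    with indep[unfolded alg_indep_mod_def, THEN spec, THEN spec, of g s]
    show "\<forall>m\<in>{..<d} \<rightarrow>\<^sub>E {..s}. g m = 0" by (rule mp)
  qed
  ultimately have "d \<le> card T" by (intro alg_indep_le_card[OF T(1)])
  then show "d \<le> expected_dim n r" using T(2) by simp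
qed

lemma dim_bounded_at_prime: "prime_in UNIV P \<Longrightarrow> dim_bounded_at P"
  using critical_prime(2) dim_bounded_at_critical_prime by blast

text \<open>The bound is available at primes of the ring in all variables. Setting the variables
  outside \<open>vars n r\<close> to zero retracts that ring onto the coordinate ring; the preimage
  \<open>Q\<close> of \<open>P 0\<close> is such a prime and meets the coordinate ring in
  \<open>P 0\<close>.\<close>

lemma prime_chain_length_le:
  fixes P :: "nat \<Rightarrow> 'k::field mpoly set"
  assumes n: "1 \<le> n" and r: "1 \<le> r" and Z: "nongenerating_subscheme n r Z"
    and P: "\<And>i. i \<le> d \<Longrightarrow> prime_in (coords n r) (P i)" and ZP: "Z \<subseteq> P 0"
    and chain: "\<And>i. i < d \<Longrightarrow> P i \<subset> P (Suc i)"
  shows "d \<le> expected_dim n r"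
proof -
  define \<rho> :: "'k mpoly \<Rightarrow> 'k mpoly" where
    "\<rho> = peval Const (\<lambda>v. if v \<in> vars n r then Var v else 0)"
  interpret C: comm_ring_hom "Const :: 'k \<Rightarrow> 'k mpoly" by (rule comm_ring_hom_Const)
  interpret \<rho>: comm_ring_hom \<rho> unfolding \<rho>_def by (rule C.comm_ring_hom_peval)
  have \<rho>_coords: "\<rho> p \<in> coords n r" for p
    unfolding \<rho>_def peval_def meval_def
    by (intro coords_sum coords_mult coords_Const coords_prod coords_power)
      (auto simp: coords_Var coords_0)
  have \<rho>_id: "\<rho> p = p" if "p \<in> coords n r" for p
  proof -
    have "\<rho> p = peval Const Var p"
      unfolding \<rho>_def using that by (intro peval_cong) (auto simp: coords_def)
    then show ?thesis by (simp add: peval_Const_Var)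
  qed
  note P0 = prime_inD[OF P[of 0]]
  define Q where "Q = {p. \<rho> p \<in> P 0}"
  have "prime_in UNIV Q"
    unfolding prime_in_def Q_def using P0(2-6) \<rho>_coords
    by (auto simp: \<rho>.hom_add \<rho>.hom_mult)
  have P0_coords: "P 0 \<subseteq> coords n r" using P0(1) by blast
  have "Z \<subseteq> Q" using ZP P0_coords \<rho>_id by (force simp: Q_def)
  have "\<forall>i<d. \<exists>p. p \<in> P (Suc i) - P i" using chain by blast
  then obtain f where f: "\<And>i. i < d \<Longrightarrow> f i \<in> P (Suc i) - P i" by metis
  have fR: "f i \<in> coords n r" if "i < d" for i
    using f[OF that] prime_inD(1)[OF P[of "Suc i"]] that by auto
  have "alg_indep_mod Q d f"
    unfolding alg_indep_mod_def
  proof (intro allI impI)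
    fix s and g :: "(nat \<Rightarrow> nat) \<Rightarrow> 'k"
    let ?S = "\<Sum>m\<in>{..<d} \<rightarrow>\<^sub>E {..s}. Const (g m) * (\<Prod>i<d. f i ^ m i)"
    assume "?S \<in> Q"
    moreover have "?S \<in> coords n r"
      by (intro coords_sum coords_mult coords_Const coords_prod coords_power fR) auto
    ultimately have "?S \<in> P 0" by (simp add: Q_def \<rho>_id)
    then show "\<forall>m\<in>{..<d} \<rightarrow>\<^sub>E {..s}. g m = 0"
      by (intro prime_chain_independent[of d n r P f]) (use P chain f in auto)
  qed
  then show ?thesis
    using dim_bounded_at_prime[OF \<open>prime_in UNIV Q\<close>] n r Z \<open>Z \<subseteq> Q\<close> fR
    unfolding dim_bounded_at_def by blast
qed

section \<open>The lower bound\<close>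

definition kill :: "var set \<Rightarrow> 'k::field mpoly \<Rightarrow> 'k mpoly" where
  "kill U = peval Const (\<lambda>v. if v \<in> U then 0 else Var v)"

lemma comm_ring_hom_kill: "comm_ring_hom (kill U)"
  unfolding kill_def by (rule comm_ring_hom.comm_ring_hom_peval[OF comm_ring_hom_Const])

lemma kill_Const: "kill U (Const c) = Const c"
  unfolding kill_def by (rule comm_ring_hom.peval_Const[OF comm_ring_hom_Const])

lemma kill_Var: "kill U (Var v) = (if v \<in> U then 0 else Var v)"
  unfolding kill_def by (rule comm_ring_hom.peval_Var[OF comm_ring_hom_Const])

lemma kill_empty: "kill {} p = p"
  by (simp add: kill_def peval_Const_Var)

text \<open>Letting further parameters vanish factors through the earlier specialization, so the
  kernels along a sequence of specializations increase.\<close>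

lemma kill_kill: "U \<subseteq> U' \<Longrightarrow> kill U' (kill U p) = kill U' p"
proof -
  assume "U \<subseteq> U'"
  interpret comm_ring_hom "kill U'" by (rule comm_ring_hom_kill)
  have eq: "kill U' (if v \<in> U then 0 else Var v) = (if v \<in> U' then 0 else Var v)" for v
    using \<open>U \<subseteq> U'\<close> by (auto simp: kill_Var)
  show ?thesis
    unfolding kill_def[of U] peval_hom[OF comm_ring_hom_kill] kill_Const eq
    by (simp add: kill_def)
qed

lemma Var_nonzero: "(Var v :: 'k::field mpoly) \<noteq> 0"
  unfolding Var_def by (metis lookup_single_eq lookup_zero zero_neq_one)

lemma Var_inj: "(Var v :: 'k::field mpoly) = Var w \<Longrightarrow> v = w"
proof (rule ccontr)
  assume eq: "(Var v :: 'k mpoly) = Var w" and "v \<noteq> w"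
  have "kill {v} (Var v :: 'k mpoly) = kill {v} (Var w)" by (simp only: eq)
  then have "(Var w :: 'k mpoly) = 0" using \<open>v \<noteq> w\<close> unfolding kill_Var by simp
  then show False by (rule notE[OF Var_nonzero])
qed

definition prime_chain :: "nat \<Rightarrow> nat \<Rightarrow> 'k::field mpoly set \<Rightarrow> nat \<Rightarrow> bool" where
  "prime_chain n r Z d \<longleftrightarrow> (\<exists>P. (\<forall>i\<le>d. prime_in (coords n r) (P i)) \<and> Z \<subseteq> P 0 \<and>
     (\<forall>i<d. P i \<subset> P (Suc i)))"

text \<open>The primes are the kernels of the generic point \<open>x\<close> and of its specializations in which the
  parameters \<open>ps\<close> vanish one after the other.\<close>
lemma specialization_chain:
  fixes x :: "var \<Rightarrow> 'k::field mpoly" and Z :: "'k mpoly set"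
  assumes Z: "nongenerating_subscheme n r Z"
    and B: "invol_matrix_algebra n B" "B \<noteq> mat_pairs n"
      "\<And>k. k < r \<Longrightarrow> generic_tuple n (\<lambda>v. to_fract (x v)) k \<in> B"
    and step: "\<And>i. i < length ps \<Longrightarrow> \<exists>v\<in>vars n r.
      kill (set (take i ps)) (x v) \<noteq> 0 \<and> kill (set (take (Suc i) ps)) (x v) = 0"
  shows "prime_chain n r Z (length ps)"
proof -
  define \<theta> where "\<theta> i p = kill (set (take i ps)) (peval Const x p)" for i p
  define P where "P i = {p \<in> coords n r. \<theta> i p = 0}" for i
  interpret C: comm_ring_hom "Const :: 'k \<Rightarrow> 'k mpoly" by (rule comm_ring_hom_Const)
  have \<theta>: "comm_ring_hom (\<theta> i)" for i
    unfolding \<theta>_def by (rule comm_ring_hom_compose[OF comm_ring_hom_kill C.comm_ring_hom_peval])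
  have "prime_in (coords n r) (P i)" for i
  proof -
    interpret comm_ring_hom "\<theta> i" by (rule \<theta>)
    show ?thesis unfolding prime_in_def P_def
      by (auto simp: coords_0 coords_add coords_mult hom_add hom_mult)
  qed
  moreover have "Z \<subseteq> P 0"
  proof
    fix f assume f: "f \<in> Z"
    have tf: "comm_ring_hom (to_fract :: 'k mpoly \<Rightarrow> _)" by (unfold_locales, simp_all)
    have "ideal Z (coord_ring n r)" using Z by (simp add: nongenerating_subscheme_def)
    then have "f \<in> coords n r"
      using f additive_subgroup.a_subset ideal.axioms(1) coord_ring_simps(1) by blast
    \<comment> \<open>The field of fractions of the polynomial ring is an admissible extension, and
      the generic point lies in the subscheme because its tuple lies in the proper subalgebra
      \<open>B\<close>.\<close>
    have "peval (\<lambda>c. to_fract (Const c)) (\<lambda>v. to_fract (x v)) f = 0"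
      using nongenerating_subscheme_point[OF Z comm_ring_hom_compose[OF tf comm_ring_hom_Const] surj_Fract[OF surj_id]]
        f B by blast
    then have "peval Const x f = 0"
      using peval_hom[OF tf, of Const x f] by simp
    then show "f \<in> P 0" using \<open>f \<in> coords n r\<close> by (simp add: P_def \<theta>_def kill_empty)
  qed
  moreover have "P i \<subset> P (Suc i)" if i: "i < length ps" for i
  proof -
    have "\<theta> (Suc i) p = kill (set (take (Suc i) ps)) (\<theta> i p)" for p
      unfolding \<theta>_def by (rule kill_kill[symmetric]) (rule set_take_subset_set_take, simp)
    moreover have "kill U 0 = (0 :: 'k mpoly)" for U
      using comm_ring_hom_kill[of U] by (metis comm_ring_hom_def ring_hom.axioms(1) kill_Const C.hom_zero)
    ultimately have "P i \<subseteq> P (Suc i)" by (auto simp: P_def)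
    moreover obtain v where "v \<in> vars n r" "kill (set (take i ps)) (x v) \<noteq> 0"
        "kill (set (take (Suc i) ps)) (x v) = 0" using step[OF i] by blast
    \<comment> \<open>The coordinate that dies at step \<open>i\<close> separates the two
      kernels.\<close>
    then have "Var v \<in> P (Suc i) - P i" by (simp add: P_def \<theta>_def C.peval_Var coords_Var)
    ultimately show ?thesis by blast
  qed
  ultimately show ?thesis unfolding prime_chain_def by blast
qed

text \<open>For \<open>n = 1\<close> the involution interchanges two copies of the field, so the
  diagonal is a proper stable subalgebra. The generic tuple in it has \<open>r\<close> free entries,
  which vanish one by one.\<close>

lemma commuting_chain:
  fixes Z :: "'k::field mpoly set"
  assumes Z: "nongenerating_subscheme 1 r Z"
  shows "prime_chain 1 r Z r"
proof -
  define x :: "var \<Rightarrow> 'k mpoly" where "x = (\<lambda>(k, s, i, j). Var (k, False, 0, 0))"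
  define ps :: "var list" where "ps = map (\<lambda>k. (k, False, 0, 0)) [0..<r]"
  define B where "B = {(a, b). a \<in> carrier_mat 1 1 \<and> b \<in> carrier_mat 1 1 \<and>
      a $$ (0, 0) = (b $$ (0, 0) :: 'k mpoly fract)}"
  have "invol_matrix_algebra 1 B"
    by (auto simp: invol_matrix_algebra_def B_def scalar_prod_def)
  moreover have "B \<noteq> carrier_mat 1 1 \<times> carrier_mat 1 1"
  proof
    assume "B = carrier_mat 1 1 \<times> carrier_mat 1 1"
    then have "(0\<^sub>m 1 1, 1\<^sub>m 1) \<in> B" by simp
    then show False by (simp add: B_def)
  qed
  moreover have "generic_tuple 1 (\<lambda>v. to_fract (x v)) k \<in> B" for k
    by (simp add: generic_tuple_def B_def x_def)
  moreover have "\<exists>v\<in>vars 1 r. kill (set (take i ps)) (x v) \<noteq> 0 \<and> kill (set (take (Suc i) ps)) (x v) = 0"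
    if i: "i < length ps" for i
  proof (rule bexI)
    show "(i, False, 0, 0) \<in> vars 1 r" using i by (auto simp: vars_def ps_def)
    have "take j [0..<r] = [0..<min j r]" for j by (cases "j \<le> r") (auto simp: min_def)
    then have "set (take j ps) = (\<lambda>k. (k, False, 0, 0)) ` {..<min j r}" for j
      by (auto simp: ps_def take_map)
    then show "kill (set (take i ps)) (x (i, False, 0, 0)) \<noteq> 0 \<and>
        kill (set (take (Suc i) ps)) (x (i, False, 0, 0)) = 0"
      using i by (auto simp: x_def kill_Var Var_nonzero ps_def)
  qed
  moreover have "length ps = r" by (simp add: ps_def)
  ultimately show ?thesis
    using specialization_chain[OF Z, of B x ps] by simp
qed

text \<open>The involution exchanges the two membership conditions. The algebra is proper because
  the matrix unit at \<open>(1, 0)\<close> maps \<open>w\<close> to the second unit vector, which is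
  no multiple of \<open>w\<close> as \<open>w $ 0 = 1\<close>.\<close>

lemma eigenvector_algebra:
  fixes w :: "'f::field vec"
  assumes n: "n > 1" and w: "w \<in> carrier_vec n" "w $ 0 = 1"
  defines "E \<equiv> {a \<in> carrier_mat n n. \<exists>\<mu>. a *\<^sub>v w = \<mu> \<cdot>\<^sub>v w}"
  shows "invol_matrix_algebra n {(a, b). a \<in> E \<and> transpose_mat b \<in> E}"
    and "{(a, b). a \<in> E \<and> transpose_mat b \<in> E} \<noteq> mat_pairs n"
proof -
  let ?S = "{(a, b). a \<in> E \<and> transpose_mat b \<in> E}"
  have E_carr: "a \<in> carrier_mat n n" if "a \<in> E" for a using that by (simp add: E_def)
  have one: "1\<^sub>m n \<in> E" using w by (auto simp: E_def intro!: exI[of _ 1])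
  have add: "a + b \<in> E" if ab: "a \<in> E" "b \<in> E" for a b
  proof -
    obtain \<mu> \<nu> where "a *\<^sub>v w = \<mu> \<cdot>\<^sub>v w" "b *\<^sub>v w = \<nu> \<cdot>\<^sub>v w" using ab by (auto simp: E_def)
    then have "(a + b) *\<^sub>v w = (\<mu> + \<nu>) \<cdot>\<^sub>v w"
      using add_mult_distrib_mat_vec[OF E_carr[OF ab(1)] E_carr[OF ab(2)] w(1)]
      by (simp add: add_smult_distrib_vec)
    then show ?thesis using E_carr[OF ab(1)] E_carr[OF ab(2)] by (auto simp: E_def)
  qed
  have mult: "a * b \<in> E" if ab: "a \<in> E" "b \<in> E" for a b
  proof -
    obtain \<mu> \<nu> where "a *\<^sub>v w = \<mu> \<cdot>\<^sub>v w" "b *\<^sub>v w = \<nu> \<cdot>\<^sub>v w" using ab by (auto simp: E_def)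
    then have "(a * b) *\<^sub>v w = (\<nu> * \<mu>) \<cdot>\<^sub>v w"
      using assoc_mult_mat_vec[OF E_carr[OF ab(1)] E_carr[OF ab(2)] w(1)]
        mult_mat_vec[OF E_carr[OF ab(1)] w(1)] by (simp add: smult_smult_assoc)
    then show ?thesis using E_carr[OF ab(1)] E_carr[OF ab(2)] by (auto simp: E_def)
  qed
  have smult: "k \<cdot>\<^sub>m a \<in> E" if a: "a \<in> E" for a k
  proof -
    obtain \<mu> where \<mu>: "a *\<^sub>v w = \<mu> \<cdot>\<^sub>v w" using a by (auto simp: E_def)
    have "(k \<cdot>\<^sub>m a) *\<^sub>v w = k \<cdot>\<^sub>v (a *\<^sub>v w)"
      using E_carr[OF a] w(1) by (intro eq_vecI) auto
    then have "(k \<cdot>\<^sub>m a) *\<^sub>v w = (k * \<mu>) \<cdot>\<^sub>v w" by (simp add: \<mu> smult_smult_assoc)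
    then show ?thesis using E_carr[OF a] by (auto simp: E_def)
  qed
  have tr: "b \<in> carrier_mat n n" if "transpose_mat b \<in> E" for b using E_carr[OF that] by simp
  show "invol_matrix_algebra n ?S"
    unfolding invol_matrix_algebra_def
  proof (intro conjI allI impI)
    fix a b c d assume "(a, b) \<in> ?S"
      "(c, d) \<in> ?S"
    then show "(a + c, b + d) \<in> ?S"
      "(a * c, b * d) \<in> ?S"
      using tr by (auto simp: transpose_add[of _ n n] transpose_mult[of _ n n _ n] intro: add mult)
  next
    fix k a b assume "(a, b) \<in> ?S"
    moreover have "transpose_mat (k \<cdot>\<^sub>m b) = k \<cdot>\<^sub>m transpose_mat b" by (intro eq_matI) auto
    ultimately show "(k \<cdot>\<^sub>m a, k \<cdot>\<^sub>m b) \<in> ?S"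
      by (auto intro: smult)
  qed (use E_carr tr one in auto)
  have "unit_mat n 1 0 \<notin> E"
  proof
    assume "unit_mat n 1 0 \<in> E"
    then obtain \<mu> where \<mu>: "unit_mat n 1 0 *\<^sub>v w = \<mu> \<cdot>\<^sub>v w" by (auto simp: E_def)
    have "(unit_mat n 1 0 *\<^sub>v w) $ i = (if i = 1 then 1 else 0)" if i: "i < n" for i
    proof -
      have "(unit_mat n 1 0 *\<^sub>v w) $ i = (\<Sum>j\<in>{0..<n}. unit_mat n 1 0 $$ (i, j) * w $ j)"
        using i w by (auto simp: unit_mat_def scalar_prod_def)
      also have "\<dots> = (\<Sum>j\<in>{0..<n}. if j = 0 then if i = 1 then 1 else 0 else 0)"
        using i w(2) by (intro sum.cong refl) (auto simp: unit_mat_def)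
      finally have "(unit_mat n 1 0 *\<^sub>v w) $ i = (\<Sum>j\<in>{0..<n}. if j = 0 then if i = 1 then 1 else 0 else 0)" .
      then show ?thesis using n by simp
    qed
    from this[of 0] this[of 1] \<mu> w n have "\<mu> = 0" "\<mu> * w $ 1 = 1" by auto
    then show False by simp
  qed
  then show "?S \<noteq> mat_pairs n"
    using one by (metis (mono_tags, lifting) SigmaI case_prodD mem_Collect_eq one_carrier_mat
        unit_mat_carrier)
qed

text \<open>Coordinates of the tuples \<open>(a\<^sub>k, b\<^sub>k)\<close> such that all \<open>a\<^sub>k\<close> and \<open>b\<^sub>k\<^sup>t\<close> have the eigenvector \<open>ev\<close>.
  Free parameters are all entries of these \<open>2r\<close> matrices outside the first column, their upper
  left entries, and the coordinates of \<open>ev\<close> other than the first one. The variable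
  \<open>(0, False, i, 0)\<close>, which is no free entry for \<open>i > 0\<close>, serves as name of the \<open>i\<close>-th of them.\<close>
definition ev :: "nat \<Rightarrow> 'k::field mpoly" where
  "ev i = (if i = 0 then 1 else Var (0, False, i, 0))"

text \<open>The eigenvalue, read off as coordinate 0 of the matrix applied to \<open>ev\<close>,
  where \<open>ev 0 = 1\<close>.\<close>

definition ev_value :: "nat \<Rightarrow> nat \<Rightarrow> bool \<Rightarrow> 'k::field mpoly" where
  "ev_value n k s = Var (k, s, 0, 0) + (\<Sum>j\<in>{1..<n}. Var (k, s, 0, j) * ev j)"

text \<open>In the first column below the top, the entry is solved for from its row of the
  eigenvector equation. No division occurs because \<open>ev 0 = 1\<close>.\<close>

definition ev_entry :: "nat \<Rightarrow> nat \<Rightarrow> bool \<Rightarrow> nat \<Rightarrow> nat \<Rightarrow> 'k::field mpoly" where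
  "ev_entry n k s i j = (if j > 0 \<or> i = 0 then Var (k, s, i, j)
     else ev_value n k s * ev i - (\<Sum>l\<in>{1..<n}. Var (k, s, i, l) * ev l))"

text \<open>The indices are exchanged for \<open>s\<close>, since it is the transpose of the second
  component that has the eigenvector.\<close>

definition ev_point :: "nat \<Rightarrow> var \<Rightarrow> 'k::field mpoly" where
  "ev_point n = (\<lambda>(k, s, i, j). if s then ev_entry n k s j i else ev_entry n k s i j)"

lemma ev_entry_eigenvector:
  assumes "n > 0"
  shows "(\<Sum>j<n. ev_entry n k s i j * ev j) = ev_value n k s * ev i"
proof -
  have "{..<n} = insert 0 {1..<n}" using assms by auto
  then have "(\<Sum>j<n. ev_entry n k s i j * ev j) =
      ev_entry n k s i 0 * ev 0 + (\<Sum>j\<in>{1..<n}. ev_entry n k s i j * ev j)" by simp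
  also have "(\<Sum>j\<in>{1..<n}. ev_entry n k s i j * ev j) = (\<Sum>j\<in>{1..<n}. Var (k, s, i, j) * ev j)"
    by (intro sum.cong) (auto simp: ev_entry_def)
  finally have eq: "(\<Sum>j<n. ev_entry n k s i j * ev j) =
      ev_entry n k s i 0 * ev 0 + (\<Sum>j\<in>{1..<n}. Var (k, s, i, j) * ev j)" .
  have ev0: "ev 0 = 1" by (simp add: ev_def)
  show ?thesis unfolding eq by (cases "i = 0") (simp_all add: ev_entry_def ev_value_def ev0)
qed

lemma ev_point_nongenerating:
  assumes n: "n > 1"
  obtains B where "invol_matrix_algebra n B" "B \<noteq> mat_pairs n"
    "\<And>k. generic_tuple n (\<lambda>v. to_fract (ev_point n v :: 'k::field mpoly)) k \<in> B"
proof -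
  interpret tf: comm_ring_hom "to_fract :: 'k mpoly \<Rightarrow> _" by (unfold_locales, simp_all)
  define w :: "'k mpoly fract vec" where "w = vec n (\<lambda>i. to_fract (ev i))"
  have w: "w \<in> carrier_vec n" "w $ 0 = 1" using n by (auto simp: w_def ev_def)
  define E where "E = {a \<in> carrier_mat n n. \<exists>\<mu>. a *\<^sub>v w = \<mu> \<cdot>\<^sub>v w}"
  have mem: "mat n n (\<lambda>(i, j). to_fract (ev_entry n k s i j)) \<in> E" for k s
  proof -
    let ?m = "mat n n (\<lambda>(i, j). to_fract (ev_entry n k s i j))"
    have "?m *\<^sub>v w = to_fract (ev_value n k s) \<cdot>\<^sub>v w"
    proof (rule eq_vecI)
      fix i assume "i < dim_vec (to_fract (ev_value n k s) \<cdot>\<^sub>v w)"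
      then have i: "i < n" by (simp add: w_def)
      have "(?m *\<^sub>v w) $ i =
          (\<Sum>j<n. to_fract (ev_entry n k s i j) * to_fract (ev j))"
        using i by (auto simp: w_def scalar_prod_def lessThan_atLeast0 intro!: sum.cong)
      also have "\<dots> = to_fract (\<Sum>j<n. ev_entry n k s i j * ev j)"
        by (simp add: tf.hom_sum tf.hom_mult)
      also have "\<dots> = to_fract (ev_value n k s * ev i)"
        using n by (subst ev_entry_eigenvector) auto
      finally show "(?m *\<^sub>v w) $ i =
          (to_fract (ev_value n k s) \<cdot>\<^sub>v w) $ i"
        using i by (simp add: w_def tf.hom_mult)
    qed (simp add: w_def)
    then show ?thesis by (auto simp: E_def)
  qed
  have "generic_tuple n (\<lambda>v. to_fract (ev_point n v)) k \<in> {(a, b). a \<in> E \<and> transpose_mat b \<in> E}" for k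
  proof -
    have eqs: "mat n n (\<lambda>(i, j). to_fract (ev_point n (k, False, i, j))) =
        mat n n (\<lambda>(i, j). to_fract (ev_entry n k False i j))"
      "transpose_mat (mat n n (\<lambda>(i, j). to_fract (ev_point n (k, True, i, j)))) =
        mat n n (\<lambda>(i, j). to_fract (ev_entry n k True i j))"
      by (auto simp: ev_point_def intro!: eq_matI)
    show ?thesis unfolding generic_tuple_def mem_Collect_eq prod.case eqs using mem by blast
  qed
  then show ?thesis
    using that eigenvector_algebra[OF n w, folded E_def] by blast
qed

text \<open>When all free entries except the diagonal of the first matrix have vanished, its entry
  at \<open>(m, 0)\<close> is the difference of its diagonal entries at 0 and \<open>m\<close>,
  times the \<open>m\<close>-th coordinate of the eigenvector. So this diagonal is kept until the
  eigenvector has been specialized.\<close>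

lemma eigenvector_chain:
  fixes Z :: "'k::field mpoly set"
  assumes n: "n > 1" and r: "r \<ge> 1" and Z: "nongenerating_subscheme n r Z"
  shows "prime_chain n r Z (expected_dim n r)"
proof -
  define free where "free = {..<r} \<times> (UNIV :: bool set) \<times> ({..<n} \<times> {..<n} - {1..<n} \<times> {0})"
  define diag where "diag = (\<lambda>i. (0 :: nat, False, i, i)) ` {..<n}"
  define evs where "evs = (\<lambda>i. (0 :: nat, False, i, 0 :: nat)) ` {1..<n}"
  have fin: "finite free" "finite diag" "finite evs" by (auto simp: free_def diag_def evs_def)
  have diag_free: "diag \<subseteq> free" using r by (auto simp: diag_def free_def)
  have disj: "evs \<inter> free = {}" by (auto simp: evs_def free_def)
  obtain ps1 where ps1: "set ps1 = free - diag" "distinct ps1"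
    using finite_distinct_list[of "free - diag"] fin by auto
  obtain ps2 where ps2: "set ps2 = evs" "distinct ps2"
    using finite_distinct_list[of evs] fin by auto
  obtain ps3 where ps3: "set ps3 = diag" "distinct ps3"
    using finite_distinct_list[of diag] fin by auto
  define ps where "ps = ps1 @ ps2 @ ps3"
  have dist: "distinct ps" using ps1 ps2 ps3 diag_free disj by (auto simp: ps_def)
  have "length ps = card (set ps)" using distinct_card[OF dist] by simp
  also have "set ps = free \<union> evs" using ps1 ps2 ps3 diag_free by (auto simp: ps_def)
  also have "card \<dots> = card free + card evs" using fin disj by (intro card_Un_disjoint) auto
  also have "card evs = n - 1" unfolding evs_def by (subst card_image) (auto simp: inj_on_def)
  \<comment> \<open>Each of the 2r matrices has \<open>n * n\<close> entries, of which the
    \<open>n - 1\<close> in the first column below the top are determined by the others and the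
    eigenvector.\<close>
  also have "card free = r * (2 * (n * n - (n - 1)))"
  proof -
    have "card ({..<n} \<times> {..<n} - {1..<n} \<times> {0}) = n * n - (n - 1)"
      using n by (subst card_Diff_subset) (auto simp: card_cartesian_product)
    then show ?thesis by (simp add: free_def card_cartesian_product)
  qed
  finally have L: "length ps = r * (2 * (n * n - (n - 1))) + (n - 1)" .
  have n1: "int (n - 1) = int n - 1" using n by simp
  have "int (n * n - (n - 1)) = int n * int n - (int n - 1)"
    unfolding of_nat_diff[OF order_trans[OF diff_le_self le_square]] n1 by simp
  then have "int (length ps) = int r * (2 * (int n * int n - (int n - 1))) + (int n - 1)"
    unfolding L of_nat_add of_nat_mult n1 by (simp only: of_nat_numeral)
  also have "\<dots> = int (expected_dim n r)"
    unfolding int_expected_dim[OF n r] by (simp add: power2_eq_square algebra_simps)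
  finally have len: "length ps = expected_dim n r" by simp
  \<comment> \<open>Every free entry is itself a coordinate of the tuple, so its vanishing is
    detected directly.\<close>
  have ev_point_free: "\<exists>v\<in>vars n r. ev_point n v = (Var p :: 'k mpoly)" if pf: "p \<in> free" for p
  proof -
    obtain k s i j where p_eq: "p = (k, s, i, j)" by (metis surj_pair)
    then have "k < r" "i < n" "j < n" "j > 0 \<or> i = 0" using pf by (auto simp: free_def)
    note p = p_eq this
    show ?thesis
      by (rule bexI[of _ "if s then (k, s, j, i) else p"])
        (use p in \<open>auto simp: ev_point_def ev_entry_def vars_def\<close>)
  qed
  have step: "\<exists>v\<in>vars n r. kill (set (take i ps)) (ev_point n v :: 'k mpoly) \<noteq> 0 \<and>
      kill (set (take (Suc i) ps)) (ev_point n v :: 'k mpoly) = 0" if i: "i < length ps" for i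
  proof -
    let ?U = "set (take i ps)" and ?p = "ps ! i"
    have U': "set (take (Suc i) ps) = insert ?p ?U" using i by (simp add: take_Suc_conv_app_nth)
    have notU: "?p \<notin> ?U"
      using dist i by (metis distinct.simps(2) distinct_append id_take_nth_drop not_distinct_conv_prefix
          distinct_take take_Suc_conv_app_nth)
    show ?thesis
    proof (cases "?p \<in> free")
      case True
      then obtain v where "v \<in> vars n r" "ev_point n v = (Var ?p :: 'k mpoly)"
        using ev_point_free by blast
      then show ?thesis using notU unfolding U' by (intro bexI[of _ v]) (auto simp: kill_Var Var_nonzero)
    next
      case False
      then have p_evs: "?p \<in> evs" using i nth_mem[OF i] ps1 ps2 ps3 diag_free by (auto simp: ps_def)
      have "\<not> i < length ps1"
      proof
        assume "i < length ps1"
        then have "?p \<in> set ps1" by (simp add: ps_def nth_append)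
        then show False using ps1 False by simp
      qed
      moreover have "i < length ps1 + length ps2"
      proof (rule ccontr)
        assume "\<not> ?thesis"
        then have "?p = ps3 ! (i - length ps1 - length ps2)" "i - length ps1 - length ps2 < length ps3"
          using i by (auto simp: ps_def nth_append)
        then have "?p \<in> set ps3" by simp
        then show False using ps3 diag_free False by auto
      qed
      \<comment> \<open>The position lies in the middle block: the free entries outside
        \<open>diag\<close> are already zero, while those in \<open>diag\<close> are still
        alive.\<close>
      ultimately have U_eq: "?U = free - diag \<union> set (take (i - length ps1) ps2)"
        using ps1 by (simp add: ps_def)
      have off: "v \<in> ?U" if "v \<in> free - diag" for v using that U_eq by blast
      have "set (take (i - length ps1) ps2) \<subseteq> evs" using ps2(1) set_take_subset by fast
      then have on: "v \<notin> ?U" if "v \<in> diag" for v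
        using that U_eq diag_free disj by blast
      obtain m where m: "?p = (0, False, m, 0)" "0 < m" "m < n" using p_evs by (auto simp: evs_def)
      \<comment> \<open>A general \<open>U\<close> covers both the state before \<open>?p\<close>
        vanishes, where the product is nonzero, and the state after, where its last factor is
        zero.\<close>
      have val: "kill U (ev_point n ?p :: 'k mpoly) =
          (Var (0, False, 0, 0) - Var (0, False, m, m)) * kill U (Var ?p)"
        if U: "?U \<subseteq> U" "diag \<inter> U = {}" for U
      proof -
        interpret comm_ring_hom "kill U :: 'k mpoly \<Rightarrow> 'k mpoly" by (rule comm_ring_hom_kill)
        have 0: "kill U (Var (0, False, 0, j) :: 'k mpoly) = 0" if "j \<in> {1..<n}" for j
        proof -
          have "(0, False, 0, j) \<in> free - diag" using that r n by (auto simp: free_def diag_def)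
          then have "(0, False, 0, j) \<in> U" using off U(1) by blast
          then show ?thesis by (simp add: kill_Var)
        qed
        have 1: "kill U (Var (0, False, m, j) :: 'k mpoly) = (if j = m then Var (0, False, m, m) else 0)"
          if "j \<in> {1..<n}" for j
        proof (cases "j = m")
          case True
          have "(0, False, m, m) \<in> diag" using m by (auto simp: diag_def)
          then have "(0, False, m, m) \<notin> U" using U(2) by blast
          then show ?thesis using True by (simp add: kill_Var)
        next
          case False
          have "(0, False, m, j) \<in> free - diag" using that False r m by (auto simp: free_def diag_def)
          then have "(0, False, m, j) \<in> U" using off U(1) by blast
          then show ?thesis using False by (simp add: kill_Var)
        qed
        have "(0, False, 0, 0) \<in> diag" using n by (auto simp: diag_def)
        then have "(0, False, 0, 0) \<notin> U" using U(2) by blast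
        then have 2: "kill U (Var (0, False, 0, 0) :: 'k mpoly) = Var (0, False, 0, 0)"
          by (simp add: kill_Var)
        have "kill U (ev_value n 0 False :: 'k mpoly) = Var (0, False, 0, 0)"
          by (simp add: ev_value_def hom_add hom_sum hom_mult 0 2 del: One_nat_def)
        moreover have "kill U (\<Sum>l\<in>{1..<n}. Var (0, False, m, l) * ev l :: 'k mpoly) =
            (\<Sum>l\<in>{1..<n}. if l = m then Var (0, False, m, m) * kill U (ev m) else 0)"
          unfolding hom_sum hom_mult by (intro sum.cong) (auto simp: 1 simp del: One_nat_def)
        ultimately show ?thesis
          using m by (simp add: ev_point_def ev_entry_def hom_minus hom_mult ev_def left_diff_distrib
              del: One_nat_def)
      qed
      have dU: "diag \<inter> ?U = {}" using on by blast
      have dI: "diag \<inter> insert ?p ?U = {}" using on False diag_free by blast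
      \<comment> \<open>As \<open>0 < m\<close>, the two diagonal variables are distinct, so their
        difference is nonzero.\<close>
      have "kill ?U (ev_point n ?p :: 'k mpoly) \<noteq> 0"
        unfolding val[OF order_refl dU] using notU Var_inj[of "(0, False, 0, 0)" "(0, False, m, m)"] m
        by (auto simp: kill_Var Var_nonzero)
      moreover have "kill (insert ?p ?U) (ev_point n ?p :: 'k mpoly) = 0"
        unfolding val[OF subset_insertI dI] by (simp add: kill_Var)
      moreover have "?p \<in> vars n r" using m r by (auto simp: vars_def)
      ultimately show ?thesis unfolding U' by blast
    qed
  qed
  obtain B where "invol_matrix_algebra n B" "B \<noteq> mat_pairs n"
    "\<And>k. generic_tuple n (\<lambda>v. to_fract (ev_point n v :: 'k mpoly)) k \<in> B"
    using ev_point_nongenerating[OF n] by metis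
  then show ?thesis
    using specialization_chain[OF Z _ _ _ step] unfolding len by blast
qed

theorem theorem1p1:
  fixes n r :: nat and Z :: "'k::field mpoly set"
  assumes "infinite (UNIV :: 'k set)"
    and "n \<ge> 1" and "r \<ge> 1"
    and "nongenerating_subscheme n r Z"
  shows "subscheme_dim n r Z =
    ereal (if n > 1 then 2 * real r * (real n)\<^sup>2 - (2 * real r - 1) * (real n - 1) else real r)"
proof -
  let ?R = "coord_ring n r :: 'k mpoly ring"
  let ?chains = "{ereal (real d) | d. \<exists>P. (\<forall>i\<le>d. primeideal (P i) ?R \<and> Z \<subseteq> P i) \<and> (\<forall>i<d. P i \<subset> P (Suc i))}"
  have "ideal Z ?R" using assms(4) by (simp add: nongenerating_subscheme_def)
  then have dim: "subscheme_dim n r Z = Sup ?chains"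
    unfolding subscheme_dim_def by (rule krull_dim_quot[OF cring_coord_ring])
  have "prime_chain n r Z (expected_dim n r)"
  proof (cases "n = 1")
    case True
    then show ?thesis using commuting_chain[of r Z] assms(4) by (simp add: expected_dim_def)
  next
    case False
    then show ?thesis using eigenvector_chain[OF _ assms(3,4)] assms(2) by simp
  qed
  then obtain P where P: "\<And>i. i \<le> expected_dim n r \<Longrightarrow> prime_in (coords n r) (P i)" "Z \<subseteq> P 0"
    "\<And>i. i < expected_dim n r \<Longrightarrow> P i \<subset> P (Suc i)"
    unfolding prime_chain_def by blast
  \<comment> \<open>Only the smallest prime was required to contain \<open>Z\<close>; the others
    inherit this along the chain.\<close>
  have "Z \<subseteq> P i" if "i \<le> expected_dim n r" for i
    using that
  proof (induction i)
    case (Suc i)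
    then show ?case using P(3)[of i] by auto
  qed (use P(2) in simp)
  then have "ereal (real (expected_dim n r)) \<in> ?chains"
    using P(1,3) unfolding primeideal_coord_ring by blast
  moreover have "e \<le> ereal (real (expected_dim n r))" if "e \<in> ?chains" for e
  proof -
    obtain d Q where d: "e = ereal (real d)" "\<And>i. i \<le> d \<Longrightarrow> prime_in (coords n r) (Q i)"
      "\<And>i. i \<le> d \<Longrightarrow> Z \<subseteq> Q i" "\<And>i. i < d \<Longrightarrow> Q i \<subset> Q (Suc i)"
      using \<open>e \<in> ?chains\<close> unfolding primeideal_coord_ring by blast
    have "d \<le> expected_dim n r"
      by (rule prime_chain_length_le[OF assms(2-4) d(2) d(3)[of 0] d(4)]) auto
    then show ?thesis using d(1) by simp
  qed
  ultimately have "subscheme_dim n r Z = ereal (real (expected_dim n r))"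
    unfolding dim by (intro antisym Sup_least Sup_upper)
  also have "real (expected_dim n r) =
      (if n > 1 then 2 * real r * (real n)\<^sup>2 - (2 * real r - 1) * (real n - 1) else real r)"
  proof (cases "n > 1")
    case True
    have "real_of_int (int (expected_dim n r)) =
        real_of_int (2 * int r * (int n)\<^sup>2 - (2 * int r - 1) * (int n - 1))"
      by (simp only: int_expected_dim[OF True assms(3)])
    then show ?thesis using True by simp
  qed (simp add: expected_dim_def)
  finally show ?thesis .
qed

end
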